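(* Let $M\in\mathbb{R}^{d\times d}$ be invertible. Then $$\theta_M\in M^{1,\infty}(\mathbb{R}^{2d})\cap W(\mathcal{F}L^1,L^\infty)(\mathbb{R}^{2d}).$$ Furthermore, let $f\in\mathcal{S}'(\mathbb{R}^d)$. Then, for all $1\le p,q\le\infty$, $$Wf\in M^{p,q}(\mathbb{R}^{2d})\iff \mathcal{B}_{A_M}f\in M^{p,q}(\mathbb{R}^{2d}).$$
   Context: $A_M=\begin{pmatrix} I & M+\frac12 I\\ I & M-\frac12 I\end{pmatrix}\in\mathrm{GL}(2d,\mathbb{R})$. For $A\in\mathrm{GL}(2d,\mathbb{R})$ and $f,g\in\mathcal{S}'(\mathbb{R}^d)$, $\mathcal{B}_A(f,g)=\mathcal{F}_2\mathfrak{T}_A(f\otimes\overline g)\in\mathcal{S}'(\mathbb{R}^{2d})$, where $\mathfrak{T}_AF(z)=F(Az)$ and $\mathcal{F}_2F(x,\omega)=\int e^{-2\pi i\omega\cdot t}F(x,t)\,dt$ (both extended to $\mathcal{S}'(\mathbb{R}^{2d})$); for nice $f,g$ this is $\int e^{-2\pi i\omega\cdot y}f(A_{11}x+A_{12}y)\overline{g(A_{21}x+A_{22}y)}\,dy$, with $A_{ij}$ the $d\times d$ blocks of $A$. $\mathcal{B}_Af=\mathcal{B}_A(f,f)$. The Wigner distribution is $Wf=\mathcal{B}_{A_0}f$, i.e. the case $M=0$. $\theta_M=\mathcal{F}_\sigma\chi_M\in\mathcal{S}'(\mathbb{R}^{2d})$, with $\chi_M(\xi,\eta)=e^{2\pi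 i\eta\cdot M\xi}$ and symplectic Fourier transform $\mathcal{F}_\sigma F(x,\omega)=\mathcal{F}F(\omega,-x)$, where $\mathcal{F}F(z)=\int e^{-2\pi iz\cdot w}F(w)\,dw$. For $n\ge1$, fixed $0\neq G\in\mathcal{S}(\mathbb{R}^n)$, and $u\in\mathcal{S}'(\mathbb{R}^n)$, let $V_Gu(z,\zeta)=\langle u,M_\zeta T_zG\rangle$ ($\langle\cdot,\cdot\rangle$ extends the $L^2$ inner product, conjugate-linear in the second entry; $T_zG(t)=G(t-z)$, $M_\zeta G(t)=e^{2\pi it\cdot\zeta}G(t)$). $M^{p,q}(\mathbb{R}^n)$ is the set of $u\in\mathcal{S}'(\mathbb{R}^n)$ with $\big(\int(\int|V_Gu(z,\zeta)|^p\,dz)^{q/p}d\zeta\big)^{1/q}<\infty$; $W(\mathcal{F}L^p,L^q)(\mathbb{R}^n)$ is the set of $u\in\mathcal{S}'(\mathbb{R}^n)$ with $\big(\int(\int|V_Gu(z,\zeta)|^p\,d\zeta)^{q/p}dz\big)^{1/q}<\infty$ (usual modifications for infinite exponents; the spaces do not depend on $G$). *)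

theory Defs
  imports "HOL-Analysis.Analysis" "HOL-Probability.Essential_Supremum"
begin

section \<open>Schwartz functions and tempered distributions\<close>

primrec iter_deriv ::
    "'a::euclidean_space list \<Rightarrow> ('a \<Rightarrow> complex) \<Rightarrow> 'a \<Rightarrow> complex" where
  "iter_deriv [] \<phi> = \<phi>"
| "iter_deriv (v # vs) \<phi> = (\<lambda>x. frechet_derivative (iter_deriv vs \<phi>) (at x) v)"

definition schwartz_space :: "('a::euclidean_space \<Rightarrow> complex) set" where
  "schwartz_space = {\<phi>. \<forall>vs \<in> lists Basis.
     (\<forall>x. iter_deriv vs \<phi> differentiable (at x)) \<and>
     (\<forall>k::nat. \<exists>C. \<forall>x. (1 + norm x) ^ k * norm (iter_deriv vs \<phi> x) \<le> C)}"

definition schwartz_seminorm :: "nat \<Rightarrow> ('a::euclidean_space \<Rightarrow> complex) \<Rightarrow> real" where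
  "schwartz_seminorm N \<phi> =
     (\<Sum>vs \<in> {vs \<in> lists Basis. length vs \<le> N}.
        SUP x. (1 + norm x) ^ N * norm (iter_deriv vs \<phi> x))"

text \<open>
  A tempered distribution is a continuous (complex-)linear functional on the Schwartz space.
  Functionals are represented by total HOL functions; their values outside the Schwartz space
  carry no meaning, and all operations below evaluate a tempered distribution at Schwartz
  functions only.  A function F of polynomial growth is the functional \<open>\<phi> \<mapsto> \<integral> F \<phi>\<close>.
\<close>

type_synonym 'a distr = "('a \<Rightarrow> complex) \<Rightarrow> complex"

definition tempered_distributions :: "'a::euclidean_space distr set" where
  "tempered_distributions = {u.
     (\<forall>\<phi> \<in> schwartz_space. \<forall>\<psi> \<in> schwartz_space. u (\<lambda>x. \<phi> x + \<psi> x) = u \<phi> + u \<psi>) \<and>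
     (\<forall>c. \<forall>\<phi> \<in> schwartz_space. u (\<lambda>x. c * \<phi> x) = c * u \<phi>) \<and>
     (\<exists>C N. \<forall>\<phi> \<in> schwartz_space. norm (u \<phi>) \<le> C * schwartz_seminorm N \<phi>)}"

definition distr_of_fun :: "('a::euclidean_space \<Rightarrow> complex) \<Rightarrow> 'a distr" where
  "distr_of_fun F = (\<lambda>\<phi>. LINT x|lborel. F x * \<phi> x)"

text \<open>The extension of the \<open>L\<^sup>2\<close> inner product, conjugate-linear in the second entry.\<close>

definition distr_inner :: "'a distr \<Rightarrow> ('a \<Rightarrow> complex) \<Rightarrow> complex" where
  "distr_inner u \<phi> = u (\<lambda>x. cnj (\<phi> x))"

definition distr_cnj :: "'a distr \<Rightarrow> 'a distr" where
  "distr_cnj u = (\<lambda>\<phi>. cnj (u (\<lambda>x. cnj (\<phi> x))))"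

definition distr_tensor :: "'a distr \<Rightarrow> 'b distr \<Rightarrow> ('a \<times> 'b) distr" where
  "distr_tensor u v = (\<lambda>\<phi>. u (\<lambda>x. v (\<lambda>y. \<phi> (x, y))))"


section \<open>Fourier transforms\<close>

definition fourier :: "('a::euclidean_space \<Rightarrow> complex) \<Rightarrow> 'a \<Rightarrow> complex" where
  "fourier F z = (LINT w|lborel. cis (- (2 * pi * (z \<bullet> w))) * F w)"

definition partial_fourier2 ::
    "('a \<times> 'b::euclidean_space \<Rightarrow> complex) \<Rightarrow> 'a \<times> 'b \<Rightarrow> complex" where
  "partial_fourier2 F = (\<lambda>(x, \<omega>). LINT t|lborel. cis (- (2 * pi * (\<omega> \<bullet> t))) * F (x, t))"

text \<open>The extensions to distributions are the transposes of the transforms on Schwartz functions.\<close>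

definition distr_fourier :: "'a::euclidean_space distr \<Rightarrow> 'a distr" where
  "distr_fourier u = (\<lambda>\<phi>. u (fourier \<phi>))"

definition distr_partial_fourier2 :: "('a \<times> 'b::euclidean_space) distr \<Rightarrow> ('a \<times> 'b) distr" where
  "distr_partial_fourier2 u = (\<lambda>\<phi>. u (partial_fourier2 \<phi>))"

text \<open>
  For a function F, the symplectic Fourier transform is \<open>(x, \<omega>) \<mapsto> fourier F (\<omega>, -x)\<close>.
  The substitution \<open>(a, b) = (\<omega>, -x)\<close> turns a test function \<open>\<phi> (x, \<omega>)\<close> into \<open>\<phi> (-b, a)\<close>.
\<close>

definition distr_symplectic_fourier ::
    "('a::euclidean_space \<times> 'a) distr \<Rightarrow> ('a \<times> 'a) distr" where
  "distr_symplectic_fourier u = (\<lambda>\<phi>. distr_fourier u (\<lambda>(a, b). \<phi> (- b, a)))"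


section \<open>Bilinear time-frequency distributions\<close>

text \<open>
  \<open>\<real>\<^bsup>2d\<^esup>\<close> is \<open>(real^'d) \<times> (real^'d)\<close>; a \<open>2d \<times> 2d\<close> matrix is indexed by \<open>'d + 'd\<close>, with
  \<open>Inl\<close> and \<open>Inr\<close> indexing the first and the second block.
\<close>

definition vec_join :: "(real^'d) \<times> (real^'d) \<Rightarrow> real^('d + 'd)" where
  "vec_join z = (\<chi> i. case i of Inl a \<Rightarrow> fst z $ a | Inr b \<Rightarrow> snd z $ b)"

definition vec_split :: "real^('d + 'd) \<Rightarrow> (real^'d) \<times> (real^'d)" where
  "vec_split v = ((\<chi> a. v $ Inl a), (\<chi> b. v $ Inr b))"

definition mat_apply :: "real^('d + 'd)^('d + 'd) \<Rightarrow> (real^'d) \<times> (real^'d) \<Rightarrow> (real^'d) \<times> (real^'d)" where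
  "mat_apply A z = vec_split (A *v vec_join z)"

definition block_matrix ::
    "real^'d^'d \<Rightarrow> real^'d^'d \<Rightarrow> real^'d^'d \<Rightarrow> real^'d^'d \<Rightarrow> real^('d + 'd)^('d + 'd)" where
  "block_matrix A11 A12 A21 A22 = (\<chi> i j.
     case i of
       Inl a \<Rightarrow> (case j of Inl b \<Rightarrow> A11 $ a $ b | Inr b \<Rightarrow> A12 $ a $ b)
     | Inr a \<Rightarrow> (case j of Inl b \<Rightarrow> A21 $ a $ b | Inr b \<Rightarrow> A22 $ a $ b))"

lemma mat_apply_block_matrix:
  fixes x y :: "real^'d"
  shows "mat_apply (block_matrix A11 A12 A21 A22) (x, y) =
     (A11 *v x + A12 *v y, A21 *v x + A22 *v y)"
proof -
  have sum_Plus: "sum h UNIV = (\<Sum>a\<in>UNIV. h (Inl a)) + (\<Sum>b\<in>UNIV. h (Inr b))"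
    for h :: "'d + 'd \<Rightarrow> real"
    using sum.Plus[of "UNIV :: 'd set" "UNIV :: 'd set" h] by (simp add: comp_def)
  show ?thesis
    by (simp add: mat_apply_def vec_split_def vec_join_def block_matrix_def
        matrix_vector_mult_def vec_eq_iff sum_Plus)
qed

text \<open>
  For a function F and invertible A,
  \<open>\<integral> F (A z) \<phi> z dz = \<integral> F w \<bar>det A\<bar>\<^sup>-\<^sup>1 \<phi> (A\<^sup>-\<^sup>1 w) dw\<close>.
\<close>

definition distr_matrix_comp ::
    "real^('d + 'd)^('d + 'd) \<Rightarrow> ((real^'d) \<times> (real^'d)) distr \<Rightarrow> ((real^'d) \<times> (real^'d)) distr" where
  "distr_matrix_comp A u =
     (\<lambda>\<phi>. u (\<lambda>w. complex_of_real (inverse \<bar>det A\<bar>) * \<phi> (mat_apply (matrix_inv A) w)))"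

definition bilinear_tf ::
    "real^('d + 'd)^('d + 'd) \<Rightarrow> (real^'d) distr \<Rightarrow> (real^'d) distr \<Rightarrow> ((real^'d) \<times> (real^'d)) distr"
  where
  "bilinear_tf A f g =
     distr_partial_fourier2 (distr_matrix_comp A (distr_tensor f (distr_cnj g)))"

definition A_mat :: "real^'d^'d \<Rightarrow> real^('d + 'd)^('d + 'd)" where
  "A_mat M = block_matrix (mat 1) (M + (1/2) *\<^sub>R mat 1) (mat 1) (M - (1/2) *\<^sub>R mat 1)"

definition wigner :: "(real^'d) distr \<Rightarrow> ((real^'d) \<times> (real^'d)) distr" where
  "wigner f = bilinear_tf (A_mat 0) f f"

definition chi :: "real^'d^'d \<Rightarrow> (real^'d) \<times> (real^'d) \<Rightarrow> complex" where
  "chi M = (\<lambda>(\<xi>, \<eta>). cis (2 * pi * (\<eta> \<bullet> (M *v \<xi>))))"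

definition theta :: "real^'d^'d \<Rightarrow> ((real^'d) \<times> (real^'d)) distr" where
  "theta M = distr_symplectic_fourier (distr_of_fun (chi M))"


section \<open>Modulation spaces and Wiener amalgam spaces\<close>

definition translation :: "'a::euclidean_space \<Rightarrow> ('a \<Rightarrow> complex) \<Rightarrow> 'a \<Rightarrow> complex" where
  "translation z G = (\<lambda>t. G (t - z))"

definition frequency_shift :: "'a::euclidean_space \<Rightarrow> ('a \<Rightarrow> complex) \<Rightarrow> 'a \<Rightarrow> complex" where
  "frequency_shift \<zeta> G = (\<lambda>t. cis (2 * pi * (t \<bullet> \<zeta>)) * G t)"

definition stft :: "('a::euclidean_space \<Rightarrow> complex) \<Rightarrow> 'a distr \<Rightarrow> 'a \<Rightarrow> 'a \<Rightarrow> complex" where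
  "stft G u z \<zeta> = distr_inner u (frequency_shift \<zeta> (translation z G))"

text \<open>The power function on \<open>[0, \<infinity>]\<close> for exponents \<open>r > 0\<close>.\<close>

definition ennpowr :: "ennreal \<Rightarrow> real \<Rightarrow> ennreal" where
  "ennpowr x r = (if x = \<infinity> then \<infinity> else ennreal (enn2real x powr r))"

definition Lp_norm :: "ennreal \<Rightarrow> ('a::euclidean_space \<Rightarrow> ennreal) \<Rightarrow> ennreal" where
  "Lp_norm p h =
     (if p = \<infinity> then esssup lborel h
      else ennpowr (\<integral>\<^sup>+ x. ennpowr (h x) (enn2real p) \<partial>lborel) (1 / enn2real p))"

text \<open>Both families of spaces are taken with respect to a window G, a nonzero Schwartz function.\<close>

definition modulation_space ::
    "('a::euclidean_space \<Rightarrow> complex) \<Rightarrow> ennreal \<Rightarrow> ennreal \<Rightarrow> 'a distr set" where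
  "modulation_space G p q = {u \<in> tempered_distributions.
     Lp_norm q (\<lambda>\<zeta>. Lp_norm p (\<lambda>z. ennreal (norm (stft G u z \<zeta>)))) < \<infinity>}"

definition wiener_amalgam ::
    "('a::euclidean_space \<Rightarrow> complex) \<Rightarrow> ennreal \<Rightarrow> ennreal \<Rightarrow> 'a distr set" where
  "wiener_amalgam G p q = {u \<in> tempered_distributions.
     Lp_norm q (\<lambda>z. Lp_norm p (\<lambda>\<zeta>. ennreal (norm (stft G u z \<zeta>)))) < \<infinity>}"

end

theory Submission
  imports Defs "HOL-Probability.Probability"
begin

text \<open>
  The matrices differ by a shear: the matrix for \<open>M\<close> sends \<open>(x, y)\<close> to the value that the matrix for \<open>0\<close>
  takes at \<open>(x + M y, y)\<close>, and a shear has determinant one.  Tested against \<open>\<phi>\<close>, the distribution for \<open>M\<close> is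
  therefore the Wigner distribution tested against \<open>T \<phi>\<close>, where \<open>T\<close> conjugates the shear
  \<open>(x, t) \<mapsto> (x - M t, t)\<close> by the Fourier transform in the second variable (\<open>bilinear_tf_A_mat\<close>).  This is an
  identity between the test functions that enter the tensor product of \<open>f\<close> with its conjugate, so the tensor
  product itself need not be analysed; even temperedness passes from one distribution to the other
  through the continuity of \<open>T\<close> on the Schwartz space.

  \<open>T\<close> is the Fourier multiplier with symbol \<open>exp (- 2 \<pi> \<i> \<xi> \<bullet> M \<eta>)\<close>.  It commutes with translations, and since
  the symbol is a character of second degree, moving \<open>T\<close> past the modulation by \<open>\<zeta>\<close> costs only a phase and a
  translation that is linear in \<open>\<zeta>\<close> (\<open>shear_multiplier_tf_atom\<close>).  Hence the
  short-time Fourier transform of \<open>u \<circ> T\<close> with window \<open>G\<close> has at \<open>(z, \<zeta>)\<close> the modulus of that of \<open>u\<close> with another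
  window \<open>G'\<close> at \<open>(z - L \<zeta>, \<zeta>)\<close>.  The inner norm integrates over \<open>z\<close> with \<open>\<zeta>\<close> fixed and does not see the
  translation, so only the change of window from \<open>G'\<close> to \<open>G\<close> remains.  The converse implication is the
  same statement for \<open>- M\<close>.

  For the change of window, \<open>G'\<close> is written as a superposition of time-frequency shifts of \<open>G\<close> with a Schwartz
  density; the density is a partial Fourier transform and the formula is Fourier inversion
  (\<open>stft_change_window\<close>).  A tempered distribution may be moved under the integral because Riemann sums
  converge in every Schwartz seminorm at once (\<open>tempered_integral\<close>).  The short-time Fourier transform for
  \<open>G'\<close> is then dominated by a convolution of that for \<open>G\<close> with an integrable function, and Minkowski's integral
  inequality (\<open>Lp_norm_integral_le\<close>), applied once for each variable, bounds the mixed norm.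

  For \<open>\<theta>\<^sub>M\<close>, polarising the quadratic phase \<open>\<chi>\<^sub>M\<close> shows that the modulus of the short-time Fourier transform at
  \<open>(z, \<zeta>)\<close> is that of one fixed Schwartz function at \<open>\<Lambda>\<^sub>1 z + \<Lambda>\<^sub>2 \<zeta>\<close> with linear maps \<open>\<Lambda>\<^sub>1\<close> and \<open>\<Lambda>\<^sub>2\<close>
  (\<open>norm_stft_theta\<close>).  The map \<open>\<Lambda>\<^sub>1\<close> is bijective, and \<open>\<Lambda>\<^sub>2\<close> is bijective because \<open>M\<close> is invertible, so the
  integral over either variable is finite and does not depend on the other one.

  All of this rests on the continuity of the partial Fourier transform on the Schwartz space, which is
  obtained by coinduction over classes of operators (\<open>schwartz_continuous_coinduct\<close>).
\<close>

section \<open>The Schwartz space and its continuous operators\<close>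

definition dir_deriv :: "'a::euclidean_space \<Rightarrow> ('a \<Rightarrow> complex) \<Rightarrow> 'a \<Rightarrow> complex" where
  "dir_deriv v \<phi> = (\<lambda>x. frechet_derivative \<phi> (at x) v)"

lemma iter_deriv_Cons: "iter_deriv (v # vs) \<phi> = dir_deriv v (iter_deriv vs \<phi>)"
  by (simp add: dir_deriv_def)

lemma iter_deriv_append: "iter_deriv (vs @ ws) \<phi> = iter_deriv vs (iter_deriv ws \<phi>)"
  by (induction vs) auto

lemma dir_deriv_eqI: "(\<And>x. (\<phi> has_derivative \<phi>' x) (at x)) \<Longrightarrow> dir_deriv v \<phi> = (\<lambda>x. \<phi>' x v)"
  unfolding dir_deriv_def using frechet_derivative_at by metis

lemma schwartz_differentiable: "\<phi> \<in> schwartz_space \<Longrightarrow> \<phi> differentiable (at x)"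
  unfolding schwartz_space_def by (auto dest!: bspec[of _ _ "[]"])

lemma schwartz_has_derivative:
  "\<phi> \<in> schwartz_space \<Longrightarrow> (\<phi> has_derivative (\<lambda>v. dir_deriv v \<phi> x)) (at x)"
  using schwartz_differentiable[of \<phi> x] by (simp add: dir_deriv_def frechet_derivative_works eta_contract_eq)

lemma schwartz_continuous_on: "\<phi> \<in> schwartz_space \<Longrightarrow> continuous_on A \<phi>"
  by (meson continuous_at_imp_continuous_on differentiable_imp_continuous_within schwartz_differentiable)

lemma schwartz_borel: "\<phi> \<in> schwartz_space \<Longrightarrow> \<phi> \<in> borel_measurable borel"
  by (intro borel_measurable_continuous_onI schwartz_continuous_on)

lemma iter_deriv_in_schwartz:
  assumes "\<phi> \<in> schwartz_space" "vs \<in> lists Basis"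
  shows "iter_deriv vs \<phi> \<in> schwartz_space"
  unfolding schwartz_space_def
proof (rule CollectI, rule ballI, intro conjI allI)
  fix ws :: "'a list" assume "ws \<in> lists Basis"
  then have "ws @ vs \<in> lists Basis" using assms(2) by auto
  with assms(1) have *: "(\<forall>x. iter_deriv (ws @ vs) \<phi> differentiable (at x)) \<and>
      (\<forall>k. \<exists>C. \<forall>x. (1 + norm x) ^ k * norm (iter_deriv (ws @ vs) \<phi> x) \<le> C)"
    unfolding schwartz_space_def by blast
  show "iter_deriv ws (iter_deriv vs \<phi>) differentiable (at x)" for x
    using * by (simp add: iter_deriv_append)
  show "\<exists>C. \<forall>x. (1 + norm x) ^ k * norm (iter_deriv ws (iter_deriv vs \<phi>) x) \<le> C" for k
    using * by (simp add: iter_deriv_append)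
qed

lemma dir_deriv_in_schwartz:
  "\<phi> \<in> schwartz_space \<Longrightarrow> b \<in> Basis \<Longrightarrow> dir_deriv b \<phi> \<in> schwartz_space"
  using iter_deriv_in_schwartz[of \<phi> "[b]"] by (simp add: dir_deriv_def)

text \<open>
  The Schwartz space is the largest set of differentiable, rapidly decreasing functions that is
  stable under the coordinate derivatives, so membership can be shown by exhibiting a stable set.
  This replaces inductions over iterated derivatives.
\<close>

lemma schwartz_coinduct:
  assumes "\<phi> \<in> X"
    and "\<And>\<psi> x. \<psi> \<in> X \<Longrightarrow> \<psi> differentiable (at x)"
    and "\<And>\<psi> k. \<psi> \<in> X \<Longrightarrow> \<exists>C. \<forall>x. (1 + norm x) ^ k * norm (\<psi> x) \<le> C"
    and "\<And>\<psi> b. \<psi> \<in> X \<Longrightarrow> b \<in> Basis \<Longrightarrow> dir_deriv b \<psi> \<in> X"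
  shows "\<phi> \<in> schwartz_space"
proof -
  have "iter_deriv vs \<phi> \<in> X" if "vs \<in> lists Basis" for vs
    using that by (induction vs) (auto simp: assms iter_deriv_Cons simp del: iter_deriv.simps(2))
  then show ?thesis unfolding schwartz_space_def using assms(2,3) by blast
qed

subsection \<open>Bounds by seminorms\<close>

lemma power_norm_pair_le: "(1 + norm z) ^ k \<le> (1 + norm (fst z)) ^ k * (1 + norm (snd z)) ^ k"
proof -
  have "norm z \<le> norm (fst z) + norm (snd z)" by (cases z) (simp add: norm_Pair_le)
  also have "1 + \<dots> \<le> (1 + norm (fst z)) * (1 + norm (snd z))" by (simp add: algebra_simps)
  finally show ?thesis unfolding power_mult_distrib[symmetric] by (intro power_mono) auto
qed

lemma power_norms_le_pair: "(1 + norm x) ^ j * (1 + norm y) ^ k \<le> (1 + norm (x, y)) ^ (j + k)"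
  unfolding power_add using norm_fst_le[of x y] norm_snd_le[of y x] by (intro mult_mono power_mono) auto

lemma finite_derivative_lists: "finite {vs \<in> lists (Basis::'a::euclidean_space set). length vs \<le> N}"
proof -
  have "{vs \<in> lists (Basis::'a set). length vs \<le> N} = {vs. set vs \<subseteq> Basis \<and> length vs \<le> N}" by auto
  then show ?thesis by (simp add: finite_lists_length_le)
qed

lemma schwartz_bdd_above:
  assumes "\<phi> \<in> schwartz_space" "vs \<in> lists Basis"
  shows "bdd_above (range (\<lambda>x. (1 + norm x) ^ k * norm (iter_deriv vs \<phi> x)))"
  using assms unfolding schwartz_space_def bdd_above_def by blast

lemma schwartz_sup_nonneg:
  assumes "\<phi> \<in> schwartz_space" "vs \<in> lists Basis"
  shows "0 \<le> (SUP x. (1 + norm x) ^ k * norm (iter_deriv vs \<phi> x))"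
  by (rule cSUP_upper2[OF schwartz_bdd_above[OF assms], of 0]) auto

lemma schwartz_seminorm_upper:
  assumes "\<phi> \<in> schwartz_space" "vs \<in> lists Basis" "length vs \<le> N" "k \<le> N"
  shows "(1 + norm x) ^ k * norm (iter_deriv vs \<phi> x) \<le> schwartz_seminorm N \<phi>"
proof -
  have "(1 + norm x) ^ k * norm (iter_deriv vs \<phi> x) \<le> (1 + norm x) ^ N * norm (iter_deriv vs \<phi> x)"
    using assms by (intro mult_right_mono power_increasing) auto
  also have "\<dots> \<le> (SUP x. (1 + norm x) ^ N * norm (iter_deriv vs \<phi> x))"
    by (rule cSUP_upper[OF _ schwartz_bdd_above]) (use assms in auto)
  also have "\<dots> \<le> schwartz_seminorm N \<phi>"
    unfolding schwartz_seminorm_def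
    by (rule member_le_sum) (use assms finite_derivative_lists schwartz_sup_nonneg in auto)
  finally show ?thesis .
qed

lemma schwartz_seminorm_nonneg: "\<phi> \<in> schwartz_space \<Longrightarrow> 0 \<le> schwartz_seminorm N \<phi>"
  unfolding schwartz_seminorm_def by (intro sum_nonneg) (auto intro: schwartz_sup_nonneg)

lemma schwartz_seminorm_mono:
  assumes "\<phi> \<in> schwartz_space" "N \<le> N'"
  shows "schwartz_seminorm N \<phi> \<le> schwartz_seminorm N' \<phi>"
proof -
  have "schwartz_seminorm N \<phi> \<le> (\<Sum>vs \<in> {vs \<in> lists (Basis::'a set). length vs \<le> N}.
        SUP x. (1 + norm x) ^ N' * norm (iter_deriv vs \<phi> x))"
    unfolding schwartz_seminorm_def
  proof (rule sum_mono, rule cSUP_mono)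
    fix vs n assume "vs \<in> {vs \<in> lists (Basis::'a set). length vs \<le> N}"
    then show "bdd_above (range (\<lambda>x. (1 + norm x) ^ N' * norm (iter_deriv vs \<phi> x)))"
      using schwartz_bdd_above[OF assms(1)] by auto
    show "\<exists>m\<in>UNIV. (1 + norm n) ^ N * norm (iter_deriv vs \<phi> n) \<le> (1 + norm m) ^ N' * norm (iter_deriv vs \<phi> m)"
      using assms(2) by (intro bexI[of _ n] mult_right_mono power_increasing) auto
  qed auto
  also have "\<dots> \<le> schwartz_seminorm N' \<phi>"
    unfolding schwartz_seminorm_def
    by (rule sum_mono2[OF finite_derivative_lists]) (use assms schwartz_sup_nonneg in auto)
  finally show ?thesis .
qed

text \<open>
  A family of quantities, indexed by \<open>x\<close>, that is bounded by one seminorm uniformly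
  in \<open>x\<close>.  The index absorbs the suprema that would otherwise have to be taken.
\<close>

definition schwartz_bounded :: "(('a::euclidean_space \<Rightarrow> complex) \<Rightarrow> 'c \<Rightarrow> real) \<Rightarrow> bool" where
  "schwartz_bounded B \<longleftrightarrow> (\<exists>C N. \<forall>\<phi> \<in> schwartz_space. \<forall>x. B \<phi> x \<le> C * schwartz_seminorm N \<phi>)"

lemma schwartz_boundedE:
  assumes "schwartz_bounded B"
  obtains C N where "C \<ge> 0" "\<And>\<phi> x. \<phi> \<in> schwartz_space \<Longrightarrow> B \<phi> x \<le> C * schwartz_seminorm N \<phi>"
proof -
  obtain C N where C: "\<And>\<phi> x. \<phi> \<in> schwartz_space \<Longrightarrow> B \<phi> x \<le> C * schwartz_seminorm N \<phi>"
    using assms unfolding schwartz_bounded_def by blast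
  have "B \<phi> x \<le> max C 0 * schwartz_seminorm N \<phi>" if "\<phi> \<in> schwartz_space" for \<phi> x
    using C[OF that, of x] mult_right_mono[OF max.cobounded1 schwartz_seminorm_nonneg[OF that, of N], of C 0]
    by linarith
  then show ?thesis by (intro that[of "max C 0" N]) auto
qed

lemma schwartz_boundedI:
  "(\<And>\<phi> x. \<phi> \<in> schwartz_space \<Longrightarrow> B \<phi> x \<le> C * schwartz_seminorm N \<phi>) \<Longrightarrow> schwartz_bounded B"
  unfolding schwartz_bounded_def by blast

lemma schwartz_bounded_mono:
  assumes "schwartz_bounded B'" "\<And>\<phi> x. \<phi> \<in> schwartz_space \<Longrightarrow> \<exists>y. B \<phi> x \<le> B' \<phi> y"
  shows "schwartz_bounded B"
  using assms unfolding schwartz_bounded_def by (meson order_trans)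

lemma schwartz_bounded_add:
  assumes "schwartz_bounded A" "schwartz_bounded B"
  shows "schwartz_bounded (\<lambda>\<phi> x. A \<phi> x + B \<phi> x)"
proof -
  obtain C N where 1: "C \<ge> 0" "\<And>\<phi> x. \<phi> \<in> schwartz_space \<Longrightarrow> A \<phi> x \<le> C * schwartz_seminorm N \<phi>"
    using schwartz_boundedE[OF assms(1)] by metis
  obtain D K where 2: "D \<ge> 0" "\<And>\<phi> x. \<phi> \<in> schwartz_space \<Longrightarrow> B \<phi> x \<le> D * schwartz_seminorm K \<phi>"
    using schwartz_boundedE[OF assms(2)] by metis
  show ?thesis
  proof (rule schwartz_boundedI)
    fix \<phi> :: "'a \<Rightarrow> complex" and x assume p: "\<phi> \<in> schwartz_space"
    have "A \<phi> x + B \<phi> x \<le> C * schwartz_seminorm N \<phi> + D * schwartz_seminorm K \<phi>"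
      using 1 2 p by (simp add: add_mono)
    also have "\<dots> \<le> C * schwartz_seminorm (max N K) \<phi> + D * schwartz_seminorm (max N K) \<phi>"
      using 1 2 p by (intro add_mono mult_left_mono schwartz_seminorm_mono) auto
    finally show "A \<phi> x + B \<phi> x \<le> (C + D) * schwartz_seminorm (max N K) \<phi>"
      by (simp add: algebra_simps)
  qed
qed

lemma schwartz_bounded_zero: "schwartz_bounded (\<lambda>\<phi> x. 0)"
  by (rule schwartz_boundedI[where C=0]) auto

lemma schwartz_bounded_sum:
  "finite I \<Longrightarrow> (\<And>i. i \<in> I \<Longrightarrow> schwartz_bounded (B i)) \<Longrightarrow> schwartz_bounded (\<lambda>\<phi> x. \<Sum>i\<in>I. B i \<phi> x)"
  by (induction rule: finite_induct) (auto intro: schwartz_bounded_add schwartz_bounded_zero)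

lemma schwartz_bounded_scale:
  assumes "schwartz_bounded B" "c \<ge> 0"
  shows "schwartz_bounded (\<lambda>\<phi> x. c * B \<phi> x)"
proof -
  obtain C N where 1: "C \<ge> 0" "\<And>\<phi> x. \<phi> \<in> schwartz_space \<Longrightarrow> B \<phi> x \<le> C * schwartz_seminorm N \<phi>"
    using schwartz_boundedE[OF assms(1)] by metis
  show ?thesis
    by (rule schwartz_boundedI[where C="c*C" and N=N]) (use 1 assms in \<open>auto simp: mult.assoc intro!: mult_left_mono\<close>)
qed

lemma schwartz_bounded_decay:
  "vs \<in> lists Basis \<Longrightarrow> schwartz_bounded (\<lambda>\<phi> x. (1 + norm x) ^ k * norm (iter_deriv vs \<phi> x))"
  by (rule schwartz_boundedI[where C=1 and N="max k (length vs)"])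
    (use schwartz_seminorm_upper[of _ vs] in auto)

lemma schwartz_bounded_decay0: "schwartz_bounded (\<lambda>\<phi> x. (1 + norm x) ^ k * norm (\<phi> x))"
  using schwartz_bounded_decay[of "[]" k] by simp

lemma schwartz_decay:
  assumes "\<phi> \<in> schwartz_space"
  obtains C where "C \<ge> 0" "\<And>x. (1 + norm x) ^ k * norm (\<phi> x) \<le> C"
proof -
  obtain C N where "C \<ge> 0" "\<And>\<phi> x. (\<phi> :: 'a \<Rightarrow> complex) \<in> schwartz_space \<Longrightarrow> (1 + norm x) ^ k * norm (\<phi> x) \<le> C * schwartz_seminorm N \<phi>"
    using schwartz_boundedE[OF schwartz_bounded_decay0[of k]] by metis
  then show ?thesis
    using assms schwartz_seminorm_nonneg[OF assms] by (intro that[of "C * schwartz_seminorm N \<phi>"]) auto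
qed

subsection \<open>Continuous operators\<close>

definition schwartz_continuous ::
    "(('a::euclidean_space \<Rightarrow> complex) \<Rightarrow> ('b::euclidean_space \<Rightarrow> complex)) \<Rightarrow> bool" where
  "schwartz_continuous T \<longleftrightarrow> (\<forall>\<phi> \<in> schwartz_space. T \<phi> \<in> schwartz_space) \<and>
     (\<forall>N. schwartz_bounded (\<lambda>\<phi> (_::unit). schwartz_seminorm N (T \<phi>)))"

lemma schwartz_continuous_in: "schwartz_continuous T \<Longrightarrow> \<phi> \<in> schwartz_space \<Longrightarrow> T \<phi> \<in> schwartz_space"
  by (simp add: schwartz_continuous_def)

lemma schwartz_bounded_comp:
  assumes "schwartz_continuous T" "schwartz_bounded B"
  shows "schwartz_bounded (\<lambda>\<phi>. B (T \<phi>))"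
proof -
  obtain C N where 1: "C \<ge> 0" "\<And>\<phi> x. \<phi> \<in> schwartz_space \<Longrightarrow> B \<phi> x \<le> C * schwartz_seminorm N \<phi>"
    using schwartz_boundedE[OF assms(2)] by metis
  have "schwartz_bounded (\<lambda>\<phi> (_::unit). schwartz_seminorm N (T \<phi>))"
    using assms(1) by (simp add: schwartz_continuous_def)
  from schwartz_bounded_scale[OF this \<open>C \<ge> 0\<close>] show ?thesis
    by (rule schwartz_bounded_mono) (use 1 assms(1) in \<open>auto simp: schwartz_continuous_in\<close>)
qed

lemma schwartz_continuous_comp:
  assumes "schwartz_continuous S" "schwartz_continuous T"
  shows "schwartz_continuous (\<lambda>\<phi>. S (T \<phi>))"
proof -
  have "schwartz_bounded (\<lambda>\<phi> (_::unit). schwartz_seminorm N (S \<phi>))" for N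
    using assms(1) by (simp add: schwartz_continuous_def)
  from schwartz_bounded_comp[OF assms(2) this] show ?thesis
    using assms by (simp add: schwartz_continuous_def)
qed

lemma schwartz_continuous_id: "schwartz_continuous (\<lambda>\<phi>. \<phi>)"
  unfolding schwartz_continuous_def by (auto intro: schwartz_boundedI[where C=1])

lemma schwartz_continuousI:
  assumes "\<And>\<phi>. \<phi> \<in> schwartz_space \<Longrightarrow> T \<phi> \<in> schwartz_space"
    and "\<And>vs k. vs \<in> lists Basis \<Longrightarrow> schwartz_bounded (\<lambda>\<phi> x. (1 + norm x) ^ k * norm (iter_deriv vs (T \<phi>) x))"
  shows "schwartz_continuous T"
  unfolding schwartz_continuous_def
proof (intro conjI allI ballI assms(1))
  fix N
  have "schwartz_bounded (\<lambda>\<phi> (_::unit). SUP x. (1 + norm x) ^ N * norm (iter_deriv vs (T \<phi>) x))"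
    if "vs \<in> lists Basis" for vs
  proof -
    from schwartz_boundedE[OF assms(2)[OF that, of N]] obtain C K where
      "\<And>\<phi> x. \<phi> \<in> schwartz_space \<Longrightarrow> (1 + norm x) ^ N * norm (iter_deriv vs (T \<phi>) x) \<le> C * schwartz_seminorm K \<phi>"
      by metis
    then show ?thesis by (intro schwartz_boundedI[where C=C and N=K] cSUP_least) auto
  qed
  then show "schwartz_bounded (\<lambda>\<phi> (_::unit). schwartz_seminorm N (T \<phi>))"
    unfolding schwartz_seminorm_def by (intro schwartz_bounded_sum finite_derivative_lists) auto
qed

text \<open>
  If each member of a class is bounded without derivatives, and each coordinate derivative of an output
  is again the output of a member, then iteration bounds all derivatives.  No formula for iterated
  derivatives is needed.
\<close>

lemma schwartz_continuous_coinduct: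
  assumes "T \<in> \<T>"
    and diff: "\<And>T \<phi> x. T \<in> \<T> \<Longrightarrow> \<phi> \<in> schwartz_space \<Longrightarrow> T \<phi> differentiable (at x)"
    and bdd: "\<And>T k. T \<in> \<T> \<Longrightarrow> schwartz_bounded (\<lambda>\<phi> x. (1 + norm x) ^ k * norm (T \<phi> x))"
    and stab: "\<And>T b. T \<in> \<T> \<Longrightarrow> b \<in> Basis \<Longrightarrow>
      \<exists>T' \<in> \<T>. \<forall>\<phi> \<in> schwartz_space. dir_deriv b (T \<phi>) = T' \<phi>"
  shows "schwartz_continuous T"
proof -
  have ex: "\<exists>T' \<in> \<T>. \<forall>\<phi> \<in> schwartz_space. iter_deriv vs (T \<phi>) = T' \<phi>" if "vs \<in> lists Basis" for vs
    using that
  proof (induction vs)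
    case Nil
    then show ?case using assms(1) by auto
  next
    case (Cons v vs)
    then obtain T' where T': "T' \<in> \<T>" "\<forall>\<phi> \<in> schwartz_space. iter_deriv vs (T \<phi>) = T' \<phi>" by auto
    with stab[OF T'(1), of v] Cons show ?case
      by (auto simp: iter_deriv_Cons simp del: iter_deriv.simps(2))
  qed
  have bd: "schwartz_bounded (\<lambda>\<phi> x. (1 + norm x) ^ k * norm (iter_deriv vs (T \<phi>) x))"
    if "vs \<in> lists Basis" for vs k
  proof -
    from ex[OF that] obtain T' where T': "T' \<in> \<T>" "\<forall>\<phi> \<in> schwartz_space. iter_deriv vs (T \<phi>) = T' \<phi>" by auto
    show ?thesis by (rule schwartz_bounded_mono[OF bdd[OF T'(1), of k]]) (use T'(2) in auto)
  qed
  show ?thesis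
  proof (rule schwartz_continuousI[OF _ bd])
    fix \<phi> :: "'a \<Rightarrow> complex" assume p: "\<phi> \<in> schwartz_space"
    show "T \<phi> \<in> schwartz_space"
      unfolding schwartz_space_def
    proof (rule CollectI, rule ballI, intro conjI allI)
      fix vs :: "'b list" and x k assume vs: "vs \<in> lists Basis"
      obtain T' where T': "T' \<in> \<T>" "\<forall>\<phi> \<in> schwartz_space. iter_deriv vs (T \<phi>) = T' \<phi>" using ex[OF vs] by auto
      then show "iter_deriv vs (T \<phi>) differentiable (at x)" using diff p by metis
      obtain C N where "\<And>\<phi> x. \<phi> \<in> schwartz_space \<Longrightarrow> (1 + norm x) ^ k * norm (iter_deriv vs (T \<phi>) x) \<le> C * schwartz_seminorm N \<phi>"
        using schwartz_boundedE[OF bd[OF vs, of k]] by metis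
      with p show "\<exists>C. \<forall>x. (1 + norm x) ^ k * norm (iter_deriv vs (T \<phi>) x) \<le> C"
        by (intro exI[of _ "C * schwartz_seminorm N \<phi>"]) auto
    qed
  qed auto
qed

lemma schwartz_continuous_dir_deriv: "b \<in> Basis \<Longrightarrow> schwartz_continuous (dir_deriv b)"
proof (rule schwartz_continuousI)
  fix vs :: "'a list" and k assume "b \<in> Basis" "vs \<in> lists Basis"
  then have "schwartz_bounded (\<lambda>\<phi> x. (1 + norm x) ^ k * norm (iter_deriv (vs @ [b]) \<phi> x))"
    by (intro schwartz_bounded_decay) auto
  then show "schwartz_bounded (\<lambda>\<phi> x. (1 + norm x) ^ k * norm (iter_deriv vs (dir_deriv b \<phi>) x))"
    by (simp add: iter_deriv_append dir_deriv_def)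
qed (auto intro: dir_deriv_in_schwartz)

lemma schwartz_dir_deriv_add:
  assumes "\<phi> \<in> schwartz_space" "\<psi> \<in> schwartz_space"
  shows "dir_deriv v (\<lambda>x. \<phi> x + \<psi> x) = (\<lambda>x. dir_deriv v \<phi> x + dir_deriv v \<psi> x)"
  by (rule dir_deriv_eqI) (intro has_derivative_add schwartz_has_derivative assms)

lemma schwartz_dir_deriv_cmult:
  assumes "\<phi> \<in> schwartz_space"
  shows "dir_deriv v (\<lambda>x. c * \<phi> x) = (\<lambda>x. c * dir_deriv v \<phi> x)"
  by (rule dir_deriv_eqI) (intro has_derivative_mult_right schwartz_has_derivative assms)

lemma schwartz_add:
  assumes "\<phi> \<in> schwartz_space" "\<psi> \<in> schwartz_space"
  shows "(\<lambda>x. \<phi> x + \<psi> x) \<in> schwartz_space"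
proof (rule schwartz_coinduct)
  let ?X = "{f. \<exists>\<phi> \<psi>. f = (\<lambda>x::'a. \<phi> x + \<psi> x) \<and> \<phi> \<in> schwartz_space \<and> \<psi> \<in> schwartz_space}"
  show "(\<lambda>x. \<phi> x + \<psi> x) \<in> ?X" using assms by blast
  fix f assume "f \<in> ?X"
  then obtain \<phi> \<psi> where f: "f = (\<lambda>x. \<phi> x + \<psi> x)" "\<phi> \<in> schwartz_space" "\<psi> \<in> schwartz_space" by auto
  show "f differentiable (at x)" for x
    unfolding f(1) by (intro differentiable_add schwartz_differentiable f)
  show "dir_deriv b f \<in> ?X" if "b \<in> Basis" for b
    unfolding f(1) schwartz_dir_deriv_add[OF f(2,3)] using that f(2,3) dir_deriv_in_schwartz by blast
  fix k
  obtain C where C: "\<And>x. (1 + norm x) ^ k * norm (\<phi> x) \<le> C" using schwartz_decay[OF f(2)] by metis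
  obtain D where D: "\<And>x. (1 + norm x) ^ k * norm (\<psi> x) \<le> D" using schwartz_decay[OF f(3)] by metis
  have "(1 + norm x) ^ k * norm (f x) \<le> C + D" for x
  proof -
    have "(1 + norm x) ^ k * norm (f x) \<le> (1 + norm x) ^ k * (norm (\<phi> x) + norm (\<psi> x))"
      unfolding f by (intro mult_left_mono norm_triangle_ineq) auto
    then show ?thesis using C[of x] D[of x] by (simp add: distrib_left)
  qed
  then show "\<exists>C. \<forall>x. (1 + norm x) ^ k * norm (f x) \<le> C" by blast
qed

lemma schwartz_cmult:
  assumes "\<phi> \<in> schwartz_space"
  shows "(\<lambda>x. c * \<phi> x) \<in> schwartz_space"
proof (rule schwartz_coinduct)
  let ?X = "{f. \<exists>\<phi>. f = (\<lambda>x::'a. c * \<phi> x) \<and> \<phi> \<in> schwartz_space}"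
  show "(\<lambda>x. c * \<phi> x) \<in> ?X" using assms by blast
  fix f assume "f \<in> ?X"
  then obtain \<phi> where f: "f = (\<lambda>x. c * \<phi> x)" "\<phi> \<in> schwartz_space" by auto
  show "f differentiable (at x)" for x
    unfolding f(1) by (intro differentiable_mult differentiable_const schwartz_differentiable f)
  show "dir_deriv b f \<in> ?X" if "b \<in> Basis" for b
    unfolding f(1) schwartz_dir_deriv_cmult[OF f(2)] using that f(2) dir_deriv_in_schwartz by blast
  fix k
  obtain C where C: "\<And>x. (1 + norm x) ^ k * norm (\<phi> x) \<le> C" using schwartz_decay[OF f(2)] by metis
  have "(1 + norm x) ^ k * norm (f x) \<le> norm c * C" for x
    using mult_left_mono[OF C[of x] norm_ge_zero[of c]] by (simp add: f(1) norm_mult mult_ac)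
  then show "\<exists>C. \<forall>x. (1 + norm x) ^ k * norm (f x) \<le> C" by blast
qed

lemma iter_deriv_add:
  assumes "\<phi> \<in> schwartz_space" "\<psi> \<in> schwartz_space" "vs \<in> lists Basis"
  shows "iter_deriv vs (\<lambda>x. \<phi> x + \<psi> x) = (\<lambda>x. iter_deriv vs \<phi> x + iter_deriv vs \<psi> x)"
  using assms(3)
proof (induction vs)
  case (Cons v vs)
  then have "iter_deriv vs (\<lambda>x. \<phi> x + \<psi> x) = (\<lambda>x. iter_deriv vs \<phi> x + iter_deriv vs \<psi> x)" "vs \<in> lists Basis" by auto
  then show ?case
    by (simp add: iter_deriv_Cons schwartz_dir_deriv_add iter_deriv_in_schwartz assms del: iter_deriv.simps(2))
qed simp

lemma iter_deriv_cmult: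
  assumes "\<phi> \<in> schwartz_space" "vs \<in> lists Basis"
  shows "iter_deriv vs (\<lambda>x. c * \<phi> x) = (\<lambda>x. c * iter_deriv vs \<phi> x)"
  using assms(2)
proof (induction vs)
  case (Cons v vs)
  then have "iter_deriv vs (\<lambda>x. c * \<phi> x) = (\<lambda>x. c * iter_deriv vs \<phi> x)" "vs \<in> lists Basis" by auto
  then show ?case
    by (simp add: iter_deriv_Cons schwartz_dir_deriv_cmult iter_deriv_in_schwartz assms del: iter_deriv.simps(2))
qed simp

lemma schwartz_continuous_add:
  assumes S: "schwartz_continuous S" and T: "schwartz_continuous T"
  shows "schwartz_continuous (\<lambda>\<phi> x. S \<phi> x + T \<phi> x)"
proof (rule schwartz_continuousI)
  note in_S = schwartz_continuous_in[OF S] and in_T = schwartz_continuous_in[OF T]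
  show "(\<lambda>x. S \<phi> x + T \<phi> x) \<in> schwartz_space" if "\<phi> \<in> schwartz_space" for \<phi>
    by (intro schwartz_add in_S in_T that)
  fix vs :: "'b list" and k assume vs: "vs \<in> lists Basis"
  note decay = schwartz_bounded_decay[OF vs, of k]
  show "schwartz_bounded (\<lambda>\<phi> x. (1 + norm x) ^ k * norm (iter_deriv vs (\<lambda>x. S \<phi> x + T \<phi> x) x))"
  proof (rule schwartz_bounded_mono[OF schwartz_bounded_add[OF schwartz_bounded_comp[OF S decay] schwartz_bounded_comp[OF T decay]]])
    fix \<phi> :: "'a \<Rightarrow> complex" and x assume p: "\<phi> \<in> schwartz_space"
    show "\<exists>y. (1 + norm x) ^ k * norm (iter_deriv vs (\<lambda>x. S \<phi> x + T \<phi> x) x)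
        \<le> (1 + norm y) ^ k * norm (iter_deriv vs (S \<phi>) y) + (1 + norm y) ^ k * norm (iter_deriv vs (T \<phi>) y)"
      unfolding iter_deriv_add[OF in_S[OF p] in_T[OF p] vs] distrib_left[symmetric]
      by (intro exI[of _ x] mult_left_mono norm_triangle_ineq) auto
  qed
qed

lemma schwartz_continuous_cmult: "schwartz_continuous (\<lambda>\<phi> x. c * \<phi> x)"
proof (rule schwartz_continuousI)
  show "(\<lambda>x. c * \<phi> x) \<in> schwartz_space" if "\<phi> \<in> schwartz_space" for \<phi> by (rule schwartz_cmult[OF that])
  fix vs :: "'a list" and k assume vs: "vs \<in> lists Basis"
  show "schwartz_bounded (\<lambda>\<phi> x. (1 + norm x) ^ k * norm (iter_deriv vs (\<lambda>x. c * \<phi> x) x))"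
    by (rule schwartz_bounded_mono[OF schwartz_bounded_scale[OF schwartz_bounded_decay[OF vs, of k] norm_ge_zero[of c]]])
      (auto simp: iter_deriv_cmult[OF _ vs] norm_mult mult_ac intro!: exI)
qed

lemma schwartz_continuous_cong:
  assumes "schwartz_continuous T" "\<And>\<phi>. \<phi> \<in> schwartz_space \<Longrightarrow> T' \<phi> = T \<phi>"
  shows "schwartz_continuous T'"
proof -
  have "schwartz_bounded (\<lambda>\<phi> (_::unit). schwartz_seminorm N (T' \<phi>))" for N
    by (rule schwartz_bounded_mono[where B' = "\<lambda>\<phi> (_::unit). schwartz_seminorm N (T \<phi>)"])
      (use assms in \<open>auto simp: schwartz_continuous_def\<close>)
  then show ?thesis using assms by (simp add: schwartz_continuous_def)
qed

lemma schwartz_continuous_zero: "schwartz_continuous (\<lambda>\<phi> x. 0)"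
  by (rule schwartz_continuous_coinduct[where \<T> = "{\<lambda>\<phi> x. 0}"])
    (auto simp: schwartz_bounded_zero dir_deriv_def)

lemma schwartz_continuous_sum:
  "finite I \<Longrightarrow> (\<And>i. i \<in> I \<Longrightarrow> schwartz_continuous (T i)) \<Longrightarrow> schwartz_continuous (\<lambda>\<phi> x. \<Sum>i\<in>I. T i \<phi> x)"
  by (induction rule: finite_induct) (auto intro: schwartz_continuous_add schwartz_continuous_zero)

lemma schwartz_dir_deriv_eq_sum:
  assumes "\<phi> \<in> schwartz_space"
  shows "dir_deriv v \<phi> x = (\<Sum>b\<in>Basis. complex_of_real (v \<bullet> b) * dir_deriv b \<phi> x)"
proof -
  have lin: "linear (\<lambda>v. dir_deriv v \<phi> x)"
    using schwartz_has_derivative[OF assms] has_derivative_linear by blast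
  have "dir_deriv (\<Sum>b\<in>Basis. (v \<bullet> b) *\<^sub>R b) \<phi> x = (\<Sum>b\<in>Basis. (v \<bullet> b) *\<^sub>R dir_deriv b \<phi> x)"
    by (simp only: linear_sum[OF lin] linear_scale[OF lin])
  then show ?thesis by (simp add: euclidean_representation scaleR_conv_of_real)
qed

lemma schwartz_continuous_dir_deriv_all: "schwartz_continuous (dir_deriv v)"
proof (rule schwartz_continuous_cong)
  show "schwartz_continuous (\<lambda>\<phi> x. \<Sum>b\<in>Basis. complex_of_real (v \<bullet> b) * dir_deriv b \<phi> x)"
    by (intro schwartz_continuous_sum schwartz_continuous_comp[OF schwartz_continuous_cmult] schwartz_continuous_dir_deriv) auto
qed (auto simp: schwartz_dir_deriv_eq_sum)

lemma schwartz_dir_deriv_in: "\<phi> \<in> schwartz_space \<Longrightarrow> dir_deriv v \<phi> \<in> schwartz_space"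
  by (rule schwartz_continuous_in[OF schwartz_continuous_dir_deriv_all])

subsection \<open>Affine substitutions and multiplication by coordinates\<close>

text \<open>
  By the chain rule, a derivative of \<open>\<lambda>x. A \<phi> (L x + c)\<close> has the same form with \<open>A\<close> followed by a directional
  derivative, so these operators form a stable class.  Injectivity of \<open>L\<close> preserves the decay, since \<open>norm x\<close> is
  then at most a multiple of \<open>norm (L x)\<close>.
\<close>

lemma schwartz_continuous_affine:
  fixes L :: "'b::euclidean_space \<Rightarrow> 'a::euclidean_space"
  assumes L: "linear L" "inj L"
  shows "schwartz_continuous (\<lambda>\<phi> x. \<phi> (L x + c))"
proof (rule schwartz_continuous_coinduct)
  let ?\<T> = "{U. \<exists>A. U = (\<lambda>(\<phi>::'a\<Rightarrow>complex) x. A \<phi> (L x + c)) \<and> schwartz_continuous A}"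
  show "(\<lambda>\<phi> x. \<phi> (L x + c)) \<in> ?\<T>"
    using schwartz_continuous_id by (intro CollectI exI[of _ "\<lambda>\<phi>. \<phi>"] conjI refl)
  fix U assume "U \<in> ?\<T>"
  then obtain A where U: "U = (\<lambda>\<phi> x. A \<phi> (L x + c))" and A: "schwartz_continuous A"
    by blast
  have D: "(U \<phi> has_derivative (\<lambda>v. dir_deriv (L v) (A \<phi>) (L x + c))) (at x)" if "\<phi> \<in> schwartz_space" for \<phi> x
    unfolding U
    by (rule has_derivative_compose[where g="A \<phi>" and f="\<lambda>x. L x + c" and f'=L])
      (use schwartz_has_derivative[OF schwartz_continuous_in[OF A that]] L(1) in
        \<open>auto intro!: derivative_eq_intros linear_imp_has_derivative\<close>)
  show "U \<phi> differentiable (at x)" if "\<phi> \<in> schwartz_space" for \<phi> x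
    using D[OF that] differentiableI by blast
  show "\<exists>T'\<in>?\<T>. \<forall>\<phi>\<in>schwartz_space. dir_deriv b (U \<phi>) = T' \<phi>" for b
  proof (rule bexI)
    show "\<forall>\<phi>\<in>schwartz_space. dir_deriv b (U \<phi>) = (\<lambda>x. dir_deriv (L b) (A \<phi>) (L x + c))"
      by (intro ballI dir_deriv_eqI D)
    show "(\<lambda>\<phi> x. dir_deriv (L b) (A \<phi>) (L x + c)) \<in> ?\<T>"
      using schwartz_continuous_comp[OF schwartz_continuous_dir_deriv_all A]
      by (intro CollectI exI[of _ "\<lambda>\<phi>. dir_deriv (L b) (A \<phi>)"] conjI refl)
  qed
  fix k
  obtain B where B: "B > 0" "\<And>x. B * norm x \<le> norm (L x)"
    using linear_inj_bounded_below_pos[OF L] by metis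
  define K where "K = 1 + (1 + norm c) / B"
  have K: "1 + norm x \<le> K * (1 + norm (L x + c))" for x
  proof -
    have "norm (L x) \<le> norm (L x + c) + norm c"
      using norm_triangle_ineq4[of "L x + c" c] by simp
    then have "norm x \<le> (norm (L x + c) + norm c) / B"
      using B(1) B(2)[of x] by (simp add: pos_le_divide_eq mult.commute)
    also have "\<dots> \<le> (1 + norm c) / B * (1 + norm (L x + c))"
      using B(1) by (simp add: field_simps)
    finally have "norm x \<le> (1 + norm c) / B * (1 + norm (L x + c))" .
    then show ?thesis unfolding K_def distrib_right mult_1 using norm_ge_zero[of "L x + c"] by linarith
  qed
  have "0 \<le> K" using B(1) by (simp add: K_def)
  show "schwartz_bounded (\<lambda>\<phi> x. (1 + norm x) ^ k * norm (U \<phi> x))"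
  proof (rule schwartz_bounded_mono[OF schwartz_bounded_scale[OF schwartz_bounded_comp[OF A schwartz_bounded_decay0[of k]], of "K^k"]])
    fix \<phi> :: "'a \<Rightarrow> complex" and x
    have "(1 + norm x) ^ k * norm (U \<phi> x) \<le> (K * (1 + norm (L x + c))) ^ k * norm (U \<phi> x)"
      by (intro mult_right_mono power_mono K) auto
    then show "\<exists>y. (1 + norm x) ^ k * norm (U \<phi> x) \<le> K ^ k * ((1 + norm y) ^ k * norm (A \<phi> y))"
      by (intro exI[of _ "L x + c"]) (simp add: U power_mult_distrib mult.assoc)
  qed (use \<open>0 \<le> K\<close> in auto)
qed

lemma schwartz_continuous_linear:
  "linear L \<Longrightarrow> inj L \<Longrightarrow> schwartz_continuous (\<lambda>\<phi> x. \<phi> (L x))"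
  using schwartz_continuous_affine[of L 0] by simp

lemma schwartz_affine:
  "\<phi> \<in> schwartz_space \<Longrightarrow> linear L \<Longrightarrow> inj L \<Longrightarrow> (\<lambda>x. \<phi> (L x + c)) \<in> schwartz_space"
  by (rule schwartz_continuous_in[OF schwartz_continuous_affine])

lemma schwartz_linear:
  "\<phi> \<in> schwartz_space \<Longrightarrow> linear L \<Longrightarrow> inj L \<Longrightarrow> (\<lambda>x. \<phi> (L x)) \<in> schwartz_space"
  by (rule schwartz_continuous_in[OF schwartz_continuous_linear])

lemma schwartz_continuous_mult_inner:
  "schwartz_continuous (\<lambda>\<phi> x. complex_of_real (x \<bullet> v) * \<phi> x)"
proof (rule schwartz_continuous_coinduct)
  let ?\<T> = "{U. \<exists>A B. U = (\<lambda>(\<phi>::'a\<Rightarrow>complex) (x::'a). complex_of_real (x \<bullet> v) * A \<phi> x + B \<phi> x)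
     \<and> schwartz_continuous A \<and> schwartz_continuous B}"
  show "(\<lambda>\<phi> x. complex_of_real (x \<bullet> v) * \<phi> x) \<in> ?\<T>"
    using schwartz_continuous_id schwartz_continuous_zero
    by (intro CollectI exI[of _ "\<lambda>\<phi>. \<phi>"] exI[of _ "\<lambda>\<phi> x. 0"] conjI) auto
  fix U assume "U \<in> ?\<T>"
  then obtain A B where U: "U = (\<lambda>\<phi> x. complex_of_real (x \<bullet> v) * A \<phi> x + B \<phi> x)"
    and A: "schwartz_continuous A" and B: "schwartz_continuous B"
    by blast
  have D: "(U \<phi> has_derivative (\<lambda>w. complex_of_real (x \<bullet> v) * dir_deriv w (A \<phi>) x + (complex_of_real (w \<bullet> v) * A \<phi> x + dir_deriv w (B \<phi>) x))) (at x)" if "\<phi> \<in> schwartz_space" for \<phi> x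
    unfolding U
    by (rule has_derivative_eq_rhs[OF has_derivative_add[OF has_derivative_mult[OF
          has_derivative_of_real[OF has_derivative_inner_left[OF has_derivative_ident]]
          schwartz_has_derivative[OF schwartz_continuous_in[OF A that]]]
          schwartz_has_derivative[OF schwartz_continuous_in[OF B that]]]])
      (auto simp: algebra_simps)
  show "U \<phi> differentiable (at x)" if "\<phi> \<in> schwartz_space" for \<phi> x
    using D[OF that] differentiableI by blast
  show "\<exists>T'\<in>?\<T>. \<forall>\<phi>\<in>schwartz_space. dir_deriv b (U \<phi>) = T' \<phi>" for b
  proof (rule bexI)
    show "\<forall>\<phi>\<in>schwartz_space. dir_deriv b (U \<phi>) = (\<lambda>x. complex_of_real (x \<bullet> v) * dir_deriv b (A \<phi>) x + (complex_of_real (b \<bullet> v) * A \<phi> x + dir_deriv b (B \<phi>) x))"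
      by (intro ballI dir_deriv_eqI D)
    show "(\<lambda>\<phi> x. complex_of_real (x \<bullet> v) * dir_deriv b (A \<phi>) x + (complex_of_real (b \<bullet> v) * A \<phi> x + dir_deriv b (B \<phi>) x)) \<in> ?\<T>"
      using schwartz_continuous_comp[OF schwartz_continuous_dir_deriv_all A]
        schwartz_continuous_add[OF schwartz_continuous_comp[OF schwartz_continuous_cmult A] schwartz_continuous_comp[OF schwartz_continuous_dir_deriv_all B]]
      by (intro CollectI exI[of _ "\<lambda>\<phi>. dir_deriv b (A \<phi>)"] exI[of _ "\<lambda>\<phi> x. complex_of_real (b \<bullet> v) * A \<phi> x + dir_deriv b (B \<phi>) x"] conjI refl)
  qed
  fix k
  show "schwartz_bounded (\<lambda>\<phi> x. (1 + norm x) ^ k * norm (U \<phi> x))"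
  proof -
    have "schwartz_bounded (\<lambda>\<phi> x. norm v * ((1 + norm x) ^ Suc k * norm (A \<phi> x)) + (1 + norm x) ^ k * norm (B \<phi> x))"
      by (intro schwartz_bounded_add schwartz_bounded_scale schwartz_bounded_comp[OF A schwartz_bounded_decay0] schwartz_bounded_comp[OF B schwartz_bounded_decay0]) auto
    then show ?thesis
    proof (rule schwartz_bounded_mono)
      fix \<phi> :: "'a \<Rightarrow> complex" and x
      have "norm (complex_of_real (x \<bullet> v) * A \<phi> x) \<le> norm v * (1 + norm x) * norm (A \<phi> x)"
      proof -
        have "\<bar>x \<bullet> v\<bar> \<le> norm x * norm v" by (rule Cauchy_Schwarz_ineq2)
        also have "\<dots> \<le> norm v * (1 + norm x)" by (simp add: algebra_simps)
        finally show ?thesis unfolding norm_mult by (intro mult_right_mono) auto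
      qed
      then have "norm (U \<phi> x) \<le> norm v * (1 + norm x) * norm (A \<phi> x) + norm (B \<phi> x)"
        unfolding U by (intro norm_triangle_le add_right_mono)
      then have "(1 + norm x) ^ k * norm (U \<phi> x) \<le> (1 + norm x) ^ k * (norm v * (1 + norm x) * norm (A \<phi> x) + norm (B \<phi> x))"
        by (intro mult_left_mono) auto
      then show "\<exists>y. (1 + norm x) ^ k * norm (U \<phi> x) \<le> norm v * ((1 + norm y) ^ Suc k * norm (A \<phi> y)) + (1 + norm y) ^ k * norm (B \<phi> y)"
        by (intro exI[of _ x]) (simp add: algebra_simps)
    qed
  qed
qed

lemma schwartz_mult_inner: "\<phi> \<in> schwartz_space \<Longrightarrow> (\<lambda>x. complex_of_real (x \<bullet> v) * \<phi> x) \<in> schwartz_space"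
  by (rule schwartz_continuous_in[OF schwartz_continuous_mult_inner])

subsection \<open>Conjugates, products and chirps\<close>

lemma schwartz_cnj:
  assumes "\<phi> \<in> schwartz_space"
  shows "(\<lambda>x. cnj (\<phi> x)) \<in> schwartz_space"
proof (rule schwartz_coinduct)
  let ?X = "{f. \<exists>\<phi>. f = (\<lambda>x::'a. cnj (\<phi> x)) \<and> \<phi> \<in> schwartz_space}"
  show "(\<lambda>x. cnj (\<phi> x)) \<in> ?X" using assms by blast
  fix f assume "f \<in> ?X"
  then obtain \<phi> where f: "f = (\<lambda>x. cnj (\<phi> x))" "\<phi> \<in> schwartz_space" by auto
  have D: "(f has_derivative (\<lambda>v. cnj (dir_deriv v \<phi> x))) (at x)" for x
    unfolding f(1) by (rule bounded_linear.has_derivative[OF bounded_linear_cnj schwartz_has_derivative[OF f(2)]])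
  then show "f differentiable (at x)" for x using differentiableI by blast
  show "dir_deriv b f \<in> ?X" if "b \<in> Basis" for b
    using dir_deriv_eqI[OF D] schwartz_dir_deriv_in[OF f(2)] by auto
  show "\<exists>C. \<forall>x. (1 + norm x) ^ k * norm (f x) \<le> C" for k
    unfolding f(1) complex_mod_cnj using schwartz_decay[OF f(2), of k] by metis
qed

text \<open>
  A coordinate derivative on a product space hits only one factor, so products of this form are a stable
  set without passing to sums.  Restriction to the diagonal then gives pointwise products.
\<close>

lemma schwartz_tensor:
  fixes \<phi> :: "'a::euclidean_space \<Rightarrow> complex" and \<psi> :: "'b::euclidean_space \<Rightarrow> complex"
  assumes "\<phi> \<in> schwartz_space" "\<psi> \<in> schwartz_space"
  shows "(\<lambda>z. \<phi> (fst z) * \<psi> (snd z)) \<in> schwartz_space"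
proof (rule schwartz_coinduct)
  let ?X = "{f. \<exists>\<phi> \<psi>. f = (\<lambda>z::'a\<times>'b. \<phi> (fst z) * \<psi> (snd z)) \<and> \<phi> \<in> schwartz_space \<and> \<psi> \<in> schwartz_space}"
  show "(\<lambda>z. \<phi> (fst z) * \<psi> (snd z)) \<in> ?X" using assms by blast
  fix f assume "f \<in> ?X"
  then obtain \<phi> \<psi> where f: "f = (\<lambda>z. \<phi> (fst z) * \<psi> (snd z))" "\<phi> \<in> schwartz_space" "\<psi> \<in> schwartz_space" by auto
  have D: "(f has_derivative (\<lambda>v. \<phi> (fst z) * dir_deriv (snd v) \<psi> (snd z) + dir_deriv (fst v) \<phi> (fst z) * \<psi> (snd z))) (at z)" for z
    unfolding f(1)
    by (intro has_derivative_mult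
        has_derivative_compose[where g=\<phi> and f=fst and f'=fst, OF _ schwartz_has_derivative[OF f(2)]]
        has_derivative_compose[where g=\<psi> and f=snd and f'=snd, OF _ schwartz_has_derivative[OF f(3)]]
        bounded_linear_imp_has_derivative bounded_linear_fst bounded_linear_snd)
  then show "f differentiable (at x)" for x using differentiableI by blast
  have zero: "dir_deriv 0 \<phi> x = 0" if "\<phi> \<in> schwartz_space" for \<phi> :: "'c::euclidean_space \<Rightarrow> complex" and x
    using schwartz_dir_deriv_eq_sum[OF that, of 0] by simp
  show "dir_deriv b f \<in> ?X" if b: "b \<in> Basis" for b
  proof -
    have eq: "dir_deriv b f = (\<lambda>z. \<phi> (fst z) * dir_deriv (snd b) \<psi> (snd z) + dir_deriv (fst b) \<phi> (fst z) * \<psi> (snd z))"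
      by (rule dir_deriv_eqI[OF D])
    from b consider u where "b = (u, 0)" | v where "b = (0, v)"
      unfolding Basis_prod_def by auto
    then show ?thesis
    proof cases
      case 1
      then have "dir_deriv b f = (\<lambda>z. dir_deriv u \<phi> (fst z) * \<psi> (snd z))"
        unfolding eq by (simp add: zero f)
      then show ?thesis using schwartz_dir_deriv_in[OF f(2)] f(3) by blast
    next
      case 2
      then have "dir_deriv b f = (\<lambda>z. \<phi> (fst z) * dir_deriv v \<psi> (snd z))"
        unfolding eq by (simp add: zero f)
      then show ?thesis using schwartz_dir_deriv_in[OF f(3)] f(2) by blast
    qed
  qed
  fix k
  obtain C where C: "C \<ge> 0" "\<And>x. (1 + norm x) ^ k * norm (\<phi> x) \<le> C" using schwartz_decay[OF f(2), of k] by metis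
  obtain D where D: "\<And>x. (1 + norm x) ^ k * norm (\<psi> x) \<le> D" using schwartz_decay[OF f(3), of k] by metis
  have "(1 + norm z) ^ k * norm (f z) \<le> C * D" for z :: "'a \<times> 'b"
  proof -
    have "(1 + norm z) ^ k * norm (f z) \<le> (1 + norm (fst z)) ^ k * (1 + norm (snd z)) ^ k * norm (f z)"
      by (intro mult_right_mono power_norm_pair_le) auto
    also have "\<dots> = ((1 + norm (fst z)) ^ k * norm (\<phi> (fst z))) * ((1 + norm (snd z)) ^ k * norm (\<psi> (snd z)))"
      by (simp add: f(1) norm_mult mult_ac)
    also have "\<dots> \<le> C * D" by (intro mult_mono C D) (auto simp: C)
    finally show ?thesis .
  qed
  then show "\<exists>C. \<forall>x. (1 + norm x) ^ k * norm (f x) \<le> C" by blast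
qed

lemma schwartz_mult:
  fixes \<phi> \<psi> :: "'a::euclidean_space \<Rightarrow> complex"
  assumes "\<phi> \<in> schwartz_space" "\<psi> \<in> schwartz_space"
  shows "(\<lambda>x. \<phi> x * \<psi> x) \<in> schwartz_space"
proof -
  have "linear (\<lambda>x::'a. (x, x))" by (intro linearI) auto
  from schwartz_linear[OF schwartz_tensor[OF assms] this] show ?thesis by (simp add: inj_def)
qed

text \<open>
  The condition on \<open>q'\<close> says that multiplication by the derivative of the phase preserves the Schwartz space.
  For the quadratic phases used below, \<open>q' x b\<close> is linear in \<open>x\<close>.
\<close>

lemma schwartz_chirp:
  fixes q :: "'a::euclidean_space \<Rightarrow> real"
  assumes "\<phi> \<in> schwartz_space"
    and q: "\<And>x. (q has_derivative q' x) (at x)"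
    and q': "\<And>\<psi> b. \<psi> \<in> schwartz_space \<Longrightarrow> (\<lambda>x. complex_of_real (q' x b) * \<psi> x) \<in> schwartz_space"
  shows "(\<lambda>x. cis (q x) * \<phi> x) \<in> schwartz_space"
proof (rule schwartz_coinduct)
  let ?X = "{f. \<exists>\<phi>. f = (\<lambda>x. cis (q x) * \<phi> x) \<and> \<phi> \<in> schwartz_space}"
  show "(\<lambda>x. cis (q x) * \<phi> x) \<in> ?X" using assms by blast
  fix f assume "f \<in> ?X"
  then obtain \<phi> where f: "f = (\<lambda>x. cis (q x) * \<phi> x)" "\<phi> \<in> schwartz_space" by auto
  have D: "(f has_derivative (\<lambda>v. cis (q x) * (dir_deriv v \<phi> x + \<i> * (complex_of_real (q' x v) * \<phi> x)))) (at x)" for x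
  proof -
    have "((\<lambda>x. cis (q x)) has_derivative (\<lambda>v. q' x v *\<^sub>R (\<i> * cis (q x)))) (at x)"
      by (rule has_derivative_cis[OF q])
    from has_derivative_mult[OF this schwartz_has_derivative[OF f(2)]]
    show ?thesis unfolding f(1) by (rule has_derivative_eq_rhs) (auto simp: fun_eq_iff algebra_simps scaleR_conv_of_real)
  qed
  then show "f differentiable (at x)" for x using differentiableI by blast
  show "dir_deriv b f \<in> ?X" if "b \<in> Basis" for b
    unfolding dir_deriv_eqI[OF D]
    using schwartz_add[OF schwartz_dir_deriv_in[OF f(2), of b] schwartz_cmult[OF q'[OF f(2), of b], of \<i>]]
    by (intro CollectI exI[of _ "\<lambda>x. dir_deriv b \<phi> x + \<i> * (complex_of_real (q' x b) * \<phi> x)"] conjI refl)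
  show "\<exists>C. \<forall>x. (1 + norm x) ^ k * norm (f x) \<le> C" for k
    unfolding f(1) norm_mult using schwartz_decay[OF f(2), of k] by (simp add: norm_cis) metis
qed

lemma schwartz_modulation:
  assumes "\<phi> \<in> schwartz_space"
  shows "(\<lambda>x. cis (x \<bullet> v) * \<phi> x) \<in> schwartz_space"
  by (rule schwartz_chirp[OF assms, where q' = "\<lambda>x w. w \<bullet> v"])
    (auto intro!: derivative_eq_intros schwartz_cmult)

section \<open>Integrals of Schwartz functions\<close>

text \<open>
  The square of \<open>1 + norm t\<close> dominates \<open>1 + (t \<bullet> b)\<^sup>2\<close> for every coordinate, so the function lies below a product
  of one-dimensional Cauchy densities.
\<close>

lemma integrable_polynomial_decay:
  "integrable lborel (\<lambda>t::'a::euclidean_space. inverse ((1 + norm t) ^ (2 * DIM('a))))"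
proof -
  have int1: "integrable lborel (\<lambda>x::real. inverse (1 + x\<^sup>2))"
    using integrable_inverse_1_plus_square by (simp add: set_integrable_def)
  then have fin: "(\<integral>\<^sup>+x. ennreal (inverse (1 + x\<^sup>2)) \<partial>(lborel :: real measure)) < \<infinity>"
    by (simp add: integrable_iff_bounded)
  have prod: "integrable lborel (\<lambda>t::'a. \<Prod>b\<in>Basis. inverse (1 + (t \<bullet> b)\<^sup>2))"
  proof (rule integrableI_bounded)
    have "(\<integral>\<^sup>+t. ennreal (norm (\<Prod>b\<in>Basis. inverse (1 + (t \<bullet> b)\<^sup>2))) \<partial>(lborel :: 'a measure))
       = (\<integral>\<^sup>+t. (\<Prod>b\<in>Basis. ennreal (inverse (1 + (t \<bullet> b)\<^sup>2))) \<partial>(lborel :: 'a measure))"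
      by (intro nn_integral_cong) (simp add: prod_ennreal abs_prod)
    also have "\<dots> = (\<Prod>b\<in>(Basis::'a set). \<integral>\<^sup>+x. ennreal (inverse (1 + x\<^sup>2)) \<partial>lborel)"
      by (rule nn_integral_lborel_prod) auto
    also have "\<dots> < \<infinity>" using fin by (simp add: power_less_top_ennreal)
    finally show "(\<integral>\<^sup>+t. ennreal (norm (\<Prod>b\<in>Basis. inverse (1 + (t \<bullet> b)\<^sup>2))) \<partial>(lborel :: 'a measure)) < \<infinity>" .
  qed measurable
  show ?thesis
  proof (rule Bochner_Integration.integrable_bound[OF prod])
    have "inverse ((1 + norm t) ^ (2 * DIM('a))) \<le> (\<Prod>b\<in>Basis. inverse (1 + (t \<bullet> b)\<^sup>2))" for t :: 'a
    proof -
      have "(\<Prod>b\<in>Basis. 1 + (t \<bullet> b)\<^sup>2) \<le> (\<Prod>b\<in>(Basis::'a set). (1 + norm t)\<^sup>2)"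
      proof (rule prod_mono, intro conjI)
        fix b :: 'a assume "b \<in> Basis"
        then have "\<bar>t \<bullet> b\<bar>\<^sup>2 \<le> (norm t)\<^sup>2" by (intro power_mono Basis_le_norm) auto
        then show "1 + (t \<bullet> b)\<^sup>2 \<le> (1 + norm t)\<^sup>2" by (simp add: power2_sum add_increasing2)
      qed auto
      also have "\<dots> = (1 + norm t) ^ (2 * DIM('a))" by (simp add: power_mult)
      finally have "inverse ((1 + norm t) ^ (2 * DIM('a))) \<le> inverse (\<Prod>b\<in>Basis. 1 + (t \<bullet> b)\<^sup>2)"
        by (intro le_imp_inverse_le) (auto intro!: prod_pos add_pos_nonneg)
      then show ?thesis by (simp add: prod_inversef[symmetric])
    qed
    then show "AE t in lborel. norm (inverse ((1 + norm t) ^ (2 * DIM('a)))) \<le> norm (\<Prod>b\<in>Basis. inverse (1 + ((t::'a) \<bullet> b)\<^sup>2))"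
      by (intro AE_I2) (simp add: abs_prod)
  qed measurable
qed

lemma schwartz_integrable:
  fixes \<phi> :: "'a::euclidean_space \<Rightarrow> complex"
  assumes "\<phi> \<in> schwartz_space"
  shows "integrable lborel \<phi>"
proof -
  obtain C where C: "C \<ge> 0" "\<And>x. (1 + norm x) ^ (2 * DIM('a)) * norm (\<phi> x) \<le> C" using schwartz_decay[OF assms] by metis
  show ?thesis
  proof (rule Bochner_Integration.integrable_bound[OF integrable_mult_right[OF integrable_polynomial_decay, of C]])
    show "AE x in lborel. norm (\<phi> x) \<le> norm (C * inverse ((1 + norm x) ^ (2 * DIM('a))))"
      using C by (intro AE_I2) (simp add: field_simps add_pos_nonneg)
  qed (use assms schwartz_borel in simp)
qed

lemma lborel_integral_shift:
  fixes f :: "'a::euclidean_space \<Rightarrow> complex"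
  assumes [measurable]: "f \<in> borel_measurable borel"
  shows "(LINT x|lborel. f (x + c)) = (LINT x|lborel. f x)"
proof -
  have "(LINT x|lborel. f x) = (LINT x|distr lborel borel ((+) c). f x)" by (simp add: lborel_distr_plus)
  also have "\<dots> = (LINT x|lborel. f (c + x))" by (subst integral_distr) auto
  finally show ?thesis by (simp add: add.commute)
qed

lemma lborel_nn_integral_shift:
  fixes f :: "'a::euclidean_space \<Rightarrow> ennreal"
  assumes [measurable]: "f \<in> borel_measurable borel"
  shows "(\<integral>\<^sup>+x. f (x + c) \<partial>lborel) = (\<integral>\<^sup>+x. f x \<partial>lborel)"
proof -
  have "(\<integral>\<^sup>+x. f x \<partial>lborel) = (\<integral>\<^sup>+x. f x \<partial>distr lborel borel ((+) c))" by (simp add: lborel_distr_plus)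
  also have "\<dots> = (\<integral>\<^sup>+x. f (c + x) \<partial>lborel)" by (subst nn_integral_distr) auto
  finally show ?thesis by (simp add: add.commute)
qed

text \<open>
  The majorant is local in \<open>p\<close> because a translated Schwartz function has one majorant for all bounded
  translations, but none for all translations.
\<close>

lemma has_derivative_integral_dominated:
  fixes g :: "'p::euclidean_space \<Rightarrow> 'a \<Rightarrow> complex"
  assumes e: "e > 0"
    and int: "\<And>x. x \<in> ball p e \<Longrightarrow> integrable M (g x)"
    and der: "\<And>x t. x \<in> ball p e \<Longrightarrow> ((\<lambda>x. g x t) has_derivative g' x t) (at x)"
    and meas [measurable]: "\<And>v. (\<lambda>t. g' p t v) \<in> borel_measurable M"
    and bd: "\<And>x t v. x \<in> ball p e \<Longrightarrow> norm (g' x t v) \<le> B t * norm v"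
    and B: "integrable M B"
  shows "((\<lambda>x. LINT t|M. g x t) has_derivative (\<lambda>v. LINT t|M. g' p t v)) (at p)"
proof -
  have p: "p \<in> ball p e" using e by simp
  have lin: "linear (g' p t)" for t using der[OF p] has_derivative_linear by blast
  have int': "integrable M (\<lambda>t. g' p t v)" for v
  proof (rule Bochner_Integration.integrable_bound[OF integrable_mult_left[OF B, of "norm v"] meas])
    have "norm (g' p t v) \<le> norm (B t * norm v)" for t
      using bd[OF p, of t v] unfolding real_norm_def by linarith
    then show "AE t in M. norm (g' p t v) \<le> norm (B t * norm v)" by simp
  qed
  have bl: "bounded_linear (\<lambda>v. LINT t|M. g' p t v)"
  proof (rule bounded_linear_intro)
    show "(LINT t|M. g' p t (x + y)) = (LINT t|M. g' p t x) + (LINT t|M. g' p t y)" for x y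
      by (simp add: linear_add[OF lin] int')
    show "(LINT t|M. g' p t (r *\<^sub>R x)) = r *\<^sub>R (LINT t|M. g' p t x)" for r x
      by (simp add: linear_scale[OF lin])
    show "norm (LINT t|M. g' p t x) \<le> norm x * (LINT t|M. B t)" for x
    proof -
      have "norm (LINT t|M. g' p t x) \<le> (LINT t|M. norm (g' p t x))" by (rule integral_norm_bound)
      also have "\<dots> \<le> (LINT t|M. B t * norm x)"
        by (intro integral_mono integrable_norm int' integrable_mult_left B bd[OF p])
      finally show ?thesis by (simp add: mult.commute)
    qed
  qed
  let ?r = "\<lambda>h t. norm (g (p + h) t - g p t - g' p t h) / norm h"
  \<comment> \<open>Restricting to the ball keeps every term of the sequences in the region where the majorant holds.\<close>
  have "((\<lambda>h. LINT t|M. ?r h t) \<longlongrightarrow> 0) (at 0 within ball 0 e)"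
    unfolding tendsto_at_iff_sequentially o_def
  proof (intro allI impI)
    fix X assume X: "\<forall>i. X i \<in> ball (0::'p) e - {0}" "X \<longlonglongrightarrow> 0"
    then have pX: "p + X i \<in> ball p e" for i by (auto simp: dist_norm)
    have "(\<lambda>i. LINT t|M. ?r (X i) t) \<longlonglongrightarrow> (LINT t|M. 0)"
    proof (rule integral_dominated_convergence[where w="\<lambda>t. 2 * B t"])
      show "integrable M (\<lambda>t. 2 * B t)" using B by simp
      show "(\<lambda>t. ?r (X i) t) \<in> borel_measurable M" for i
        using borel_measurable_integrable[OF int[OF pX[of i]]] borel_measurable_integrable[OF int[OF p]] by measurable
      show "AE t in M. (\<lambda>i. ?r (X i) t) \<longlonglongrightarrow> 0"
      proof (rule AE_I2)
        fix t
        have "((\<lambda>h. ?r h t) \<longlongrightarrow> 0) (at 0)"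
          using der[OF p, of t] by (simp add: has_derivative_at)
        then have "((\<lambda>h. ?r h t) \<longlongrightarrow> 0) (at 0 within UNIV)" by simp
        then show "(\<lambda>i. ?r (X i) t) \<longlonglongrightarrow> 0"
          unfolding tendsto_at_iff_sequentially o_def using X by blast
      qed
      show "AE t in M. norm (?r (X i) t) \<le> 2 * B t" for i
      proof (rule AE_I2)
        fix t
        have B0: "onorm (g' x t) \<le> B t" if "x \<in> ball p e" for x
          using bd[OF that] by (intro onorm_le) (simp add: mult.commute)
        have "norm (g (p + X i) t - g p t) \<le> B t * norm (p + X i - p)"
          by (rule differentiable_bound[where f="\<lambda>x. g x t" and f'="\<lambda>x. g' x t", OF convex_ball has_derivative_at_withinI[OF der] B0 pX p])
        moreover have "norm (g' p t (X i)) \<le> B t * norm (X i)" by (rule bd[OF p])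
        ultimately have "norm (g (p + X i) t - g p t - g' p t (X i)) \<le> 2 * B t * norm (X i)"
          using norm_triangle_ineq4[of "g (p + X i) t - g p t" "g' p t (X i)"] by simp
        moreover have "norm (X i) > 0" using X by auto
        ultimately show "norm (?r (X i) t) \<le> 2 * B t" by (simp add: pos_divide_le_eq)
      qed
    qed simp
    then show "(\<lambda>i. LINT t|M. ?r (X i) t) \<longlonglongrightarrow> 0" by simp
  qed
  then have lim: "((\<lambda>h. LINT t|M. ?r h t) \<longlongrightarrow> 0) (at 0)"
    using at_within_open[of 0 "ball (0::'p) e"] e by simp
  have "((\<lambda>h. norm ((LINT t|M. g (p + h) t) - (LINT t|M. g p t) - (LINT t|M. g' p t h)) / norm h) \<longlongrightarrow> 0) (at 0)"
  proof (rule tendsto_sandwich[OF _ _ tendsto_const lim])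
    have "eventually (\<lambda>h. h \<in> ball 0 e) (at (0::'p))"
      using e by (intro eventually_at_in_open') auto
    then show "\<forall>\<^sub>F h in at 0. norm ((LINT t|M. g (p + h) t) - (LINT t|M. g p t) - (LINT t|M. g' p t h)) / norm h \<le> (LINT t|M. ?r h t)"
    proof eventually_elim
      case (elim h)
      then have "p + h \<in> ball p e" by (auto simp: dist_norm)
      then have "(LINT t|M. g (p + h) t) - (LINT t|M. g p t) - (LINT t|M. g' p t h) = (LINT t|M. g (p + h) t - g p t - g' p t h)"
        using int[of "p + h"] int[OF p] int'[of h] by simp
      then show ?case by (simp add: divide_right_mono integral_norm_bound)
    qed
  qed auto
  then show ?thesis using bl by (simp add: has_derivative_at)
qed

lemma schwartz_dir_deriv_decay:
  assumes "\<phi> \<in> schwartz_space"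
  obtains C where "C \<ge> 0" "\<And>x v. (1 + norm x) ^ k * norm (dir_deriv v \<phi> x) \<le> C * norm v"
proof -
  have "\<forall>b. \<exists>C. C \<ge> 0 \<and> (\<forall>x. (1 + norm x) ^ k * norm (dir_deriv b \<phi> x) \<le> C)"
    using schwartz_decay[OF schwartz_dir_deriv_in[OF assms]] by metis
  then obtain C where C: "\<And>b. C b \<ge> 0" "\<And>b x. (1 + norm x) ^ k * norm (dir_deriv b \<phi> x) \<le> C b" by metis
  have "(1 + norm x) ^ k * norm (dir_deriv v \<phi> x) \<le> (\<Sum>b\<in>Basis. C b) * norm v" for x v
  proof -
    have "norm (dir_deriv v \<phi> x) \<le> (\<Sum>b\<in>Basis. norm v * norm (dir_deriv b \<phi> x))"
      unfolding schwartz_dir_deriv_eq_sum[OF assms, of v]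
      by (rule order_trans[OF norm_sum], intro sum_mono) (simp add: norm_mult Basis_le_norm mult_right_mono)
    then have "(1 + norm x) ^ k * norm (dir_deriv v \<phi> x) \<le> (1 + norm x) ^ k * (\<Sum>b\<in>Basis. norm v * norm (dir_deriv b \<phi> x))"
      by (intro mult_left_mono) auto
    also have "\<dots> = (\<Sum>b\<in>Basis. norm v * ((1 + norm x) ^ k * norm (dir_deriv b \<phi> x)))"
      by (simp add: sum_distrib_left mult_ac)
    also have "\<dots> \<le> (\<Sum>b\<in>Basis. norm v * C b)" by (intro sum_mono mult_left_mono C) auto
    finally show ?thesis by (simp add: sum_distrib_left mult.commute)
  qed
  then show ?thesis by (intro that[of "\<Sum>b\<in>Basis. C b"]) (auto simp: C sum_nonneg)
qed

text \<open>
  The integral of \<open>f (t + s *\<^sub>R v)\<close> over \<open>t\<close> does not depend on \<open>s\<close>; its derivative at \<open>s = 0\<close> is the left-hand side.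
\<close>

lemma integral_dir_deriv_eq_0:
  fixes f :: "'a::euclidean_space \<Rightarrow> complex"
  assumes f: "f \<in> schwartz_space"
  shows "(LINT t|lborel. dir_deriv v f t) = 0"
proof -
  let ?m = "2 * DIM('a)"
  obtain C where C: "C \<ge> 0" "\<And>x v. (1 + norm x) ^ ?m * norm (dir_deriv v f x) \<le> C * norm v"
    using schwartz_dir_deriv_decay[OF f] by metis
  have shift: "(\<lambda>x. f (x + c)) \<in> schwartz_space" for c
    using schwartz_affine[OF f, of "\<lambda>x. x" c] by (simp add: linear_ident)
  have "((\<lambda>s::real. LINT t|lborel. f (t + s *\<^sub>R v)) has_derivative (\<lambda>s. LINT t|lborel. s *\<^sub>R dir_deriv v f (t + 0 *\<^sub>R v))) (at 0)"
  proof (rule has_derivative_integral_dominated[where e=1 and g' = "\<lambda>s t r. r *\<^sub>R dir_deriv v f (t + s *\<^sub>R v)"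
        and B = "\<lambda>t. C * norm v * (1 + norm v) ^ ?m * inverse ((1 + norm t) ^ ?m)"])
    show "integrable lborel (\<lambda>t. f (t + s *\<^sub>R v))" for s by (rule schwartz_integrable[OF shift])
    show "integrable lborel (\<lambda>t::'a. C * norm v * (1 + norm v) ^ ?m * inverse ((1 + norm t) ^ ?m))"
      by (intro integrable_mult_right integrable_polynomial_decay)
    show "(\<lambda>t. r *\<^sub>R dir_deriv v f (t + 0 *\<^sub>R v)) \<in> borel_measurable lborel" for r
      using schwartz_borel[OF schwartz_dir_deriv_in[OF f]] by simp
    fix s t assume s: "s \<in> ball (0::real) 1"
    have l: "linear (\<lambda>v. dir_deriv v f (t + s *\<^sub>R v'))" for v'
      using schwartz_has_derivative[OF f] has_derivative_linear by blast
    have "((\<lambda>s. f (t + s *\<^sub>R v)) has_derivative (\<lambda>r. dir_deriv (r *\<^sub>R v) f (t + s *\<^sub>R v))) (at s)"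
      by (rule has_derivative_compose[where g=f and f="\<lambda>s. t + s *\<^sub>R v", OF _ schwartz_has_derivative[OF f]])
        (auto intro!: derivative_eq_intros)
    then show "((\<lambda>s. f (t + s *\<^sub>R v)) has_derivative (\<lambda>r. r *\<^sub>R dir_deriv v f (t + s *\<^sub>R v))) (at s)"
      by (simp add: linear_scale[OF l])
    fix r
    have "norm (s *\<^sub>R v) \<le> norm v" using s by (simp add: mult_left_le_one_le)
    then have "norm t \<le> norm (t + s *\<^sub>R v) + norm v"
      using norm_triangle_ineq4[of "t + s *\<^sub>R v" "s *\<^sub>R v"] by simp
    then have "1 + norm t \<le> (1 + norm v) * (1 + norm (t + s *\<^sub>R v))"
      using mult_nonneg_nonneg[OF norm_ge_zero[of v] norm_ge_zero[of "t + s *\<^sub>R v"]]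
      unfolding distrib_left distrib_right by linarith
    then have "(1 + norm t) ^ ?m \<le> (1 + norm v) ^ ?m * (1 + norm (t + s *\<^sub>R v)) ^ ?m"
      unfolding power_mult_distrib[symmetric] by (intro power_mono) auto
    then have "(1 + norm t) ^ ?m * norm (dir_deriv v f (t + s *\<^sub>R v))
       \<le> (1 + norm v) ^ ?m * ((1 + norm (t + s *\<^sub>R v)) ^ ?m * norm (dir_deriv v f (t + s *\<^sub>R v)))"
      unfolding mult.assoc[symmetric] by (intro mult_right_mono) auto
    also have "\<dots> \<le> (1 + norm v) ^ ?m * (C * norm v)" by (intro mult_left_mono C) auto
    finally have "norm (dir_deriv v f (t + s *\<^sub>R v)) \<le> C * norm v * (1 + norm v) ^ ?m * inverse ((1 + norm t) ^ ?m)"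
      by (simp add: field_simps add_pos_nonneg)
    then show "norm (r *\<^sub>R dir_deriv v f (t + s *\<^sub>R v)) \<le> C * norm v * (1 + norm v) ^ ?m * inverse ((1 + norm t) ^ ?m) * norm r"
      by (simp add: mult.commute[of _ "\<bar>r\<bar>"] mult_left_mono)
  qed auto
  moreover have "(LINT t|lborel. f (t + s *\<^sub>R v)) = (LINT t|lborel. f t)" for s
    by (rule lborel_integral_shift[OF schwartz_borel[OF f]])
  ultimately have "((\<lambda>s::real. LINT t|lborel. f t) has_derivative (\<lambda>s. s *\<^sub>R (LINT t|lborel. dir_deriv v f t))) (at 0)"
    by simp
  from has_derivative_unique[OF this has_derivative_const] have "(\<lambda>s::real. s *\<^sub>R (LINT t|lborel. dir_deriv v f t)) = (\<lambda>s. 0)" .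
  from fun_cong[OF this, of 1] show ?thesis by simp
qed

section \<open>The partial Fourier transform on the Schwartz space\<close>

lemma schwartz_section:
  assumes "\<phi> \<in> schwartz_space"
  shows "(\<lambda>t. \<phi> (x, t)) \<in> schwartz_space"
proof -
  have "linear (\<lambda>t::'b. (0::'a, t))" by (intro linearI) auto
  from schwartz_affine[OF assms this, of "(x, 0)"] show ?thesis by (simp add: inj_def)
qed

lemma schwartz_section_modulated:
  assumes "\<phi> \<in> schwartz_space"
  shows "(\<lambda>t. cis (- (2 * pi * (\<omega> \<bullet> t))) * \<phi> (x, t)) \<in> schwartz_space"
  using schwartz_modulation[OF schwartz_section[OF assms, of x], of "- (2 * pi) *\<^sub>R \<omega>"]
  by (simp add: inner_commute)

lemma partial_fourier2_apply:
  "partial_fourier2 \<phi> (x, \<omega>) = (LINT t|lborel. cis (- (2 * pi * (\<omega> \<bullet> t))) * \<phi> (x, t))"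
  by (simp add: partial_fourier2_def)

lemma partial_fourier2_add:
  assumes "\<phi> \<in> schwartz_space" "\<psi> \<in> schwartz_space"
  shows "partial_fourier2 (\<lambda>z. \<phi> z + \<psi> z) = (\<lambda>z. partial_fourier2 \<phi> z + partial_fourier2 \<psi> z)"
  using schwartz_integrable[OF schwartz_section_modulated[OF assms(1)]]
    schwartz_integrable[OF schwartz_section_modulated[OF assms(2)]]
  by (auto simp: partial_fourier2_def distrib_left)

lemma partial_fourier2_cmult:
  "partial_fourier2 (\<lambda>z. c * \<phi> z) = (\<lambda>z. c * partial_fourier2 \<phi> z)"
  by (auto simp: partial_fourier2_def mult.left_commute[of _ c])

text \<open>
  The operator on the input that produces the derivative of the partial Fourier transform along \<open>v\<close>: it
  differentiates in the untransformed variable and multiplies by the transformed one.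
\<close>

definition pf2_derivative ::
    "'a \<times> 'b \<Rightarrow> ('a::euclidean_space \<times> 'b::euclidean_space \<Rightarrow> complex) \<Rightarrow> 'a \<times> 'b \<Rightarrow> complex" where
  "pf2_derivative v \<phi> = (\<lambda>z. dir_deriv (fst v, 0) \<phi> z + - (2 * pi * \<i>) * (complex_of_real (z \<bullet> (0, snd v)) * \<phi> z))"

lemma schwartz_continuous_pf2_derivative: "schwartz_continuous (pf2_derivative v)"
  unfolding pf2_derivative_def
  by (intro schwartz_continuous_add schwartz_continuous_dir_deriv_all
      schwartz_continuous_comp[OF schwartz_continuous_cmult] schwartz_continuous_mult_inner)

lemma has_derivative_partial_fourier2:
  fixes \<phi> :: "'a::euclidean_space \<times> 'b::euclidean_space \<Rightarrow> complex"
  assumes \<phi>: "\<phi> \<in> schwartz_space"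
  shows "(partial_fourier2 \<phi> has_derivative (\<lambda>v. partial_fourier2 (pf2_derivative v \<phi>) z)) (at z)"
proof -
  let ?m = "2 * DIM('b)"
  define e where "e \<omega> t = cis (- (2 * pi * (\<omega> \<bullet> t)))" for \<omega> t :: 'b
  define g where "g z t = e (snd z) t * \<phi> (fst z, t)" for z :: "'a \<times> 'b" and t
  define g' where "g' z t v = e (snd z) t * pf2_derivative v \<phi> (fst z, t)" for z v :: "'a \<times> 'b" and t
  obtain C where C: "C \<ge> 0" "\<And>x v. (1 + norm x) ^ ?m * norm (dir_deriv v \<phi> x) \<le> C * norm v"
    using schwartz_dir_deriv_decay[OF \<phi>] by metis
  obtain D where D: "D \<ge> 0" "\<And>x. (1 + norm x) ^ Suc ?m * norm (\<phi> x) \<le> D"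
    using schwartz_decay[OF \<phi>] by metis
  have "((\<lambda>z. LINT t|lborel. g z t) has_derivative (\<lambda>v. LINT t|lborel. g' z t v)) (at z)"
  proof (rule has_derivative_integral_dominated[where e=1 and B="\<lambda>t. (C + 2 * pi * D) * inverse ((1 + norm t) ^ ?m)"])
    show "integrable lborel (g x)" for x
      unfolding g_def e_def by (rule schwartz_integrable[OF schwartz_section_modulated[OF \<phi>]])
    show "(\<lambda>t. g' z t v) \<in> borel_measurable lborel" for v
      unfolding g'_def e_def
      using schwartz_borel[OF schwartz_section_modulated[OF schwartz_continuous_in[OF schwartz_continuous_pf2_derivative \<phi>]]] by simp
    show "integrable lborel (\<lambda>t::'b. (C + 2 * pi * D) * inverse ((1 + norm t) ^ ?m))"
      by (intro integrable_mult_right integrable_polynomial_decay)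
    fix x :: "'a \<times> 'b" and t
    have d1: "((\<lambda>z. e (snd z) t) has_derivative (\<lambda>v. (- (2 * pi * (snd v \<bullet> t))) *\<^sub>R (\<i> * e (snd x) t))) (at x)"
      unfolding e_def by (rule has_derivative_cis) (auto intro!: derivative_eq_intros)
    have d2: "((\<lambda>z. \<phi> (fst z, t)) has_derivative (\<lambda>v. dir_deriv (fst v, 0) \<phi> (fst x, t))) (at x)"
      by (rule has_derivative_compose[where g=\<phi> and f="\<lambda>z. (fst z, t)", OF _ schwartz_has_derivative[OF \<phi>]])
        (auto intro!: derivative_eq_intros)
    show "((\<lambda>z. g z t) has_derivative g' x t) (at x)"
      unfolding g_def
      by (rule has_derivative_eq_rhs[OF has_derivative_mult[OF d1 d2]])
        (auto simp: fun_eq_iff g'_def pf2_derivative_def algebra_simps scaleR_conv_of_real inner_commute)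
    fix v :: "'a \<times> 'b"
    let ?z = "(fst x, t)"
    have pw: "norm (g' x t v) \<le> norm (dir_deriv (fst v, 0) \<phi> ?z) + 2 * pi * (\<bar>t \<bullet> snd v\<bar> * norm (\<phi> ?z))"
      unfolding g'_def pf2_derivative_def e_def norm_mult norm_cis
      by (rule order_trans[OF mult_left_mono[OF norm_triangle_ineq]]) (auto simp: norm_mult)
    have "(1 + norm t) ^ ?m * norm (g' x t v) \<le> (1 + norm ?z) ^ ?m * norm (g' x t v)"
      using norm_snd_le[of t "fst x"] by (intro mult_right_mono power_mono) auto
    also have "\<dots> \<le> (1 + norm ?z) ^ ?m * (norm (dir_deriv (fst v, 0) \<phi> ?z) + 2 * pi * (\<bar>t \<bullet> snd v\<bar> * norm (\<phi> ?z)))"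
      by (intro mult_left_mono pw) auto
    also have "(1 + norm ?z) ^ ?m * (norm (dir_deriv (fst v, 0) \<phi> ?z) + 2 * pi * (\<bar>t \<bullet> snd v\<bar> * norm (\<phi> ?z)))
       = (1 + norm ?z) ^ ?m * norm (dir_deriv (fst v, 0) \<phi> ?z) + 2 * pi * ((1 + norm ?z) ^ ?m * \<bar>t \<bullet> snd v\<bar> * norm (\<phi> ?z))"
      by (simp add: algebra_simps)
    also have "\<dots> \<le> C * norm v + 2 * pi * (D * norm v)"
    proof (intro add_mono mult_left_mono)
      have "norm (fst v, 0::'b) \<le> norm v" using norm_fst_le[of "fst v" "snd v"] by simp
      then show "(1 + norm ?z) ^ ?m * norm (dir_deriv (fst v, 0) \<phi> ?z) \<le> C * norm v"
        using C(2)[of ?z "(fst v, 0)"] mult_left_mono[OF _ C(1)] by force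
      have "\<bar>t \<bullet> snd v\<bar> \<le> norm t * norm (snd v)" by (rule Cauchy_Schwarz_ineq2)
      also have "\<dots> \<le> (1 + norm ?z) * norm v"
        using norm_snd_le[of t "fst x"] norm_snd_le[of "snd v" "fst v"] by (intro mult_mono) auto
      finally have "(1 + norm ?z) ^ ?m * \<bar>t \<bullet> snd v\<bar> * norm (\<phi> ?z) \<le> (1 + norm ?z) ^ ?m * ((1 + norm ?z) * norm v) * norm (\<phi> ?z)"
        by (intro mult_right_mono mult_left_mono) auto
      also have "\<dots> = (1 + norm ?z) ^ Suc ?m * norm (\<phi> ?z) * norm v" by (simp add: mult_ac)
      also have "\<dots> \<le> D * norm v" by (intro mult_right_mono D) auto
      finally show "(1 + norm ?z) ^ ?m * \<bar>t \<bullet> snd v\<bar> * norm (\<phi> ?z) \<le> D * norm v" .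
    qed auto
    finally have "(1 + norm t) ^ ?m * norm (g' x t v) \<le> (C + 2 * pi * D) * norm v"
      by (simp add: algebra_simps)
    then show "norm (g' x t v) \<le> (C + 2 * pi * D) * inverse ((1 + norm t) ^ ?m) * norm v"
      by (simp add: field_simps add_pos_nonneg)
  qed simp
  then show ?thesis
    by (simp add: g_def g'_def e_def partial_fourier2_def case_prod_unfold)
qed

lemma dir_deriv_partial_fourier2:
  "\<phi> \<in> schwartz_space \<Longrightarrow> dir_deriv v (partial_fourier2 \<phi>) = partial_fourier2 (pf2_derivative v \<phi>)"
  by (rule dir_deriv_eqI[OF has_derivative_partial_fourier2])

text \<open>
  Integration by parts: the derivative of a modulated section of \<open>\<phi>\<close> has integral zero.
\<close>

lemma partial_fourier2_dir_deriv:
  fixes \<phi> :: "'a::euclidean_space \<times> 'b::euclidean_space \<Rightarrow> complex"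
  assumes \<phi>: "\<phi> \<in> schwartz_space"
  shows "partial_fourier2 (dir_deriv (0, b) \<phi>) (x, \<omega>) = 2 * pi * \<i> * (\<omega> \<bullet> b) * partial_fourier2 \<phi> (x, \<omega>)"
proof -
  define f where "f t = cis (- (2 * pi * (\<omega> \<bullet> t))) * \<phi> (x, t)" for t
  have f: "f \<in> schwartz_space" unfolding f_def by (rule schwartz_section_modulated[OF \<phi>])
  have "(f has_derivative (\<lambda>v. cis (- (2 * pi * (\<omega> \<bullet> t))) * dir_deriv (0, v) \<phi> (x, t)
      + - (2 * pi * (\<omega> \<bullet> v)) * \<i> * f t)) (at t)" for t
  proof -
    have d1: "((\<lambda>t. cis (- (2 * pi * (\<omega> \<bullet> t)))) has_derivative (\<lambda>v. (- (2 * pi * (\<omega> \<bullet> v))) *\<^sub>R (\<i> * cis (- (2 * pi * (\<omega> \<bullet> t)))))) (at t)"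
      by (rule has_derivative_cis) (auto intro!: derivative_eq_intros)
    have d2: "((\<lambda>t. \<phi> (x, t)) has_derivative (\<lambda>v. dir_deriv (0, v) \<phi> (x, t))) (at t)"
      by (rule has_derivative_compose[where g=\<phi> and f="\<lambda>t. (x, t)", OF _ schwartz_has_derivative[OF \<phi>]])
        (auto intro!: derivative_eq_intros)
    show ?thesis
      unfolding f_def by (rule has_derivative_eq_rhs[OF has_derivative_mult[OF d1 d2]])
        (auto simp: fun_eq_iff scaleR_conv_of_real algebra_simps)
  qed
  then have "dir_deriv b f = (\<lambda>t. cis (- (2 * pi * (\<omega> \<bullet> t))) * dir_deriv (0, b) \<phi> (x, t)
      + - (2 * pi * (\<omega> \<bullet> b)) * \<i> * f t)"
    by (rule dir_deriv_eqI)
  then have "0 = (LINT t|lborel. cis (- (2 * pi * (\<omega> \<bullet> t))) * dir_deriv (0, b) \<phi> (x, t)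
      + - (2 * pi * (\<omega> \<bullet> b)) * \<i> * f t)"
    using integral_dir_deriv_eq_0[OF f, of b] by simp
  also have "\<dots> = (LINT t|lborel. cis (- (2 * pi * (\<omega> \<bullet> t))) * dir_deriv (0, b) \<phi> (x, t))
      + - (2 * pi * (\<omega> \<bullet> b)) * \<i> * (LINT t|lborel. f t)"
    using schwartz_integrable[OF schwartz_section_modulated[OF schwartz_dir_deriv_in[OF \<phi>]]] schwartz_integrable[OF f]
    by (subst Bochner_Integration.integral_add) auto
  finally show ?thesis by (simp add: partial_fourier2_apply f_def algebra_simps)
qed

text \<open>
  Decay in the frequency is gained one power at a time, each power costing one derivative of the input.
  The induction works because the claim for \<open>k\<close> concerns all inputs, hence also the derivatives of \<open>\<phi>\<close>.
\<close>

lemma schwartz_bounded_partial_fourier2: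
  "schwartz_bounded (\<lambda>(\<phi> :: 'a::euclidean_space \<times> 'b::euclidean_space \<Rightarrow> complex) z.
     (1 + norm (fst z)) ^ j * (1 + norm (snd z)) ^ k * norm (partial_fourier2 \<phi> z))"
proof (induction k)
  case 0
  let ?m = "2 * DIM('b)"
  let ?I = "LINT t|lborel. inverse ((1 + norm (t::'b)) ^ ?m)"
  obtain C N where C: "C \<ge> 0" "\<And>\<phi> z. (\<phi> :: 'a \<times> 'b \<Rightarrow> complex) \<in> schwartz_space \<Longrightarrow> (1 + norm z) ^ (j + ?m) * norm (\<phi> z) \<le> C * schwartz_seminorm N \<phi>"
    using schwartz_boundedE[OF schwartz_bounded_decay0[of "j + ?m"]] by metis
  show ?case
  proof (rule schwartz_boundedI[where C="C * ?I" and N=N])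
    fix \<phi> :: "'a \<times> 'b \<Rightarrow> complex" and z :: "'a \<times> 'b" assume \<phi>: "\<phi> \<in> schwartz_space"
    obtain x \<omega> where z: "z = (x, \<omega>)" by (cases z)
    have bd: "(1 + norm x) ^ j * norm (\<phi> (x, t)) \<le> C * schwartz_seminorm N \<phi> * inverse ((1 + norm t) ^ ?m)" for t
    proof -
      have "((1 + norm x) ^ j * (1 + norm t) ^ ?m) * norm (\<phi> (x, t)) \<le> ((1 + norm (x, t)) ^ (j + ?m)) * norm (\<phi> (x, t))"
        by (intro mult_right_mono power_norms_le_pair) auto
      also note C(2)[OF \<phi>, of "(x, t)"]
      finally show ?thesis by (simp add: field_simps add_pos_nonneg)
    qed
    have int: "integrable lborel (\<lambda>t. cis (- (2 * pi * (\<omega> \<bullet> t))) * \<phi> (x, t))"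
      by (rule schwartz_integrable[OF schwartz_section_modulated[OF \<phi>]])
    have "(1 + norm x) ^ j * norm (partial_fourier2 \<phi> (x, \<omega>))
       \<le> (1 + norm x) ^ j * (LINT t|lborel. norm (cis (- (2 * pi * (\<omega> \<bullet> t))) * \<phi> (x, t)))"
      unfolding partial_fourier2_apply by (intro mult_left_mono integral_norm_bound) auto
    also have "\<dots> = (LINT t|lborel. (1 + norm x) ^ j * norm (cis (- (2 * pi * (\<omega> \<bullet> t))) * \<phi> (x, t)))" by simp
    also have "\<dots> \<le> (LINT t|lborel. C * schwartz_seminorm N \<phi> * inverse ((1 + norm (t::'b)) ^ ?m))"
      by (intro integral_mono integrable_mult_right integrable_polynomial_decay integrable_norm int)
        (use bd in \<open>simp add: norm_mult\<close>)
    also have "\<dots> = C * ?I * schwartz_seminorm N \<phi>" by simp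
    finally show "(1 + norm (fst z)) ^ j * (1 + norm (snd z)) ^ 0 * norm (partial_fourier2 \<phi> z) \<le> C * ?I * schwartz_seminorm N \<phi>"
      by (simp add: z)
  qed
next
  case (Suc k)
  let ?B = "\<lambda>(\<phi> :: 'a \<times> 'b \<Rightarrow> complex) z. (1 + norm (fst z)) ^ j * (1 + norm (snd z)) ^ k * norm (partial_fourier2 \<phi> z)"
  have "schwartz_bounded (\<lambda>\<phi> z. ?B \<phi> z + (\<Sum>b\<in>Basis. ?B (dir_deriv (0, b) \<phi>) z))"
    by (intro schwartz_bounded_add schwartz_bounded_sum schwartz_bounded_comp[OF schwartz_continuous_dir_deriv_all] Suc.IH) auto
  then show ?case
  proof (rule schwartz_bounded_mono)
    fix \<phi> :: "'a \<times> 'b \<Rightarrow> complex" and z :: "'a \<times> 'b" assume \<phi>: "\<phi> \<in> schwartz_space"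
    obtain x \<omega> where z: "z = (x, \<omega>)" by (cases z)
    let ?F = "norm (partial_fourier2 \<phi> z)"
    have "\<bar>\<omega> \<bullet> b\<bar> * ?F \<le> norm (partial_fourier2 (dir_deriv (0, b) \<phi>) z)" for b
    proof -
      have "1 * (\<bar>\<omega> \<bullet> b\<bar> * ?F) \<le> 2 * pi * (\<bar>\<omega> \<bullet> b\<bar> * ?F)"
        using pi_ge_two by (intro mult_right_mono) auto
      then show ?thesis by (simp add: z partial_fourier2_dir_deriv[OF \<phi>] norm_mult mult_ac)
    qed
    moreover have "norm \<omega> * ?F \<le> (\<Sum>b\<in>Basis. \<bar>\<omega> \<bullet> b\<bar>) * ?F"
      by (intro mult_right_mono norm_le_l1) auto
    ultimately have "norm \<omega> * ?F \<le> (\<Sum>b\<in>Basis. norm (partial_fourier2 (dir_deriv (0, b) \<phi>) z))"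
      unfolding sum_distrib_right by (meson order_trans sum_mono)
    then have "(1 + norm x) ^ j * (1 + norm \<omega>) ^ k * ((1 + norm \<omega>) * ?F)
      \<le> (1 + norm x) ^ j * (1 + norm \<omega>) ^ k * (?F + (\<Sum>b\<in>Basis. norm (partial_fourier2 (dir_deriv (0, b) \<phi>) z)))"
      by (intro mult_left_mono) (auto simp: distrib_right)
    then show "\<exists>y. (1 + norm (fst z)) ^ j * (1 + norm (snd z)) ^ Suc k * norm (partial_fourier2 \<phi> z)
      \<le> ?B \<phi> y + (\<Sum>b\<in>Basis. ?B (dir_deriv (0, b) \<phi>) y)"
      by (intro exI[of _ z]) (simp add: z distrib_left sum_distrib_left mult_ac)
  qed
qed

text \<open>
  The operators \<open>\<lambda>\<phi>. partial_fourier2 (A \<phi>)\<close> with continuous \<open>A\<close> form a stable class.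
\<close>

theorem schwartz_continuous_partial_fourier2:
  "schwartz_continuous (partial_fourier2 :: ('a::euclidean_space \<times> 'b::euclidean_space \<Rightarrow> complex) \<Rightarrow> _)"
proof (rule schwartz_continuous_coinduct)
  let ?\<T> = "{U. \<exists>A :: _ \<Rightarrow> 'a \<times> 'b \<Rightarrow> complex. U = (\<lambda>(\<phi>::'a\<times>'b\<Rightarrow>complex). partial_fourier2 (A \<phi>)) \<and> schwartz_continuous A}"
  show "partial_fourier2 \<in> ?\<T>"
    using schwartz_continuous_id by (intro CollectI exI[of _ "\<lambda>\<phi>. \<phi>"] conjI) auto
  fix U assume "U \<in> ?\<T>"
  then obtain A where U: "U = (\<lambda>\<phi>. partial_fourier2 (A \<phi>))" and A: "schwartz_continuous A"
    by blast
  show "U \<phi> differentiable (at x)" if "\<phi> \<in> schwartz_space" for \<phi> x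
    unfolding U using has_derivative_partial_fourier2[OF schwartz_continuous_in[OF A that]] differentiableI by blast
  show "\<exists>T'\<in>?\<T>. \<forall>\<phi>\<in>schwartz_space. dir_deriv b (U \<phi>) = T' \<phi>" for b
  proof (rule bexI)
    show "\<forall>\<phi>\<in>schwartz_space. dir_deriv b (U \<phi>) = partial_fourier2 (pf2_derivative b (A \<phi>))"
      unfolding U by (intro ballI dir_deriv_partial_fourier2 schwartz_continuous_in[OF A])
    show "(\<lambda>\<phi>. partial_fourier2 (pf2_derivative b (A \<phi>))) \<in> ?\<T>"
      using schwartz_continuous_comp[OF schwartz_continuous_pf2_derivative A]
      by (intro CollectI exI[of _ "\<lambda>\<phi>. pf2_derivative b (A \<phi>)"] conjI refl)
  qed
  fix k
  show "schwartz_bounded (\<lambda>\<phi> x. (1 + norm x) ^ k * norm (U \<phi> x))"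
  proof (rule schwartz_bounded_mono[OF schwartz_bounded_comp[OF A schwartz_bounded_partial_fourier2[of k k]]])
    fix \<phi> :: "'a \<times> 'b \<Rightarrow> complex" and z :: "'a \<times> 'b"
    show "\<exists>y. (1 + norm z) ^ k * norm (U \<phi> z) \<le> (1 + norm (fst y)) ^ k * (1 + norm (snd y)) ^ k * norm (partial_fourier2 (A \<phi>) y)"
      unfolding U by (intro exI[of _ z] mult_right_mono power_norm_pair_le) auto
  qed
qed

section \<open>Fourier inversion\<close>

lemma borel_measurable_cis [measurable]: "cis \<in> borel_measurable borel"
  by (intro borel_measurable_continuous_onI continuous_on_cis continuous_on_id)

text \<open>
  The left-hand side is, up to normalisation, the characteristic function of the standard normal
  distribution.
\<close>

lemma integral_gaussian_cis:
  "(LINT x|lborel. cis (t * x) * exp (- x\<^sup>2 / 2)) = sqrt (2 * pi) * exp (- t\<^sup>2 / 2)"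
proof -
  have "complex_of_real (exp (- t\<^sup>2 / 2)) = char std_normal_distribution t"
    by (simp add: char_std_normal_distribution)
  also have "\<dots> = (LINT x|lborel. std_normal_density x *\<^sub>R cis (t * x))"
    unfolding char_def by (subst integral_density) (auto simp: cis_conv_exp)
  also have "\<dots> = (LINT x|lborel. complex_of_real (1 / sqrt (2 * pi)) * (cis (t * x) * exp (- x\<^sup>2 / 2)))"
    by (intro Bochner_Integration.integral_cong) (auto simp: std_normal_density_def scaleR_conv_of_real)
  also have "\<dots> = complex_of_real (1 / sqrt (2 * pi)) * (LINT x|lborel. cis (t * x) * exp (- x\<^sup>2 / 2))"
    by simp
  finally show ?thesis by (simp add: field_simps)
qed

lemma integrable_gaussian_cis: "integrable lborel (\<lambda>x. cis (t * x) * complex_of_real (exp (- x\<^sup>2 / 2)))"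
proof (rule Bochner_Integration.integrable_bound)
  show "integrable lborel (\<lambda>x. sqrt (2 * pi) * std_normal_density x)" by simp
  show "AE x in lborel. norm (cis (t * x) * complex_of_real (exp (- x\<^sup>2 / 2))) \<le> norm (sqrt (2 * pi) * std_normal_density x)"
    by (simp add: norm_mult std_normal_density_def)
qed measurable

lemma
  fixes c :: "'a::euclidean_space"
  shows integrable_gaussian_cis_euclidean:
      "integrable lborel (\<lambda>x. cis (c \<bullet> x) * complex_of_real (exp (- (norm x)\<^sup>2 / 2)))"
    and integral_gaussian_cis_euclidean:
      "(LINT x|lborel. cis (c \<bullet> x) * exp (- (norm x)\<^sup>2 / 2)) = sqrt (2 * pi) ^ DIM('a) * exp (- (norm c)\<^sup>2 / 2)"
proof -
  interpret product_sigma_finite "\<lambda>b::'a. lborel :: real measure" by standard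
  let ?P = "Pi\<^sub>M (Basis::'a set) (\<lambda>_. lborel :: real measure)"
  define g where "g b x = cis ((c \<bullet> b) * x) * complex_of_real (exp (- x\<^sup>2 / 2))" for b x
  define h where "h x = cis (c \<bullet> x) * complex_of_real (exp (- (norm x)\<^sup>2 / 2))" for x :: 'a
  have [measurable]: "h \<in> borel_measurable borel" unfolding h_def[abs_def]
    by (intro borel_measurable_continuous_onI continuous_intros) simp
  have g: "h (\<Sum>b\<in>Basis. f b *\<^sub>R b) = (\<Prod>b\<in>Basis. g b (f b))" for f :: "'a \<Rightarrow> real"
  proof -
    have "(norm (\<Sum>b\<in>Basis. f b *\<^sub>R b))\<^sup>2 = (\<Sum>b\<in>Basis. (f b)\<^sup>2)"
      unfolding power2_norm_eq_inner by (subst euclidean_inner) (simp add: power2_eq_square)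
    then have "h (\<Sum>b\<in>Basis. f b *\<^sub>R b) = cis (\<Sum>b\<in>Basis. (c \<bullet> b) * f b) * complex_of_real (exp (\<Sum>b\<in>Basis. - (f b)\<^sup>2 / 2))"
      by (simp add: h_def inner_sum_right mult.commute sum_negf sum_divide_distrib)
    also have "\<dots> = (\<Prod>b\<in>Basis. g b (f b))"
      by (simp add: g_def prod.distrib exp_sum cis_conv_exp sum_distrib_left)
    finally show ?thesis .
  qed
  have int: "integrable ?P (\<lambda>f. \<Prod>b\<in>Basis. g b (f b))"
    unfolding g_def by (intro product_integrable_prod integrable_gaussian_cis) auto
  have [measurable]: "(\<lambda>f. \<Sum>b\<in>Basis. f b *\<^sub>R b) \<in> ?P \<rightarrow>\<^sub>M borel" by measurable
  show "integrable lborel (\<lambda>x. cis (c \<bullet> x) * complex_of_real (exp (- (norm x)\<^sup>2 / 2)))"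
    unfolding h_def[symmetric] by (subst lborel_eq, subst integrable_distr_eq) (use int in \<open>auto simp: g\<close>)
  have "(LINT x|lborel. h x) = integral\<^sup>L ?P (\<lambda>f. \<Prod>b\<in>Basis. g b (f b))"
    by (subst lborel_eq, subst integral_distr) (auto simp: g)
  also have "\<dots> = (\<Prod>b\<in>Basis. (LINT x|lborel. g b x))"
    unfolding g_def by (intro product_integral_prod integrable_gaussian_cis) auto
  also have "\<dots> = (\<Prod>b\<in>Basis. complex_of_real (sqrt (2 * pi)) * exp (- (c \<bullet> b)\<^sup>2 / 2))"
    unfolding g_def integral_gaussian_cis by simp
  also have "\<dots> = sqrt (2 * pi) ^ DIM('a) * exp (\<Sum>b\<in>Basis. - (c \<bullet> b)\<^sup>2 / 2)"
    by (simp add: prod.distrib exp_sum)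
  also have "(\<Sum>b\<in>Basis. - (c \<bullet> b)\<^sup>2 / 2) = - (norm c)\<^sup>2 / 2"
    unfolding power2_norm_eq_inner
    by (subst euclidean_inner) (simp add: power2_eq_square sum_negf sum_divide_distrib)
  finally show "(LINT x|lborel. cis (c \<bullet> x) * exp (- (norm x)\<^sup>2 / 2)) = sqrt (2 * pi) ^ DIM('a) * exp (- (norm c)\<^sup>2 / 2)"
    unfolding h_def .
qed

lemma lborel_integral_affine:
  fixes f :: "'a::euclidean_space \<Rightarrow> complex"
  assumes [measurable]: "f \<in> borel_measurable borel" and "c \<noteq> 0"
  shows "(LINT x|lborel. f x) = complex_of_real (\<bar>c\<bar> ^ DIM('a)) * (LINT x|lborel. f (t + c *\<^sub>R x))"
proof -
  have "(LINT x|lborel. f x) = (LINT x|density (distr lborel borel (\<lambda>x. t + c *\<^sub>R x)) (\<lambda>_. ennreal (\<bar>c\<bar> ^ DIM('a))). f x)"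
    using lborel_affine[OF \<open>c \<noteq> 0\<close>, of t] by simp
  also have "\<dots> = complex_of_real (\<bar>c\<bar> ^ DIM('a)) * (LINT x|distr lborel borel (\<lambda>x. t + c *\<^sub>R x). f x)"
    by (subst integral_density) (auto simp: scaleR_conv_of_real)
  also have "(LINT x|distr lborel borel (\<lambda>x. t + c *\<^sub>R x). f x) = (LINT x|lborel. f (t + c *\<^sub>R x))"
    by (subst integral_distr) auto
  finally show ?thesis .
qed

lemma lborel_integrable_affine:
  fixes f :: "'a::euclidean_space \<Rightarrow> complex"
  assumes f: "integrable lborel f" and "c \<noteq> 0"
  shows "integrable lborel (\<lambda>x. f (t + c *\<^sub>R x))"
proof -
  have [measurable]: "f \<in> borel_measurable borel" using borel_measurable_integrable[OF f] by simp
  have "integrable (density (distr lborel borel (\<lambda>x. t + c *\<^sub>R x)) (\<lambda>_. ennreal (\<bar>c\<bar> ^ DIM('a)))) f"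
    using lborel_affine[OF \<open>c \<noteq> 0\<close>, of t] f by simp
  then have "integrable (distr lborel borel (\<lambda>x. t + c *\<^sub>R x)) (\<lambda>x. (\<bar>c\<bar> ^ DIM('a)) *\<^sub>R f x)"
    by (subst (asm) integrable_density) auto
  then have "integrable lborel (\<lambda>x. (\<bar>c\<bar> ^ DIM('a)) *\<^sub>R f (t + c *\<^sub>R x))"
    by (subst (asm) integrable_distr_eq) auto
  from integrable_scaleR_right[OF this, of "inverse (\<bar>c\<bar> ^ DIM('a))"] show ?thesis
    using \<open>c \<noteq> 0\<close> by simp
qed

text \<open>
  Both sides are regularised by a Gaussian: Fubini's theorem turns the regularised inverse
  transform into a Gaussian average of \<open>f\<close> around \<open>x\<close>, and dominated convergence removes the
  regularisation on both sides.
\<close>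

theorem fourier_inversion:
  fixes f :: "'a::euclidean_space \<Rightarrow> complex"
  assumes cont: "continuous_on UNIV f" and bd: "\<And>x. norm (f x) \<le> B"
    and f: "integrable lborel f" and Ff: "integrable lborel (fourier f)"
  shows "(LINT \<omega>|lborel. cis (2 * pi * (x \<bullet> \<omega>)) * fourier f \<omega>) = f x"
proof -
  define \<gamma> where "\<gamma> u = complex_of_real (exp (- (norm u)\<^sup>2 / 2))" for u :: 'a
  define K where "K = complex_of_real (sqrt (2 * pi) ^ DIM('a))"
  have [measurable]: "\<gamma> \<in> borel_measurable borel" unfolding \<gamma>_def[abs_def]
    by (intro borel_measurable_continuous_onI continuous_intros) simp
  have [measurable]: "f \<in> borel_measurable borel" using cont by (rule borel_measurable_continuous_onI)
  have [measurable]: "fourier f \<in> borel_measurable borel" using Ff by (auto dest: borel_measurable_integrable)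
  have \<gamma>1: "norm (\<gamma> u) \<le> 1" for u by (simp add: \<gamma>_def)
  have int\<gamma>: "integrable lborel \<gamma>"
    using integrable_gaussian_cis_euclidean[of "0::'a"] unfolding \<gamma>_def[abs_def] by simp
  have \<gamma>cis: "(LINT u|lborel. cis (c \<bullet> u) * \<gamma> u) = K * \<gamma> c" for c
    using integral_gaussian_cis_euclidean[of c] by (simp add: \<gamma>_def K_def)
  have "sqrt (2 * pi) ^ DIM('a) * sqrt (2 * pi) ^ DIM('a) = (2 * pi) ^ DIM('a)"
    by (simp only: power_mult_distrib[symmetric] real_sqrt_mult_self) simp
  then have K: "K \<noteq> 0" "K * K = complex_of_real ((2 * pi) ^ DIM('a))"
    unfolding K_def of_real_mult[symmetric] by simp_all
  \<comment> \<open>The transform of \<open>\<gamma> ((2 * pi * \<delta>) *\<^sub>R \<omega>)\<close> is a multiple of \<open>\<gamma> (y /\<^sub>R \<delta>)\<close>; the normalising powers of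
    \<open>\<delta>\<close> cancel after rescaling, and \<open>K * K = (2 * pi) ^ DIM('a)\<close> accounts for the rest.\<close>
  have key: "K * (LINT \<omega>|lborel. cis (2 * pi * (x \<bullet> \<omega>)) * fourier f \<omega> * \<gamma> ((2 * pi * \<delta>) *\<^sub>R \<omega>))
    = (LINT u|lborel. f (x + \<delta> *\<^sub>R u) * \<gamma> u)" if "\<delta> > 0" for \<delta>
  proof -
    let ?n = "DIM('a)"
    have int\<delta>: "integrable lborel (\<lambda>\<omega>::'a. \<gamma> ((2 * pi * \<delta>) *\<^sub>R \<omega>))"
      using lborel_integrable_affine[OF int\<gamma>, of "2 * pi * \<delta>" 0] that by simp
    define J where "J y = (LINT \<omega>|lborel. cis (2 * pi * (y \<bullet> \<omega>)) * \<gamma> ((2 * pi * \<delta>) *\<^sub>R \<omega>))" for y :: 'a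
    have J: "(2 * pi * \<delta>) ^ ?n * J y = K * \<gamma> (y /\<^sub>R \<delta>)" for y
    proof -
      have "K * \<gamma> (y /\<^sub>R \<delta>) = (LINT u|lborel. cis ((y /\<^sub>R \<delta>) \<bullet> u) * \<gamma> u)"
        by (rule \<gamma>cis[symmetric])
      also have "\<dots> = (2 * pi * \<delta>) ^ ?n * (LINT \<omega>|lborel. cis ((y /\<^sub>R \<delta>) \<bullet> (0 + (2 * pi * \<delta>) *\<^sub>R \<omega>)) * \<gamma> (0 + (2 * pi * \<delta>) *\<^sub>R \<omega>))"
        using that by (subst lborel_integral_affine[of _ "2 * pi * \<delta>" 0]) auto
      also have "(LINT \<omega>|lborel. cis ((y /\<^sub>R \<delta>) \<bullet> (0 + (2 * pi * \<delta>) *\<^sub>R \<omega>)) * \<gamma> (0 + (2 * pi * \<delta>) *\<^sub>R \<omega>)) = J y"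
        unfolding J_def using that by (intro Bochner_Integration.integral_cong) (auto simp: field_simps)
      finally show ?thesis by simp
    qed
    have "(LINT \<omega>|lborel. cis (2 * pi * (x \<bullet> \<omega>)) * fourier f \<omega> * \<gamma> ((2 * pi * \<delta>) *\<^sub>R \<omega>))
       = (LINT \<omega>|lborel. LINT s|lborel. cis (2 * pi * ((x - s) \<bullet> \<omega>)) * \<gamma> ((2 * pi * \<delta>) *\<^sub>R \<omega>) * f s)"
    proof (rule Bochner_Integration.integral_cong[OF refl])
      fix \<omega> :: 'a
      have "cis (2 * pi * (x \<bullet> \<omega>)) * fourier f \<omega> * \<gamma> ((2 * pi * \<delta>) *\<^sub>R \<omega>)
        = (LINT s|lborel. (cis (2 * pi * (x \<bullet> \<omega>)) * \<gamma> ((2 * pi * \<delta>) *\<^sub>R \<omega>)) * (cis (- (2 * pi * (\<omega> \<bullet> s))) * f s))"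
        by (simp add: fourier_def)
      also have "\<dots> = (LINT s|lborel. cis (2 * pi * ((x - s) \<bullet> \<omega>)) * \<gamma> ((2 * pi * \<delta>) *\<^sub>R \<omega>) * f s)"
      proof (intro Bochner_Integration.integral_cong refl)
        fix s :: 'a
        have eq: "cis (2 * pi * (x \<bullet> \<omega>)) * cis (- (2 * pi * (\<omega> \<bullet> s))) = cis (2 * pi * ((x - s) \<bullet> \<omega>))"
          by (simp add: cis_mult inner_diff_left inner_commute[of \<omega>] right_diff_distrib)
        show "cis (2 * pi * (x \<bullet> \<omega>)) * \<gamma> ((2 * pi * \<delta>) *\<^sub>R \<omega>) * (cis (- (2 * pi * (\<omega> \<bullet> s))) * f s)
          = cis (2 * pi * ((x - s) \<bullet> \<omega>)) * \<gamma> ((2 * pi * \<delta>) *\<^sub>R \<omega>) * f s"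
          unfolding eq[symmetric] by (simp only: mult_ac)
      qed
      finally show "cis (2 * pi * (x \<bullet> \<omega>)) * fourier f \<omega> * \<gamma> ((2 * pi * \<delta>) *\<^sub>R \<omega>) = \<dots>" .
    qed
    also have "\<dots> = (LINT s|lborel. LINT \<omega>|lborel. cis (2 * pi * ((x - s) \<bullet> \<omega>)) * \<gamma> ((2 * pi * \<delta>) *\<^sub>R \<omega>) * f s)"
    proof (rule lborel_pair.Fubini_integral)
      have "integrable (lborel \<Otimes>\<^sub>M lborel) (\<lambda>(s, \<omega>). \<gamma> ((2 * pi * \<delta>) *\<^sub>R \<omega>) * f s)"
        by (rule lborel_pair.Fubini_integrable) (auto simp: norm_mult integrable_mult_left f int\<delta> integrable_norm)
      then show "integrable (lborel \<Otimes>\<^sub>M lborel) (\<lambda>(s, \<omega>). cis (2 * pi * ((x - s) \<bullet> \<omega>)) * \<gamma> ((2 * pi * \<delta>) *\<^sub>R \<omega>) * f s)"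
        by (rule Bochner_Integration.integrable_bound) (auto simp: norm_mult)
    qed
    also have "\<dots> = (LINT s|lborel. J (x - s) * f s)" by (simp add: J_def)
    finally have 1: "(2 * pi * \<delta>) ^ ?n * (LINT \<omega>|lborel. cis (2 * pi * (x \<bullet> \<omega>)) * fourier f \<omega> * \<gamma> ((2 * pi * \<delta>) *\<^sub>R \<omega>))
      = (LINT s|lborel. (2 * pi * \<delta>) ^ ?n * J (x - s) * f s)" by (simp add: mult.assoc)
    also have "\<dots> = K * (LINT s|lborel. \<gamma> ((x - s) /\<^sub>R \<delta>) * f s)"
      unfolding J unfolding mult.assoc by simp
    also have "(LINT s|lborel. \<gamma> ((x - s) /\<^sub>R \<delta>) * f s) = \<delta> ^ ?n * (LINT u|lborel. \<gamma> ((x - (x + \<delta> *\<^sub>R u)) /\<^sub>R \<delta>) * f (x + \<delta> *\<^sub>R u))"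
      using that by (subst lborel_integral_affine[of _ \<delta> x]) auto
    also have "(LINT u|lborel. \<gamma> ((x - (x + \<delta> *\<^sub>R u)) /\<^sub>R \<delta>) * f (x + \<delta> *\<^sub>R u)) = (LINT u|lborel. f (x + \<delta> *\<^sub>R u) * \<gamma> u)"
      using that by (intro Bochner_Integration.integral_cong) (auto simp: \<gamma>_def mult.commute)
    finally have "\<delta> ^ ?n * (K * (K * (LINT \<omega>|lborel. cis (2 * pi * (x \<bullet> \<omega>)) * fourier f \<omega> * \<gamma> ((2 * pi * \<delta>) *\<^sub>R \<omega>))))
       = \<delta> ^ ?n * (K * (LINT u|lborel. f (x + \<delta> *\<^sub>R u) * \<gamma> u))"
      using K(2) by (simp add: power_mult_distrib mult.assoc[symmetric])
    then show ?thesis using that K(1) by simp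
  qed
  define \<delta> where "\<delta> k = inverse (real (Suc k))" for k
  have \<delta>: "\<delta> k > 0" "\<delta> \<longlonglongrightarrow> 0" for k
    unfolding \<delta>_def using LIMSEQ_inverse_real_of_nat by auto
  have "(\<lambda>k. LINT \<omega>|lborel. cis (2 * pi * (x \<bullet> \<omega>)) * fourier f \<omega> * \<gamma> ((2 * pi * \<delta> k) *\<^sub>R \<omega>))
     \<longlonglongrightarrow> (LINT \<omega>|lborel. cis (2 * pi * (x \<bullet> \<omega>)) * fourier f \<omega>)"
  proof (rule integral_dominated_convergence[where w="\<lambda>\<omega>. norm (fourier f \<omega>)"])
    show "AE \<omega> in lborel. (\<lambda>k. cis (2 * pi * (x \<bullet> \<omega>)) * fourier f \<omega> * \<gamma> ((2 * pi * \<delta> k) *\<^sub>R \<omega>)) \<longlonglongrightarrow> cis (2 * pi * (x \<bullet> \<omega>)) * fourier f \<omega>"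
      unfolding \<gamma>_def by (intro AE_I2) (auto intro!: tendsto_eq_intros \<delta>(2))
    show "AE \<omega> in lborel. norm (cis (2 * pi * (x \<bullet> \<omega>)) * fourier f \<omega> * \<gamma> ((2 * pi * \<delta> k) *\<^sub>R \<omega>)) \<le> norm (fourier f \<omega>)" for k
      by (intro AE_I2) (simp add: norm_mult mult_left_le \<gamma>1)
  qed (auto intro: integrable_norm Ff)
  then have "(\<lambda>k. K * (LINT \<omega>|lborel. cis (2 * pi * (x \<bullet> \<omega>)) * fourier f \<omega> * \<gamma> ((2 * pi * \<delta> k) *\<^sub>R \<omega>)))
     \<longlonglongrightarrow> K * (LINT \<omega>|lborel. cis (2 * pi * (x \<bullet> \<omega>)) * fourier f \<omega>)"
    by (rule tendsto_mult_left)
  moreover have "(\<lambda>k. LINT u|lborel. f (x + \<delta> k *\<^sub>R u) * \<gamma> u) \<longlonglongrightarrow> (LINT u|lborel. f x * \<gamma> u)"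
  proof (rule integral_dominated_convergence[where w="\<lambda>u. B * norm (\<gamma> u)"])
    show "AE u in lborel. (\<lambda>k. f (x + \<delta> k *\<^sub>R u) * \<gamma> u) \<longlonglongrightarrow> f x * \<gamma> u"
    proof (intro AE_I2 tendsto_mult_right)
      fix u
      have "(\<lambda>k. x + \<delta> k *\<^sub>R u) \<longlonglongrightarrow> x" by (auto intro!: tendsto_eq_intros \<delta>(2))
      then show "(\<lambda>k. f (x + \<delta> k *\<^sub>R u)) \<longlonglongrightarrow> f x"
        using continuous_on_tendsto_compose[OF cont] by auto
    qed
    show "AE u in lborel. norm (f (x + \<delta> k *\<^sub>R u) * \<gamma> u) \<le> B * norm (\<gamma> u)" for k
      by (intro AE_I2) (simp add: norm_mult mult_right_mono bd)
  qed (auto intro: integrable_norm int\<gamma>)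
  ultimately have "K * (LINT \<omega>|lborel. cis (2 * pi * (x \<bullet> \<omega>)) * fourier f \<omega>) = (LINT u|lborel. f x * \<gamma> u)"
    using LIMSEQ_unique key[OF \<delta>(1)] by auto
  also have "\<dots> = K * f x" using \<gamma>cis[of 0] by (simp add: \<gamma>_def)
  finally show ?thesis using K(1) by simp
qed

definition inv_partial_fourier2 ::
    "('a::euclidean_space \<times> 'b::euclidean_space \<Rightarrow> complex) \<Rightarrow> 'a \<times> 'b \<Rightarrow> complex" where
  "inv_partial_fourier2 \<phi> = (\<lambda>z. partial_fourier2 \<phi> (fst z, - snd z))"

lemma inv_partial_fourier2_apply:
  "inv_partial_fourier2 \<phi> (x, \<omega>) = (LINT t|lborel. cis (2 * pi * (\<omega> \<bullet> t)) * \<phi> (x, t))"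
  by (simp add: inv_partial_fourier2_def partial_fourier2_apply)

lemma schwartz_continuous_inv_partial_fourier2:
  "schwartz_continuous (inv_partial_fourier2 :: ('a::euclidean_space \<times> 'b::euclidean_space \<Rightarrow> complex) \<Rightarrow> _)"
proof -
  have "linear (\<lambda>z::'a \<times> 'b. (fst z, - snd z))" by (intro linearI) auto
  moreover have "inj (\<lambda>z::'a \<times> 'b. (fst z, - snd z))" by (auto simp: inj_def)
  ultimately show ?thesis
    unfolding inv_partial_fourier2_def
    by (rule schwartz_continuous_comp[OF schwartz_continuous_linear schwartz_continuous_partial_fourier2])
qed

lemma fourier_section: "fourier (\<lambda>t. \<phi> (x, t)) \<omega> = partial_fourier2 \<phi> (x, \<omega>)"
  by (simp add: fourier_def partial_fourier2_apply)

text \<open>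
  Each section of \<open>\<phi>\<close> satisfies the hypotheses of the inversion theorem; its Fourier transform is integrable
  as a section of a Schwartz function.
\<close>

lemma inv_partial_fourier2_partial_fourier2:
  fixes \<phi> :: "'a::euclidean_space \<times> 'b::euclidean_space \<Rightarrow> complex"
  assumes \<phi>: "\<phi> \<in> schwartz_space"
  shows "inv_partial_fourier2 (partial_fourier2 \<phi>) = \<phi>"
proof
  fix z :: "'a \<times> 'b"
  obtain x t where z: "z = (x, t)" by (cases z)
  obtain B where B: "\<And>z. norm (\<phi> z) \<le> B"
    using schwartz_decay[OF \<phi>, of 0] by (metis mult_1 power_0)
  have "(LINT \<omega>|lborel. cis (2 * pi * (t \<bullet> \<omega>)) * fourier (\<lambda>t. \<phi> (x, t)) \<omega>) = \<phi> (x, t)"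
    by (rule fourier_inversion[OF _ B])
      (auto intro!: schwartz_continuous_on schwartz_integrable schwartz_section \<phi>
        schwartz_continuous_in[OF schwartz_continuous_partial_fourier2] simp: fourier_section[abs_def])
  then show "inv_partial_fourier2 (partial_fourier2 \<phi>) z = \<phi> z"
    by (simp add: z inv_partial_fourier2_apply fourier_section)
qed

lemma partial_fourier2_inv_partial_fourier2:
  fixes \<phi> :: "'a::euclidean_space \<times> 'b::euclidean_space \<Rightarrow> complex"
  assumes \<phi>: "\<phi> \<in> schwartz_space"
  shows "partial_fourier2 (inv_partial_fourier2 \<phi>) = \<phi>"
proof
  fix z :: "'a \<times> 'b"
  obtain x \<omega> where z: "z = (x, \<omega>)" by (cases z)
  have "partial_fourier2 (inv_partial_fourier2 \<phi>) (x, \<omega>)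
     = (LINT t|lborel. cis (- (2 * pi * (\<omega> \<bullet> t))) * partial_fourier2 \<phi> (x, - t))"
    unfolding partial_fourier2_apply[of "inv_partial_fourier2 \<phi>"] by (simp add: inv_partial_fourier2_def)
  also have "\<dots> = (LINT t|lborel. cis (2 * pi * (\<omega> \<bullet> t)) * partial_fourier2 \<phi> (x, t))"
    using schwartz_borel[OF schwartz_section[OF schwartz_continuous_in[OF schwartz_continuous_partial_fourier2 \<phi>]]]
    by (subst (2) lborel_integral_affine[of _ "-1" 0]) auto
  also have "\<dots> = inv_partial_fourier2 (partial_fourier2 \<phi>) (x, \<omega>)" by (simp add: inv_partial_fourier2_apply)
  finally show "partial_fourier2 (inv_partial_fourier2 \<phi>) z = \<phi> z"
    by (simp add: z inv_partial_fourier2_partial_fourier2[OF \<phi>])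
qed

section \<open>Tempered distributions and integrals of test functions\<close>

lemma schwartz_zero: "(\<lambda>x. 0) \<in> schwartz_space"
  by (rule schwartz_coinduct[where X="{\<lambda>x. 0}"]) (auto simp: dir_deriv_def)

lemma schwartz_sum:
  "finite I \<Longrightarrow> (\<And>i. i \<in> I \<Longrightarrow> \<phi> i \<in> schwartz_space) \<Longrightarrow> (\<lambda>x. \<Sum>i\<in>I. \<phi> i x) \<in> schwartz_space"
  by (induction rule: finite_induct) (auto intro: schwartz_add schwartz_zero)

lemma schwartz_diff:
  assumes "\<phi> \<in> schwartz_space" "\<psi> \<in> schwartz_space"
  shows "(\<lambda>x. \<phi> x - \<psi> x) \<in> schwartz_space"
  using schwartz_add[OF assms(1) schwartz_cmult[OF assms(2), of "-1"]] by simp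

lemma iter_deriv_diff:
  assumes "\<phi> \<in> schwartz_space" "\<psi> \<in> schwartz_space" "vs \<in> lists Basis"
  shows "iter_deriv vs (\<lambda>x. \<phi> x - \<psi> x) = (\<lambda>x. iter_deriv vs \<phi> x - iter_deriv vs \<psi> x)"
  using iter_deriv_add[OF assms(1) schwartz_cmult[OF assms(2), of "-1"] assms(3)]
    iter_deriv_cmult[OF assms(2,3), of "-1"] by simp

lemma iter_deriv_zero:
  assumes "vs \<in> lists Basis"
  shows "iter_deriv vs (\<lambda>x. 0) = (\<lambda>x. 0)"
  using iter_deriv_cmult[OF schwartz_zero assms, of 0] by simp

lemma iter_deriv_sum:
  assumes "finite I" "\<And>i. i \<in> I \<Longrightarrow> \<phi> i \<in> schwartz_space" "vs \<in> lists Basis"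
  shows "iter_deriv vs (\<lambda>x. \<Sum>i\<in>I. \<phi> i x) = (\<lambda>x. \<Sum>i\<in>I. iter_deriv vs (\<phi> i) x)"
  using assms(1,2)
  by (induction rule: finite_induct) (auto simp: iter_deriv_add[OF _ schwartz_sum assms(3)] iter_deriv_zero[OF assms(3)])

lemma schwartz_seminorm_le:
  assumes "\<And>vs x. vs \<in> lists Basis \<Longrightarrow> length vs \<le> N \<Longrightarrow> (1 + norm x) ^ N * norm (iter_deriv vs \<phi> x) \<le> e"
  shows "schwartz_seminorm N (\<phi> :: 'a::euclidean_space \<Rightarrow> complex) \<le> real (card {vs \<in> lists (Basis :: 'a set). length vs \<le> N}) * e"
  unfolding schwartz_seminorm_def
proof (rule order_trans[OF sum_mono])
  fix vs :: "'a list" assume "vs \<in> {vs \<in> lists Basis. length vs \<le> N}"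
  then show "(SUP x. (1 + norm x) ^ N * norm (iter_deriv vs \<phi> x)) \<le> e"
    by (intro cSUP_least) (use assms in auto)
qed simp

subsection \<open>Linearity and continuity of tempered distributions\<close>

lemma tempered_add:
  "u \<in> tempered_distributions \<Longrightarrow> \<phi> \<in> schwartz_space \<Longrightarrow> \<psi> \<in> schwartz_space \<Longrightarrow> u (\<lambda>x. \<phi> x + \<psi> x) = u \<phi> + u \<psi>"
  unfolding tempered_distributions_def by blast

lemma tempered_cmult:
  "u \<in> tempered_distributions \<Longrightarrow> \<phi> \<in> schwartz_space \<Longrightarrow> u (\<lambda>x. c * \<phi> x) = c * u \<phi>"
  unfolding tempered_distributions_def by blast

lemma tempered_diff:
  assumes "u \<in> tempered_distributions" "\<phi> \<in> schwartz_space" "\<psi> \<in> schwartz_space"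
  shows "u (\<lambda>x. \<phi> x - \<psi> x) = u \<phi> - u \<psi>"
  using tempered_add[OF assms(1,2) schwartz_cmult[OF assms(3), of "-1"]] tempered_cmult[OF assms(1,3), of "-1"] by simp

lemma tempered_sum:
  assumes "u \<in> tempered_distributions" "finite I" "\<And>i. i \<in> I \<Longrightarrow> \<phi> i \<in> schwartz_space"
  shows "u (\<lambda>x. \<Sum>i\<in>I. \<phi> i x) = (\<Sum>i\<in>I. u (\<phi> i))"
  using assms(2,3)
proof (induction rule: finite_induct)
  case empty
  then show ?case using tempered_cmult[OF assms(1) schwartz_zero, of 0] by simp
next
  case (insert i I)
  then show ?case using tempered_add[OF assms(1) insert(4)[of i] schwartz_sum[OF insert(1), of \<phi>]] by simp
qed

lemma tempered_bounded:
  assumes "u \<in> tempered_distributions"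
  shows "schwartz_bounded (\<lambda>\<phi> (_::unit). norm (u \<phi>))"
  using assms unfolding tempered_distributions_def schwartz_bounded_def by simp

text \<open>
  Linearity and the bound are checked on the test functions only, so \<open>v\<close> need not agree with \<open>u \<circ> T\<close>
  outside the Schwartz space.
\<close>

lemma tempered_comp:
  assumes u: "u \<in> tempered_distributions" and T: "schwartz_continuous T"
    and add: "\<And>\<phi> \<psi>. \<phi> \<in> schwartz_space \<Longrightarrow> \<psi> \<in> schwartz_space \<Longrightarrow> T (\<lambda>x. \<phi> x + \<psi> x) = (\<lambda>x. T \<phi> x + T \<psi> x)"
    and cmult: "\<And>c \<phi>. \<phi> \<in> schwartz_space \<Longrightarrow> T (\<lambda>x. c * \<phi> x) = (\<lambda>x. c * T \<phi> x)"
    and v: "\<And>\<phi>. \<phi> \<in> schwartz_space \<Longrightarrow> v \<phi> = u (T \<phi>)"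
  shows "v \<in> tempered_distributions"
proof -
  have "schwartz_bounded (\<lambda>\<phi> (_::unit). norm (v \<phi>))"
    by (rule schwartz_bounded_mono[OF schwartz_bounded_comp[OF T tempered_bounded[OF u]]]) (simp add: v)
  moreover have "v (\<lambda>x. \<phi> x + \<psi> x) = v \<phi> + v \<psi>" if "\<phi> \<in> schwartz_space" "\<psi> \<in> schwartz_space" for \<phi> \<psi>
    using that by (simp add: v schwartz_add add tempered_add[OF u] schwartz_continuous_in[OF T])
  moreover have "v (\<lambda>x. c * \<phi> x) = c * v \<phi>" if "\<phi> \<in> schwartz_space" for c \<phi>
    using that by (simp add: v schwartz_cmult cmult tempered_cmult[OF u] schwartz_continuous_in[OF T])
  ultimately show ?thesis
    unfolding tempered_distributions_def schwartz_bounded_def by (intro CollectI conjI ballI allI) simp_all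
qed

subsection \<open>Sections and marginals\<close>

lemma schwartz_section_fst:
  assumes "K \<in> schwartz_space"
  shows "(\<lambda>x. K (x, w)) \<in> schwartz_space"
proof -
  have "linear (\<lambda>x::'a. (x, 0::'b))" by (intro linearI) auto
  from schwartz_affine[OF assms this, of "(0, w)"] show ?thesis by (simp add: inj_def)
qed

abbreviation fst_directions :: "'a list \<Rightarrow> ('a \<times> 'b::zero) list" where
  "fst_directions vs \<equiv> map (\<lambda>v. (v, 0)) vs"

lemma fst_directions_in_lists:
  "vs \<in> lists Basis \<Longrightarrow> fst_directions vs \<in> lists (Basis :: ('a::euclidean_space \<times> 'b::euclidean_space) set)"
  by (induction vs) (auto simp: Basis_prod_def)

lemma iter_deriv_section_fst:
  assumes "K \<in> schwartz_space" "vs \<in> lists Basis"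
  shows "iter_deriv vs (\<lambda>x. K (x, w)) = (\<lambda>x. iter_deriv (fst_directions vs) K (x, w))"
  using assms(2)
proof (induction vs)
  case (Cons v vs)
  let ?K = "iter_deriv (fst_directions vs) K"
  have K: "?K \<in> schwartz_space" using Cons assms(1) by (intro iter_deriv_in_schwartz fst_directions_in_lists) auto
  have "((\<lambda>x. ?K (x, w)) has_derivative (\<lambda>v. dir_deriv (v, 0) ?K (x, w))) (at x)" for x
    by (rule has_derivative_compose[where g="?K" and f="\<lambda>x. (x, w)", OF _ schwartz_has_derivative[OF K]])
      (auto intro!: derivative_eq_intros)
  then have "dir_deriv v (\<lambda>x. ?K (x, w)) = (\<lambda>x. dir_deriv (v, 0) ?K (x, w))" by (rule dir_deriv_eqI)
  then show ?case using Cons by (simp add: iter_deriv_Cons del: iter_deriv.simps(2))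
qed simp

text \<open>
  Marginals are partial Fourier transforms at frequency zero.  Their regularity and the rule for
  differentiating them are thus instances of what is known for the partial Fourier transform.
\<close>

lemma marginal_eq_partial_fourier2: "(LINT w|lborel. K (x, w)) = partial_fourier2 K (x, 0)"
  by (simp add: partial_fourier2_apply)

lemma schwartz_marginal: "K \<in> schwartz_space \<Longrightarrow> (\<lambda>x. LINT w|lborel. K (x, w)) \<in> schwartz_space"
  unfolding marginal_eq_partial_fourier2
  by (intro schwartz_section_fst schwartz_continuous_in[OF schwartz_continuous_partial_fourier2])

lemma iter_deriv_marginal:
  fixes K :: "'a::euclidean_space \<times> 'b::euclidean_space \<Rightarrow> complex"
  assumes "K \<in> schwartz_space" "vs \<in> lists Basis"
  shows "iter_deriv vs (\<lambda>x. LINT w|lborel. K (x, w)) = (\<lambda>x. LINT w|lborel. iter_deriv (fst_directions vs) K (x, w))"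
  using assms(2)
proof (induction vs)
  case (Cons v vs)
  let ?K = "iter_deriv (fst_directions vs) K"
  have K: "?K \<in> schwartz_space" using Cons assms(1) by (intro iter_deriv_in_schwartz fst_directions_in_lists) auto
  let ?F = "partial_fourier2 ?K"
  have F: "?F \<in> schwartz_space" by (rule schwartz_continuous_in[OF schwartz_continuous_partial_fourier2 K])
  have "((\<lambda>x. ?F (x, 0)) has_derivative (\<lambda>v. dir_deriv (v, 0) ?F (x, 0))) (at x)" for x
    by (rule has_derivative_compose[where g="?F" and f="\<lambda>x. (x, 0)", OF _ schwartz_has_derivative[OF F]])
      (auto intro!: derivative_eq_intros)
  then have "dir_deriv v (\<lambda>x. ?F (x, 0)) = (\<lambda>x. dir_deriv (v, 0) ?F (x, 0))" by (rule dir_deriv_eqI)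
  also have "\<dots> = (\<lambda>x. partial_fourier2 (dir_deriv (v, 0) ?K) (x, 0))"
    unfolding dir_deriv_partial_fourier2[OF K] by (simp add: pf2_derivative_def zero_prod_def[symmetric])
  finally show ?case using Cons
    by (simp add: iter_deriv_Cons marginal_eq_partial_fourier2 del: iter_deriv.simps(2))
qed simp

subsection \<open>Uniform Riemann sums\<close>

text \<open>
  One tagged division serves all functions that share a Lipschitz constant and an integrable
  majorant.  This uniformity is what lets Riemann sums of a family of test functions converge
  simultaneously in every derivative, that is, in the topology of the Schwartz space.
\<close>

lemma uniform_riemann_sum:
  fixes g :: "'a::euclidean_space \<Rightarrow> real"
  assumes g: "integrable lborel g" and e: "e > 0" and M: "M > 0"
  obtains p :: "('a \<times> 'a set) set" where "finite p"
    "\<And>f :: 'a \<Rightarrow> complex. (\<And>v w. norm (f v - f w) \<le> M * norm (v - w)) \<Longrightarrow> (\<And>w. norm (f w) \<le> g w) \<Longrightarrow>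
      norm ((\<Sum>(t, k)\<in>p. measure lborel k *\<^sub>R f t) - (LINT w|lborel. f w)) \<le> e"
proof -
  define Q where "Q n = cbox (- real n *\<^sub>R One) (real n *\<^sub>R (One :: 'a))" for n
  have "(\<lambda>n. LINT w|lborel. indicator (- Q n) w *\<^sub>R g w) \<longlonglongrightarrow> integral\<^sup>L lborel (\<lambda>w :: 'a. 0)"
  proof (rule integral_dominated_convergence[where w="\<lambda>w. norm (g w)"])
    show "AE w in lborel. (\<lambda>n. indicator (- Q n) w *\<^sub>R g w) \<longlonglongrightarrow> 0"
    proof (rule AE_I2, rule tendsto_eventually)
      fix w :: 'a
      have "indicator (- Q n) w *\<^sub>R g w = 0" if "n \<ge> nat \<lceil>norm w\<rceil>" for n
      proof -
        have "norm w \<le> real n" using that by linarith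
        then have "- real n \<le> w \<bullet> b \<and> w \<bullet> b \<le> real n" if "b \<in> Basis" for b
          using Basis_le_norm[OF that, of w] by linarith
        then have "w \<in> Q n" unfolding Q_def mem_box by simp
        then show ?thesis by simp
      qed
      then show "\<forall>\<^sub>F n in sequentially. indicator (- Q n) w *\<^sub>R g w = 0"
        unfolding eventually_sequentially by blast
    qed
    show "(\<lambda>w. indicator (- Q n) w *\<^sub>R g w) \<in> borel_measurable lborel" for n
      using borel_measurable_integrable[OF g] by (simp add: Q_def)
  qed (use g in \<open>auto simp: indicator_def\<close>)
  then have "(\<lambda>n. LINT w|lborel. indicator (- Q n) w *\<^sub>R g w) \<longlonglongrightarrow> 0" by simp
  from tendstoD[OF this half_gt_zero[OF e]]
  obtain n where n: "\<bar>LINT w|lborel. indicator (- Q n) w *\<^sub>R g w\<bar> < e / 2"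
    unfolding eventually_sequentially dist_real_def diff_zero by blast
  define V where "V = measure lborel (Q n)"
  have V: "V \<ge> 0" unfolding V_def by (rule measure_nonneg)
  \<comment> \<open>The mesh: on a box of volume \<open>V\<close>, a Lipschitz constant \<open>M\<close> costs at most \<open>M * \<delta> * V\<close>, half the tolerance.\<close>
  define \<delta> where "\<delta> = e / (2 * (V + 1)) / M"
  have "M * \<delta> = e / (2 * (V + 1))" using M by (simp add: \<delta>_def)
  moreover have "e / (2 * (V + 1)) * V \<le> e / 2" using e V by (simp add: field_simps)
  moreover have "e / (2 * (V + 1)) > 0" using e V by simp
  ultimately have \<delta>: "\<delta> > 0" "M * \<delta> * V \<le> e / 2"
    using M unfolding \<delta>_def by (simp_all only: divide_pos_pos)
  obtain p where p: "p tagged_division_of Q n" "(\<lambda>x. ball x \<delta>) fine p"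
    using fine_division_exists[OF gauge_ball[OF \<delta>(1)]] unfolding Q_def by metis
  have "norm ((\<Sum>(t, k)\<in>p. measure lborel k *\<^sub>R f t) - (LINT w|lborel. f w)) \<le> e"
    if lip: "\<And>v w. norm (f v - f w) \<le> M * norm (v - w)" and maj: "\<And>w. norm (f w) \<le> g w" for f :: "'a \<Rightarrow> complex"
  proof -
    have cont: "continuous_on A f" for A
      by (rule lipschitz_on_continuous_on[of M]) (use M in \<open>auto intro!: lipschitz_onI simp: dist_norm lip\<close>)
    have f: "integrable lborel f"
    proof (rule Bochner_Integration.integrable_bound[OF g])
      show "f \<in> borel_measurable lborel" using borel_measurable_continuous_onI[OF cont] by simp
      show "AE w in lborel. norm (f w) \<le> norm (g w)"
        by (intro AE_I2 order_trans[OF maj]) simp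
    qed
    have Q: "Q n \<in> sets lborel" by (simp add: Q_def)
    have si: "set_integrable lborel (Q n) f"
      unfolding set_integrable_def by (rule integrable_mult_indicator[OF Q f])
    have "(LINT w|lborel. f w) = (LINT w|lborel. indicator (Q n) w *\<^sub>R f w + indicator (- Q n) w *\<^sub>R f w)"
      by (intro Bochner_Integration.integral_cong) (auto simp: indicator_def)
    also have "\<dots> = (LINT w|lborel. indicator (Q n) w *\<^sub>R f w) + (LINT w|lborel. indicator (- Q n) w *\<^sub>R f w)"
      using f Q by (intro Bochner_Integration.integral_add integrable_mult_indicator) auto
    also have "(LINT w|lborel. indicator (Q n) w *\<^sub>R f w) = integral (Q n) f"
      using set_borel_integral_eq_integral(2)[OF si] by (simp add: set_lebesgue_integral_def)
    finally have split: "(LINT w|lborel. f w) = integral (Q n) f + (LINT w|lborel. indicator (- Q n) w *\<^sub>R f w)" .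
    have "norm (LINT w|lborel. indicator (- Q n) w *\<^sub>R f w) \<le> (LINT w|lborel. norm (indicator (- Q n) w *\<^sub>R f w))"
      by (rule integral_norm_bound)
    also have "\<dots> \<le> (LINT w|lborel. indicator (- Q n) w *\<^sub>R g w)"
      using f g Q maj by (intro integral_mono integrable_norm integrable_mult_indicator) (auto simp: indicator_def)
    also have "\<dots> < e / 2" using n by linarith
    finally have tail: "norm (LINT w|lborel. indicator (- Q n) w *\<^sub>R f w) < e / 2" .
    have int: "f integrable_on cbox a b" for a b by (rule integrable_continuous[OF cont])
    have "norm ((\<Sum>(t, k)\<in>p. measure lborel k *\<^sub>R f t) - integral (Q n) f) = norm (\<Sum>(t, k)\<in>p. measure lborel k *\<^sub>R f t - integral k f)"
      using integral_combine_tagged_division_topdown[OF int p(1)[unfolded Q_def]]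
      by (simp add: sum_subtractf case_prod_unfold Q_def)
    also have "\<dots> \<le> (\<Sum>(t, k)\<in>p. M * \<delta> * measure lborel k)"
      unfolding case_prod_unfold
    proof (rule order_trans[OF norm_sum sum_mono])
      fix tk assume tk: "tk \<in> p"
      obtain t k where [simp]: "tk = (t, k)" by (cases tk)
      obtain a b where k: "k = cbox a b" using tagged_division_ofD(4)[OF p(1), of t k] tk by auto
      have kt: "k \<subseteq> ball t \<delta>" using fineD[OF p(2)] tk by auto
      have "norm (f t - f w) \<le> M * \<delta>" if "w \<in> cbox a b" for w
      proof -
        have "norm (t - w) < \<delta>" using kt that k by (auto simp: dist_norm)
        then show ?thesis using lip[of t w] mult_left_mono[of "norm (t - w)" \<delta> M] M by linarith
      qed
      moreover have "((\<lambda>w. f t - f w) has_integral (measure lborel k *\<^sub>R f t - integral k f)) (cbox a b)"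
        unfolding k by (intro has_integral_diff has_integral_const integrable_integral int)
      ultimately show "norm (measure lborel (snd tk) *\<^sub>R f (fst tk) - integral (snd tk) f) \<le> M * \<delta> * measure lborel (snd tk)"
        using has_integral_bound[of "M * \<delta>" "\<lambda>w. f t - f w" _ a b] \<delta>(1) M by (simp add: k)
    qed
    also have "\<dots> = M * \<delta> * V"
      using additive_content_tagged_division[OF p(1)[unfolded Q_def]]
      by (simp add: sum_distrib_left[symmetric] case_prod_unfold V_def Q_def)
    also note \<delta>(2)
    finally have "norm ((\<Sum>(t, k)\<in>p. measure lborel k *\<^sub>R f t) - integral (Q n) f) \<le> e / 2" .
    then show ?thesis
      unfolding split diff_diff_eq[symmetric]
      using tail norm_triangle_ineq4[of "(\<Sum>(t, k)\<in>p. measure lborel k *\<^sub>R f t) - integral (Q n) f" "LINT w|lborel. indicator (- Q n) w *\<^sub>R f w"]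
      by linarith
  qed
  then show ?thesis by (rule that[OF tagged_division_of_finite[OF p(1)]])
qed

text \<open>
  These two bounds, applied to all derivatives of \<open>\<Phi>\<close>, say that the section at \<open>w\<close> is an integrable and Lipschitz
  continuous function of \<open>w\<close> with values in the Schwartz space.
\<close>

lemma schwartz_section_estimates:
  fixes \<Phi> :: "'a::euclidean_space \<times> 'b::euclidean_space \<Rightarrow> complex"
  assumes \<Phi>: "\<Phi> \<in> schwartz_space"
  obtains C where "C \<ge> 0"
    "\<And>x w. (1 + norm x) ^ N * norm (\<Phi> (x, w)) \<le> C * inverse ((1 + norm w) ^ (2 * DIM('b)))"
    "\<And>x v w. (1 + norm x) ^ N * norm (\<Phi> (x, v) - \<Phi> (x, w)) \<le> C * norm (v - w)"
proof -
  let ?m = "2 * DIM('b)"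
  obtain A where A: "A \<ge> 0" "\<And>z. (1 + norm z) ^ (N + ?m) * norm (\<Phi> z) \<le> A"
    using schwartz_decay[OF \<Phi>] by metis
  obtain B where B: "B \<ge> 0" "\<And>z v. (1 + norm z) ^ N * norm (dir_deriv v \<Phi> z) \<le> B * norm v"
    using schwartz_dir_deriv_decay[OF \<Phi>] by metis
  show ?thesis
  proof (rule that[of "A + B"])
    fix x :: 'a and v w :: 'b
    have "((1 + norm x) ^ N * (1 + norm w) ^ ?m) * norm (\<Phi> (x, w)) \<le> ((1 + norm (x, w)) ^ (N + ?m)) * norm (\<Phi> (x, w))"
      by (intro mult_right_mono power_norms_le_pair) auto
    also have "\<dots> \<le> A + B" using A(2)[of "(x, w)"] B(1) by linarith
    finally show "(1 + norm x) ^ N * norm (\<Phi> (x, w)) \<le> (A + B) * inverse ((1 + norm w) ^ ?m)"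
      by (simp add: field_simps add_pos_nonneg)
    have pos: "(1 + norm x) ^ N > 0" by (simp add: add_pos_nonneg)
    have "norm (\<Phi> (x, v) - \<Phi> (x, w)) \<le> B / (1 + norm x) ^ N * norm (v - w)"
    proof (rule differentiable_bound[OF convex_UNIV])
      fix y :: 'b
      show "((\<lambda>y. \<Phi> (x, y)) has_derivative (\<lambda>v. dir_deriv (0, v) \<Phi> (x, y))) (at y within UNIV)"
        by (rule has_derivative_compose[where g=\<Phi> and f="\<lambda>y. (x, y)", OF _ schwartz_has_derivative[OF \<Phi>]])
          (auto intro!: derivative_eq_intros)
      show "onorm (\<lambda>v. dir_deriv (0, v) \<Phi> (x, y)) \<le> B / (1 + norm x) ^ N"
      proof (rule onorm_le)
        fix v :: 'b
        have "(1 + norm x) ^ N * norm (dir_deriv (0, v) \<Phi> (x, y)) \<le> (1 + norm (x, y)) ^ N * norm (dir_deriv (0, v) \<Phi> (x, y))"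
          using norm_fst_le[of x y] by (intro mult_right_mono power_mono) auto
        also have "\<dots> \<le> B * norm v" using B(2)[of "(x, y)" "(0, v)"] by (simp add: norm_Pair)
        finally show "norm (dir_deriv (0, v) \<Phi> (x, y)) \<le> B / (1 + norm x) ^ N * norm v"
          using pos by (simp add: field_simps)
      qed
    qed auto
    then have "(1 + norm x) ^ N * norm (\<Phi> (x, v) - \<Phi> (x, w)) \<le> B * norm (v - w)"
      using pos by (simp add: field_simps)
    also have "\<dots> \<le> (A + B) * norm (v - w)" using A(1) by (intro mult_right_mono) auto
    finally show "(1 + norm x) ^ N * norm (\<Phi> (x, v) - \<Phi> (x, w)) \<le> (A + B) * norm (v - w)" .
  qed (use A B in auto)
qed

text \<open>
  \<open>u\<close> is bounded by one seminorm, which involves finitely many weighted derivatives.  In these the sections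
  of \<open>K\<close> are Lipschitz continuous and decay, so a single Riemann sum approximates both the integral of \<open>u\<close> over
  the sections and, in that seminorm, the marginal of \<open>K\<close>.
\<close>

theorem
  fixes K :: "'a::euclidean_space \<times> 'b::euclidean_space \<Rightarrow> complex"
  assumes u: "u \<in> tempered_distributions" and K: "K \<in> schwartz_space"
  shows tempered_section_continuous: "continuous_on UNIV (\<lambda>w. u (\<lambda>x. K (x, w)))"
    and tempered_section_integrable: "integrable lborel (\<lambda>w. u (\<lambda>x. K (x, w)))"
    and tempered_integral: "u (\<lambda>x. LINT w|lborel. K (x, w)) = (LINT w|lborel. u (\<lambda>x. K (x, w)))"
proof -
  define g where "g w = inverse ((1 + norm w) ^ (2 * DIM('b)))" for w :: 'b
  have g: "integrable lborel g" unfolding g_def[abs_def] by (rule integrable_polynomial_decay)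
  have g0: "g w \<ge> 0" for w by (simp add: g_def)
  define h where "h w = u (\<lambda>x. K (x, w))" for w
  obtain A N where A: "A \<ge> 0" "\<And>\<phi>. \<phi> \<in> schwartz_space \<Longrightarrow> norm (u \<phi>) \<le> A * schwartz_seminorm N \<phi>"
    using schwartz_boundedE[OF tempered_bounded[OF u]] by metis
  define V where "V = {vs \<in> lists (Basis :: 'a set). length vs \<le> N}"
  have V: "finite V" unfolding V_def by (rule finite_derivative_lists)
  define \<Phi> where "\<Phi> vs = iter_deriv (fst_directions vs) K" for vs
  have \<Phi>: "\<Phi> vs \<in> schwartz_space" if "vs \<in> V" for vs
    using that K unfolding \<Phi>_def V_def by (intro iter_deriv_in_schwartz fst_directions_in_lists) auto
  have "\<forall>vs\<in>V. \<exists>C. C \<ge> 0 \<and> (\<forall>x w. (1 + norm x) ^ N * norm (\<Phi> vs (x, w)) \<le> C * g w) \<and>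
      (\<forall>x v w. (1 + norm x) ^ N * norm (\<Phi> vs (x, v) - \<Phi> vs (x, w)) \<le> C * norm (v - w))"
    unfolding g_def using schwartz_section_estimates[OF \<Phi>, of _ N] by metis
  then obtain C where C: "\<And>vs. vs \<in> V \<Longrightarrow> C vs \<ge> 0"
    "\<And>vs x w. vs \<in> V \<Longrightarrow> (1 + norm x) ^ N * norm (\<Phi> vs (x, w)) \<le> C vs * g w"
    "\<And>vs x v w. vs \<in> V \<Longrightarrow> (1 + norm x) ^ N * norm (\<Phi> vs (x, v) - \<Phi> vs (x, w)) \<le> C vs * norm (v - w)"
    by metis
  define D where "D = sum C V"
  have CD: "C vs \<le> D" if "vs \<in> V" for vs
    unfolding D_def using that V C(1) by (intro member_le_sum) auto
  have D0: "D \<ge> 0" unfolding D_def using C(1) by (intro sum_nonneg) auto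
  have dec: "(1 + norm x) ^ N * norm (\<Phi> vs (x, w)) \<le> D * g w" if "vs \<in> V" for vs x w
    using C(2)[OF that, of x w] mult_right_mono[OF CD[OF that] g0[of w]] by linarith
  have lip: "(1 + norm x) ^ N * norm (\<Phi> vs (x, v) - \<Phi> vs (x, w)) \<le> D * norm (v - w)" if "vs \<in> V" for vs x v w
    using C(3)[OF that, of x v w] mult_right_mono[OF CD[OF that] norm_ge_zero[of "v - w"]] by linarith
  define c where "c = real (card V)"
  have c: "c \<ge> 0" by (simp add: c_def)
  have Ks: "(\<lambda>x. K (x, w)) \<in> schwartz_space" for w by (rule schwartz_section_fst[OF K])
  have idK: "iter_deriv vs (\<lambda>x. K (x, w)) = (\<lambda>x. \<Phi> vs (x, w))" if "vs \<in> V" for vs w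
    using that iter_deriv_section_fst[OF K, of vs w] by (simp add: \<Phi>_def V_def)
  have u_le: "norm (u \<phi>) \<le> A * (c * e)"
    if "\<phi> \<in> schwartz_space" "\<And>vs x. vs \<in> V \<Longrightarrow> (1 + norm x) ^ N * norm (iter_deriv vs \<phi> x) \<le> e" for \<phi> e
  proof -
    have "schwartz_seminorm N \<phi> \<le> c * e"
      unfolding c_def V_def by (rule schwartz_seminorm_le) (use that(2) in \<open>auto simp: V_def\<close>)
    then show ?thesis using A(2)[OF that(1)] mult_left_mono[OF _ A(1)] by force
  qed
  \<comment> \<open>A common Lipschitz and decay constant for \<open>h\<close> and for all weighted derivatives of the sections; the
    summand one only makes it positive.\<close>
  define M where "M = A * (c * D) + D + 1"
  have "A * (c * D) \<ge> 0" using A(1) c D0 by simp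
  then have M: "M > 0" "A * (c * D) \<le> M" "D \<le> M" unfolding M_def using D0 by linarith+
  have h_lip: "norm (h v - h w) \<le> M * norm (v - w)" for v w
  proof -
    have "norm (h v - h w) = norm (u (\<lambda>x. K (x, v) - K (x, w)))"
      by (simp add: h_def tempered_diff[OF u Ks Ks])
    also have "\<dots> \<le> A * (c * (D * norm (v - w)))"
      using K by (intro u_le schwartz_diff Ks) (auto simp: iter_deriv_diff[OF Ks Ks] V_def idK[unfolded V_def] lip[unfolded V_def])
    also have "\<dots> \<le> M * norm (v - w)" using mult_right_mono[OF M(2) norm_ge_zero[of "v - w"]] by (simp add: mult.assoc)
    finally show ?thesis .
  qed
  have h_dec: "norm (h w) \<le> M * g w" for w
  proof -
    have "norm (h w) \<le> A * (c * (D * g w))"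
      unfolding h_def by (intro u_le Ks) (simp add: idK dec)
    also have "\<dots> \<le> M * g w" using mult_right_mono[OF M(2) g0[of w]] by (simp add: mult.assoc)
    finally show ?thesis .
  qed
  show cont: "continuous_on UNIV (\<lambda>w. u (\<lambda>x. K (x, w)))"
    unfolding h_def[symmetric]
  proof (rule lipschitz_on_continuous_on)
    show "M-lipschitz_on UNIV h" using h_lip M(1) by (intro lipschitz_onI) (simp_all add: dist_norm)
  qed
  show "integrable lborel (\<lambda>w. u (\<lambda>x. K (x, w)))"
  proof (rule Bochner_Integration.integrable_bound[OF integrable_mult_right[OF g, of M]])
    show "(\<lambda>w. u (\<lambda>x. K (x, w))) \<in> borel_measurable lborel"
      using borel_measurable_continuous_onI[OF cont] by simp
    show "AE w in lborel. norm (u (\<lambda>x. K (x, w))) \<le> norm (M * g w)"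
      using h_dec M(1) g0 by (intro AE_I2) (simp add: h_def)
  qed
  define \<psi> where "\<psi> x = (LINT w|lborel. K (x, w))" for x
  have \<psi>: "\<psi> \<in> schwartz_space" unfolding \<psi>_def[abs_def] by (rule schwartz_marginal[OF K])
  have id\<psi>: "iter_deriv vs \<psi> = (\<lambda>x. LINT w|lborel. \<Phi> vs (x, w))" if "vs \<in> V" for vs
    using that iter_deriv_marginal[OF K, of vs] by (simp add: \<Phi>_def V_def \<psi>_def[abs_def])
  have "norm (u \<psi> - (LINT w|lborel. h w)) \<le> (A * c + 1) * e" if "e > 0" for e
  proof -
    obtain p :: "('b \<times> 'b set) set" where p: "finite p"
      "\<And>f :: 'b \<Rightarrow> complex. (\<And>v w. norm (f v - f w) \<le> M * norm (v - w)) \<Longrightarrow> (\<And>w. norm (f w) \<le> M * g w) \<Longrightarrow>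
      norm ((\<Sum>(t, k)\<in>p. measure lborel k *\<^sub>R f t) - (LINT w|lborel. f w)) \<le> e"
      using uniform_riemann_sum[OF integrable_mult_right[OF g, of M] \<open>e > 0\<close> M(1)] by blast
    define S where "S x = (\<Sum>tk\<in>p. complex_of_real (measure lborel (snd tk)) * K (x, fst tk))" for x
    have S_terms: "(\<lambda>x. complex_of_real (measure lborel (snd tk)) * K (x, fst tk)) \<in> schwartz_space" for tk :: "'b \<times> 'b set"
      by (rule schwartz_cmult[OF Ks])
    have S: "S \<in> schwartz_space" unfolding S_def[abs_def] by (rule schwartz_sum[OF p(1) S_terms])
    have idS: "iter_deriv vs S = (\<lambda>x. \<Sum>(t, k)\<in>p. measure lborel k *\<^sub>R \<Phi> vs (x, t))" if "vs \<in> V" for vs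
    proof -
      have vs: "vs \<in> lists Basis" using that by (simp add: V_def)
      show ?thesis
        unfolding S_def[abs_def] iter_deriv_sum[OF p(1) S_terms vs] iter_deriv_cmult[OF Ks vs] idK[OF that]
        by (simp add: case_prod_unfold scaleR_conv_of_real)
    qed
    have uS: "u S = (\<Sum>(t, k)\<in>p. measure lborel k *\<^sub>R h t)"
      unfolding S_def[abs_def] tempered_sum[OF u p(1) S_terms] tempered_cmult[OF u Ks]
      by (simp add: h_def case_prod_unfold scaleR_conv_of_real)
    have 1: "norm (u S - (LINT w|lborel. h w)) \<le> e"
      unfolding uS by (rule p(2)[OF h_lip h_dec])
    have "norm (u (\<lambda>x. S x - \<psi> x)) \<le> A * (c * e)"
    proof (rule u_le[OF schwartz_diff[OF S \<psi>]])
      fix vs x assume vs: "vs \<in> V"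
      then have vs': "vs \<in> lists Basis" by (simp add: V_def)
      let ?f = "\<lambda>w. (1 + norm x) ^ N *\<^sub>R \<Phi> vs (x, w)"
      have "norm ((\<Sum>(t, k)\<in>p. measure lborel k *\<^sub>R ?f t) - (LINT w|lborel. ?f w)) \<le> e"
      proof (rule p(2))
        show "norm (?f v - ?f w) \<le> M * norm (v - w)" for v w
          unfolding scaleR_diff_right[symmetric]
          using lip[OF vs, of x v w] mult_right_mono[OF M(3) norm_ge_zero[of "v - w"]] by simp
        show "norm (?f w) \<le> M * g w" for w
          using dec[OF vs, of x w] mult_right_mono[OF M(3) g0[of w]] by simp
      qed
      also have "(\<Sum>(t, k)\<in>p. measure lborel k *\<^sub>R ?f t) - (LINT w|lborel. ?f w) = (1 + norm x) ^ N *\<^sub>R iter_deriv vs (\<lambda>x. S x - \<psi> x) x"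
        unfolding iter_deriv_diff[OF S \<psi> vs'] idS[OF vs] id\<psi>[OF vs]
        by (simp add: scaleR_diff_right scaleR_sum_right case_prod_unfold mult.commute)
      finally show "(1 + norm x) ^ N * norm (iter_deriv vs (\<lambda>x. S x - \<psi> x) x) \<le> e" by simp
    qed
    then have "norm (u S - u \<psi>) \<le> A * c * e"
      by (simp add: tempered_diff[OF u S \<psi>] mult.assoc)
    then show ?thesis
      using 1 norm_triangle_ineq4[of "u S - (LINT w|lborel. h w)" "u S - u \<psi>"] by (simp add: distrib_right)
  qed
  note est = this
  have k: "A * c + 1 > 0" using A(1) c by (simp add: add_nonneg_pos)
  have "norm (u \<psi> - (LINT w|lborel. h w)) \<le> 0"
  proof (rule field_le_epsilon)
    fix e :: real assume "e > 0"
    then have "e / (A * c + 1) > 0" using k by simp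
    from est[OF this] show "norm (u \<psi> - (LINT w|lborel. h w)) \<le> 0 + e" using k by simp
  qed
  then show "u (\<lambda>x. LINT w|lborel. K (x, w)) = (LINT w|lborel. u (\<lambda>x. K (x, w)))"
    by (simp add: \<psi>_def[abs_def] h_def)
qed

section \<open>Change of window\<close>

text \<open>
  The modulation by \<open>- \<zeta>\<close> of the translation by \<open>z\<close>.  With this sign, the short-time Fourier transform is the
  value of the distribution at an atom, without a conjugate.
\<close>

definition tf_atom :: "'a::euclidean_space \<Rightarrow> 'a \<Rightarrow> ('a \<Rightarrow> complex) \<Rightarrow> 'a \<Rightarrow> complex" where
  "tf_atom z \<zeta> g = (\<lambda>t. cis (- (2 * pi * (t \<bullet> \<zeta>))) * g (t - z))"

lemma stft_eq_tf_atom: "stft G u z \<zeta> = u (tf_atom z \<zeta> (\<lambda>t. cnj (G t)))"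
  by (simp add: stft_def distr_inner_def frequency_shift_def translation_def tf_atom_def cis_cnj)

lemma tf_atom_tf_atom:
  "tf_atom z \<zeta> (tf_atom z' \<zeta>' g) = (\<lambda>t. cis (2 * pi * (z \<bullet> \<zeta>')) * tf_atom (z + z') (\<zeta> + \<zeta>') g t)"
proof
  fix t
  have "cis (- (2 * pi * (t \<bullet> \<zeta>))) * cis (- (2 * pi * ((t - z) \<bullet> \<zeta>'))) = cis (2 * pi * (z \<bullet> \<zeta>')) * cis (- (2 * pi * (t \<bullet> (\<zeta> + \<zeta>'))))"
    by (simp add: cis_mult inner_diff_left inner_add_right algebra_simps)
  then show "tf_atom z \<zeta> (tf_atom z' \<zeta>' g) t = cis (2 * pi * (z \<bullet> \<zeta>')) * tf_atom (z + z') (\<zeta> + \<zeta>') g t"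
    unfolding tf_atom_def by (simp add: mult.assoc[symmetric] diff_diff_eq)
qed

lemma schwartz_translate: "g \<in> schwartz_space \<Longrightarrow> (\<lambda>t. g (t + c)) \<in> schwartz_space"
  using schwartz_affine[of g "\<lambda>x. x" c] by (simp add: linear_ident)

lemma schwartz_tf_atom:
  assumes "g \<in> schwartz_space"
  shows "tf_atom z \<zeta> g \<in> schwartz_space"
  using schwartz_modulation[OF schwartz_translate[OF assms, of "- z"], of "- (2 * pi) *\<^sub>R \<zeta>"]
  by (simp add: tf_atom_def)

text \<open>
  The atoms alone do not decay in \<open>(z, \<zeta>)\<close>; the factor \<open>a\<close> supplies this decay, and the modulation is a
  chirp in \<open>(t, \<zeta>)\<close>.
\<close>

lemma schwartz_tf_atom_family:
  fixes a :: "'a::euclidean_space \<times> 'a \<Rightarrow> complex"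
  assumes a: "a \<in> schwartz_space" and g: "g \<in> schwartz_space"
  shows "(\<lambda>x. a (snd x) * tf_atom (fst (snd x)) (snd (snd x)) g (fst x)) \<in> schwartz_space"
proof -
  let ?L = "\<lambda>x::'a \<times> 'a \<times> 'a. (snd x, fst x - fst (snd x))"
  have L: "linear ?L" by (intro linearI) (auto simp: algebra_simps)
  have inj: "inj ?L" by (auto simp: inj_def prod_eq_iff)
  have base: "(\<lambda>x. a (snd x) * g (fst x - fst (snd x))) \<in> schwartz_space"
    using schwartz_linear[OF schwartz_tensor[OF a g] L inj] by simp
  have "(\<lambda>x::'a \<times> 'a \<times> 'a. cis (- (2 * pi * (fst x \<bullet> snd (snd x)))) * (a (snd x) * g (fst x - fst (snd x)))) \<in> schwartz_space"
  proof (rule schwartz_chirp[OF base, where q' = "\<lambda>x v. - (2 * pi * (fst x \<bullet> snd (snd v) + fst v \<bullet> snd (snd x)))"])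
    show "((\<lambda>x::'a \<times> 'a \<times> 'a. - (2 * pi * (fst x \<bullet> snd (snd x)))) has_derivative
        (\<lambda>v. - (2 * pi * (fst x \<bullet> snd (snd v) + fst v \<bullet> snd (snd x))))) (at x)" for x
      by (auto intro!: derivative_eq_intros)
    fix \<psi> :: "'a \<times> 'a \<times> 'a \<Rightarrow> complex" and b :: "'a \<times> 'a \<times> 'a" assume "\<psi> \<in> schwartz_space"
    from schwartz_cmult[OF schwartz_mult_inner[OF this, of "(snd (snd b), 0, fst b)"], of "- (2 * pi)"]
    show "(\<lambda>x. complex_of_real (- (2 * pi * (fst x \<bullet> snd (snd b) + fst b \<bullet> snd (snd x)))) * \<psi> x) \<in> schwartz_space"
      by (simp add: inner_prod_def inner_commute mult.assoc)
  qed
  then show ?thesis by (simp add: tf_atom_def mult_ac)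
qed

text \<open>
  Near a given point, the atoms are multiplied by a Schwartz function \<open>b\<close> of the parameters that does not
  vanish there, which makes the family jointly Schwartz, and \<open>b\<close> is divided out afterwards.
\<close>

lemma stft_continuous:
  assumes u: "u \<in> tempered_distributions" and G: "G \<in> schwartz_space"
  shows "continuous_on UNIV (\<lambda>w. stft G u (fst w) (snd w))"
proof (cases "\<exists>p. G p \<noteq> 0")
  case False
  then have "(\<lambda>t. cnj (G t)) = (\<lambda>t. 0)" by auto
  then have "stft G u z \<zeta> = u (\<lambda>t. 0)" for z \<zeta> by (simp add: stft_eq_tf_atom tf_atom_def)
  then show ?thesis by simp
next
  case True
  then obtain p where p: "G p \<noteq> 0" by blast
  let ?g = "\<lambda>t. cnj (G t)"
  let ?V = "\<lambda>w. stft G u (fst w) (snd w)"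
  have g: "?g \<in> schwartz_space" by (rule schwartz_cnj[OF G])
  have "isCont ?V w" for w :: "'a \<times> 'a"
  proof -
    \<comment> \<open>Both factors are translated so that they take the nonzero value \<open>G p\<close> at \<open>w\<close>.\<close>
    define b where "b = (\<lambda>v. G (fst v + (p - fst w)) * G (snd v + (p - snd w)))"
    have b: "b \<in> schwartz_space"
      unfolding b_def by (rule schwartz_tensor) (rule schwartz_translate[OF G])+
    have bw: "b w \<noteq> 0" using p by (simp add: b_def)
    have b_cont: "isCont b w"
      using schwartz_continuous_on[OF b, of UNIV] continuous_on_eq_continuous_at[OF open_UNIV] by blast
    have "continuous_on UNIV (\<lambda>v. u (\<lambda>t. b v * tf_atom (fst v) (snd v) ?g t))"
      using tempered_section_continuous[OF u schwartz_tf_atom_family[OF b g]] by simp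
    then have "continuous_on UNIV (\<lambda>v. b v * ?V v)"
      by (simp add: tempered_cmult[OF u schwartz_tf_atom[OF g]] stft_eq_tf_atom)
    then have "isCont (\<lambda>v. b v * ?V v) w" using continuous_on_eq_continuous_at[OF open_UNIV] by blast
    then have "isCont (\<lambda>v. b v * ?V v / b v) w" using b_cont bw by (rule isCont_divide)
    moreover have "\<forall>\<^sub>F v in nhds w. b v * ?V v / b v = ?V v"
    proof -
      have "\<forall>\<^sub>F v in nhds w. b v \<noteq> 0"
        using b_cont bw tendsto_imp_eventually_ne[of b "b w" "nhds w" 0] by (simp add: isCont_def tendsto_at_iff_tendsto_nhds)
      then show ?thesis by eventually_elim simp
    qed
    ultimately show ?thesis by (subst (asm) isCont_cong)
  qed
  then show ?thesis by (simp add: continuous_on_eq_continuous_at)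
qed

lemma open_AE_empty:
  fixes U :: "'a::euclidean_space set"
  assumes "open U" "AE x in lborel. x \<notin> U"
  shows "U = {}"
proof (rule ccontr)
  assume "U \<noteq> {}"
  then obtain x e where e: "e > 0" "ball x e \<subseteq> U"
    using assms(1) unfolding open_contains_ball by blast
  have "AE y in lborel. y \<notin> ball x e" using assms(2) by eventually_elim (use e in auto)
  then have "emeasure lborel (ball x e) = 0"
    by (subst (asm) AE_iff_measurable[of "ball x e"]) auto
  then show False using content_ball_pos[OF e(1), of x] by (simp add: measure_def)
qed

lemma schwartz_norm_square_pos:
  assumes G: "G \<in> schwartz_space" and "G \<noteq> (\<lambda>_. 0)"
  shows "(LINT s|lborel. G s * cnj (G s)) \<noteq> 0"
proof
  assume 0: "(LINT s|lborel. G s * cnj (G s)) = 0"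
  have "(\<lambda>s. G s * cnj (G s)) \<in> schwartz_space" by (rule schwartz_mult[OF G schwartz_cnj[OF G]])
  then have int: "integrable lborel (\<lambda>s. G s * cnj (G s))" by (rule schwartz_integrable)
  have eq: "G s * cnj (G s) = complex_of_real ((norm (G s))\<^sup>2)" for s
    by (rule complex_norm_square[symmetric])
  have intr: "integrable lborel (\<lambda>s. (norm (G s))\<^sup>2)"
    using int unfolding eq complex_of_real_integrable_eq .
  have "(LINT s|lborel. (norm (G s))\<^sup>2) = 0"
    using 0 unfolding eq integral_complex_of_real of_real_eq_0_iff .
  then have "AE s in lborel. (norm (G s))\<^sup>2 = 0"
    using integral_nonneg_eq_0_iff_AE[OF intr] by simp
  then have ae: "AE s in lborel. s \<notin> {s. G s \<noteq> 0}" by simp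
  have op: "open {s. G s \<noteq> 0}"
    using open_Collect_neq[OF schwartz_continuous_on[OF G] continuous_on_const] .
  from open_AE_empty[OF op ae] assms(2) show False by auto
qed

text \<open>
  For fixed \<open>z\<close>, Fourier inversion recovers the product of the conjugate of \<open>G'\<close> with the translate of \<open>G\<close>.
  Multiplying by the conjugate of the same translate and integrating over \<open>z\<close> leaves the conjugate of \<open>G'\<close> times the
  square of the \<open>L\<^sup>2\<close> norm of \<open>G\<close>.  This writes every atom for \<open>G'\<close> as a superposition of atoms for \<open>G\<close>, with a
  density \<open>a\<close> that is the same for all \<open>(z, \<zeta>)\<close> up to phases.
\<close>

theorem stft_change_window:
  fixes G G' :: "'a::euclidean_space \<Rightarrow> complex"
  assumes u: "u \<in> tempered_distributions" and G: "G \<in> schwartz_space" "G \<noteq> (\<lambda>_. 0)"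
    and G': "G' \<in> schwartz_space"
  obtains k :: "'a \<times> 'a \<Rightarrow> real" where "integrable lborel k" "\<And>w. k w \<ge> 0"
    "\<And>z \<zeta>. ennreal (norm (stft G' u z \<zeta>)) \<le>
       (\<integral>\<^sup>+w. ennreal (k w) * ennreal (norm (stft G u (z + fst w) (\<zeta> + snd w))) \<partial>lborel)"
proof -
  define c where "c = (LINT s|lborel. G s * cnj (G s))"
  have c: "c \<noteq> 0" unfolding c_def by (rule schwartz_norm_square_pos[OF G])
  define g g' where "g = (\<lambda>t. cnj (G t))" and "g' = (\<lambda>t. cnj (G' t))"
  have g: "g \<in> schwartz_space" unfolding g_def by (rule schwartz_cnj[OF G(1)])
  have g': "g' \<in> schwartz_space" unfolding g'_def by (rule schwartz_cnj[OF G'])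
  \<comment> \<open>The density \<open>a\<close> is the transform in \<open>t\<close> of the product of \<open>g'\<close> with the translate of \<open>G\<close> by \<open>z\<close>.\<close>
  define H where "H = (\<lambda>x::'a \<times> 'a. g' (snd x) * G (snd x - fst x))"
  have H: "H \<in> schwartz_space"
  proof -
    have "linear (\<lambda>x::'a \<times> 'a. (snd x, snd x - fst x))" by (intro linearI) (auto simp: algebra_simps)
    from schwartz_linear[OF schwartz_tensor[OF g' G(1)] this] show ?thesis
      by (simp add: H_def inj_def)
  qed
  define a where "a = inv_partial_fourier2 H"
  have a: "a \<in> schwartz_space"
    unfolding a_def by (rule schwartz_continuous_in[OF schwartz_continuous_inv_partial_fourier2 H])
  let ?K = "\<lambda>x. a (snd x) * tf_atom (fst (snd x)) (snd (snd x)) g (fst x)"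
  have K: "?K \<in> schwartz_space" by (rule schwartz_tf_atom_family[OF a g])
  have repr: "(LINT w|lborel. ?K (t, w)) = c * g' t" for t
  proof -
    have "integrable (lborel \<Otimes>\<^sub>M lborel) (\<lambda>w. ?K (t, w))"
      unfolding lborel_prod by (rule schwartz_integrable[OF schwartz_section[OF K]])
    then have "(LINT w|lborel. ?K (t, w)) = (LINT z|lborel. LINT \<eta>|lborel. ?K (t, z, \<eta>))"
      unfolding lborel_prod[symmetric] by (rule lborel_pair.integral_fst'[symmetric])
    also have "\<dots> = (LINT z|lborel. g' t * (G (t - z) * g (t - z)))"
    proof (rule Bochner_Integration.integral_cong[OF refl])
      fix z
      have "(LINT \<eta>|lborel. ?K (t, z, \<eta>)) = (LINT \<eta>|lborel. cis (- (2 * pi * (t \<bullet> \<eta>))) * a (z, \<eta>) * g (t - z))"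
        by (simp add: tf_atom_def mult_ac)
      also have "\<dots> = partial_fourier2 a (z, t) * g (t - z)"
        by (simp add: partial_fourier2_apply)
      also have "partial_fourier2 a (z, t) = H (z, t)"
        by (simp add: a_def partial_fourier2_inv_partial_fourier2[OF H])
      finally show "(LINT \<eta>|lborel. ?K (t, z, \<eta>)) = g' t * (G (t - z) * g (t - z))"
        by (simp add: H_def)
    qed
    also have "\<dots> = g' t * (LINT z|lborel. G (t - z) * g (t - z))" by simp
    also have "(LINT z|lborel. G (t - z) * g (t - z)) = c"
    proof -
      have m: "(\<lambda>s. G s * g s) \<in> borel_measurable borel"
        by (rule schwartz_borel[OF schwartz_mult[OF G(1) g]])
      show ?thesis
        using lborel_integral_affine[OF m, of "-1" t] by (simp add: c_def g_def)
    qed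
    finally show ?thesis by (simp add: mult.commute)
  qed
  show thesis
  proof (rule that)
    show "integrable lborel (\<lambda>w. norm (a w) / norm c)"
      by (intro integrable_divide integrable_norm schwartz_integrable a)
    fix z \<zeta>
    let ?Kz = "\<lambda>x. cis (- (2 * pi * (fst x \<bullet> \<zeta>))) * ?K (fst x - z, snd x)"
    have Kz: "?Kz \<in> schwartz_space"
      using schwartz_modulation[OF schwartz_translate[OF K, of "(- z, 0)"], of "(- (2 * pi) *\<^sub>R \<zeta>, 0)"]
      by (simp add: inner_prod_def)
    have Kz_eq: "?Kz (t, w) = (a w * cis (2 * pi * (z \<bullet> snd w))) * tf_atom (z + fst w) (\<zeta> + snd w) g t" for t w
      using fun_cong[OF tf_atom_tf_atom[of z \<zeta> "fst w" "snd w" g], of t] by (simp add: tf_atom_def mult_ac)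
    have uKz: "u (\<lambda>t. ?Kz (t, w)) = (a w * cis (2 * pi * (z \<bullet> snd w))) * stft G u (z + fst w) (\<zeta> + snd w)" for w
      unfolding Kz_eq tempered_cmult[OF u schwartz_tf_atom[OF g]] by (simp add: stft_eq_tf_atom g_def)
    have "c * stft G' u z \<zeta> = u (\<lambda>t. c * tf_atom z \<zeta> g' t)"
      unfolding tempered_cmult[OF u schwartz_tf_atom[OF g']] by (simp add: stft_eq_tf_atom g'_def)
    also have "(\<lambda>t. c * tf_atom z \<zeta> g' t) = (\<lambda>t. LINT w|lborel. ?Kz (t, w))"
    proof
      fix t
      have "c * tf_atom z \<zeta> g' t = cis (- (2 * pi * (t \<bullet> \<zeta>))) * (LINT w|lborel. ?K (t - z, w))"
        unfolding repr by (simp add: tf_atom_def)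
      also have "\<dots> = (LINT w|lborel. cis (- (2 * pi * (t \<bullet> \<zeta>))) * ?K (t - z, w))"
        by (rule integral_mult_right_zero[symmetric])
      finally show "c * tf_atom z \<zeta> g' t = (LINT w|lborel. ?Kz (t, w))" by simp
    qed
    also have "u \<dots> = (LINT w|lborel. u (\<lambda>t. ?Kz (t, w)))"
      by (rule tempered_integral[OF u Kz])
    finally have "norm c * norm (stft G' u z \<zeta>) = norm (LINT w|lborel. u (\<lambda>t. ?Kz (t, w)))"
      by (metis norm_mult)
    then have "norm (stft G' u z \<zeta>) = norm (LINT w|lborel. u (\<lambda>t. ?Kz (t, w))) / norm c"
      using c by (simp add: field_simps)
    also have "\<dots> \<le> (LINT w|lborel. norm (u (\<lambda>t. ?Kz (t, w)))) / norm c"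
      by (intro divide_right_mono integral_norm_bound) simp
    also have "\<dots> = (LINT w|lborel. norm (a w) / norm c * norm (stft G u (z + fst w) (\<zeta> + snd w)))"
      unfolding uKz by (simp add: norm_mult)
    finally have le: "norm (stft G' u z \<zeta>) \<le> (LINT w|lborel. norm (a w) / norm c * norm (stft G u (z + fst w) (\<zeta> + snd w)))" .
    have int: "integrable lborel (\<lambda>w. norm (a w) / norm c * norm (stft G u (z + fst w) (\<zeta> + snd w)))"
      using integrable_divide[OF integrable_norm[OF tempered_section_integrable[OF u Kz]], of "norm c"]
      unfolding uKz by (simp add: norm_mult)
    have "ennreal (norm (stft G' u z \<zeta>)) \<le> ennreal (LINT w|lborel. norm (a w) / norm c * norm (stft G u (z + fst w) (\<zeta> + snd w)))"
      by (rule ennreal_leI[OF le])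
    also have "\<dots> = (\<integral>\<^sup>+w. ennreal (norm (a w) / norm c * norm (stft G u (z + fst w) (\<zeta> + snd w))) \<partial>lborel)"
      by (rule nn_integral_eq_integral[OF int, symmetric]) simp
    also have "\<dots> = (\<integral>\<^sup>+w. ennreal (norm (a w) / norm c) * ennreal (norm (stft G u (z + fst w) (\<zeta> + snd w))) \<partial>lborel)"
      by (intro nn_integral_cong ennreal_mult) auto
    finally show "ennreal (norm (stft G' u z \<zeta>)) \<le> \<dots>" .
  qed simp
qed

section \<open>Minkowski's integral inequality\<close>

lemma ennpowr_ennreal: "t \<ge> 0 \<Longrightarrow> ennpowr (ennreal t) r = ennreal (t powr r)"
  by (simp add: ennpowr_def)

lemma ennpowr_top [simp]: "ennpowr \<infinity> r = \<infinity>" "ennpowr top r = top"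
  by (simp_all add: ennpowr_def infinity_ennreal_def)

lemma ennpowr_0 [simp]: "ennpowr 0 r = 0"
  by (simp add: ennpowr_def)

lemma ennpowr_eq_0_iff: "ennpowr x r = 0 \<longleftrightarrow> x = 0"
  by (cases x) (auto simp: ennpowr_ennreal)

lemma ennpowr_1 [simp]: "ennpowr x 1 = x"
  by (cases x) (auto simp: ennpowr_ennreal)

lemma ennpowr_mono: "x \<le> y \<Longrightarrow> r > 0 \<Longrightarrow> ennpowr x r \<le> ennpowr y r"
  by (cases x; cases y) (auto simp: ennpowr_ennreal top_unique intro!: ennreal_leI powr_mono2)

lemma ennpowr_ennpowr_inverse: "r > 0 \<Longrightarrow> ennpowr (ennpowr x r) (1 / r) = x"
  by (cases x) (auto simp: ennpowr_ennreal powr_powr)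

lemma ennpowr_inverse_ennpowr: "r > 0 \<Longrightarrow> ennpowr (ennpowr x (1 / r)) r = x"
  by (cases x) (auto simp: ennpowr_ennreal powr_powr)

lemma ennpowr_mult: "r > 0 \<Longrightarrow> ennpowr (x * y) r = ennpowr x r * ennpowr y r"
  by (cases x; cases y) (auto simp: ennpowr_ennreal powr_mult ennreal_mult[symmetric] ennreal_top_mult ennreal_mult_top)

lemma borel_measurable_ennpowr [measurable (raw)]:
  assumes f: "f \<in> borel_measurable M"
  shows "(\<lambda>x. ennpowr (f x) r) \<in> borel_measurable M"
  unfolding ennpowr_def
proof (intro measurable_If measurable_const)
  have "f -` {\<infinity>} \<inter> space M \<in> sets M" using f by (intro measurable_sets[OF f]) simp
  then show "{x \<in> space M. f x = \<infinity>} \<in> sets M" by (simp add: vimage_def Int_def conj_commute)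
  show "(\<lambda>x. ennreal (enn2real (f x) powr r)) \<in> borel_measurable M"
    using f by measurable
qed simp

text \<open>
  Young's inequality for \<open>t / w\<close> and \<open>s powr (r - 1)\<close>, multiplied by \<open>w\<close>.
\<close>

lemma young_weighted:
  fixes t s w r :: real
  assumes "t \<ge> 0" "s \<ge> 0" "w > 0" "r \<ge> 1"
  shows "t * s powr (r - 1) \<le> (1 / r) * (t powr r / w powr (r - 1)) + (1 - 1 / r) * (s powr r * w)"
proof (cases "r = 1")
  case True
  then show ?thesis using assms by auto
next
  case False
  then have r: "r > 1" using assms by simp
  have "(t / w) powr 1 * s powr (r - 1) \<le> (1/r) * (t / w) powr r + (1 - 1/r) * s powr r"
  proof -
    have "(t / w) * s powr (r - 1) \<le> (t / w) powr r / r + (s powr (r - 1)) powr (r / (r - 1)) / (r / (r - 1))"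
      using assms r by (intro Youngs_inequality) (auto simp: field_simps)
    also have "(s powr (r - 1)) powr (r / (r - 1)) = s powr r" using r by (simp add: powr_powr)
    also have "s powr r / (r / (r - 1)) = (1 - 1/r) * s powr r" using r by (simp add: field_simps)
    finally show ?thesis using assms by simp
  qed
  then have "w * ((t / w) powr 1 * s powr (r - 1)) \<le> w * ((1/r) * (t / w) powr r + (1 - 1/r) * s powr r)"
    using assms by (intro mult_left_mono) auto
  moreover have "w * ((t / w) powr 1 * s powr (r - 1)) = t * s powr (r - 1)" using assms by simp
  moreover have "w * (t / w) powr r = t powr r / w powr (r - 1)"
    using assms by (simp add: powr_divide powr_diff)
  ultimately show ?thesis by (simp add: algebra_simps)
qed

text \<open>
  Hoelder's inequality with respect to the weight \<open>W\<close>, obtained by integrating tangent lines of the power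
  function.  In Minkowski's inequality, \<open>W\<close> is a majorant of the norms of the sections.
\<close>

lemma ennpowr_integral_le:
  fixes f W :: "'a \<Rightarrow> ennreal"
  assumes [measurable]: "f \<in> borel_measurable M" "W \<in> borel_measurable M"
    and r: "r \<ge> 1" and K: "(\<integral>\<^sup>+y. W y \<partial>M) = ennreal K" "K > 0"
  shows "ennpowr (\<integral>\<^sup>+y. f y \<partial>M) r
    \<le> ennreal (K powr (r - 1)) * (\<integral>\<^sup>+y. ennpowr (f y) r * inverse (ennpowr (W y) (r - 1)) \<partial>M)"
proof (cases "(\<integral>\<^sup>+y. ennpowr (f y) r * inverse (ennpowr (W y) (r - 1)) \<partial>M) = \<infinity>")
  case True
  then show ?thesis using K(2) by (simp add: ennreal_mult_top)
next
  case False
  define J where "J = (\<integral>\<^sup>+y. ennpowr (f y) r * inverse (ennpowr (W y) (r - 1)) \<partial>M)"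
  define P where "P = (\<integral>\<^sup>+y. f y \<partial>M)"
  obtain j where j: "J = ennreal j" "j \<ge> 0" using False unfolding J_def[symmetric] by (cases J) auto
  have fin: "AE y in M. W y \<noteq> \<infinity>"
    by (rule nn_integral_PInf_AE) (use K in auto)
  have tangent: "ennreal (s powr (r - 1)) * P \<le> ennreal (1 / r) * J + ennreal ((1 - 1 / r) * s powr r) * ennreal K"
    if s: "s > 0" for s
  proof -
    have "AE y in M. ennreal (s powr (r - 1)) * f y
      \<le> ennreal (1 / r) * (ennpowr (f y) r * inverse (ennpowr (W y) (r - 1))) + ennreal ((1 - 1 / r) * s powr r) * W y"
      using fin
    proof eventually_elim
      case (elim y)
      then obtain w where w: "W y = ennreal w" "w \<ge> 0" by (cases "W y") auto
      show ?case
      proof (cases "f y = 0")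
        case True
        then show ?thesis by simp
      next
        case f0: False
        show ?thesis
        proof (cases "w = 0 \<or> f y = \<infinity>")
          case True
          have "ennpowr (f y) r * inverse (ennpowr (W y) (r - 1)) = \<infinity>"
          proof (cases "w = 0")
            case True
            then show ?thesis using f0 w by (simp add: ennpowr_eq_0_iff ennreal_mult_top)
          next
            case False
            then show ?thesis using True w by (simp add: ennpowr_ennreal ennreal_top_mult)
          qed
          then show ?thesis using r by (simp add: ennreal_mult_top)
        next
          case False
          then obtain t where t: "f y = ennreal t" "t \<ge> 0" by (cases "f y") auto
          have "w > 0" using False w by simp
          have "ennreal (s powr (r - 1)) * f y = ennreal (t * s powr (r - 1))"
            using t by (simp add: ennreal_mult'' mult.commute)
          also have "\<dots> \<le> ennreal ((1 / r) * (t powr r / w powr (r - 1)) + (1 - 1 / r) * (s powr r * w))"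
            using t \<open>w > 0\<close> s r by (intro ennreal_leI young_weighted) auto
          also have "\<dots> = ennreal (1 / r) * (ennpowr (f y) r * inverse (ennpowr (W y) (r - 1))) + ennreal ((1 - 1 / r) * s powr r) * W y"
          proof -
            have "ennpowr (f y) r * inverse (ennpowr (W y) (r - 1)) = ennreal (t powr r / w powr (r - 1))"
              using t w \<open>w > 0\<close> by (simp add: ennpowr_ennreal inverse_ennreal ennreal_mult[symmetric] divide_inverse)
            moreover have "0 \<le> 1 - 1 / r" using r by simp
            ultimately show ?thesis
              unfolding w(1) using t r \<open>w > 0\<close>
              by (simp only: ennreal_mult[symmetric] ennreal_plus[symmetric] divide_nonneg_nonneg mult_nonneg_nonneg powr_ge_zero w(2) zero_le_one order_trans[OF zero_le_one r] mult.assoc)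
          qed
          finally show ?thesis .
        qed
      qed
    qed
    then have "(\<integral>\<^sup>+y. ennreal (s powr (r - 1)) * f y \<partial>M)
      \<le> (\<integral>\<^sup>+y. ennreal (1 / r) * (ennpowr (f y) r * inverse (ennpowr (W y) (r - 1))) + ennreal ((1 - 1 / r) * s powr r) * W y \<partial>M)"
      by (rule nn_integral_mono_AE)
    then show ?thesis
      by (simp add: nn_integral_add nn_integral_cmult P_def J_def K(1))
  qed
  have "P \<noteq> \<infinity>"
  proof
    assume "P = \<infinity>"
    with tangent[of 1] show False
      using r j K by (simp add: ennreal_mult_top ennreal_mult[symmetric] ennreal_plus[symmetric] top_unique del: ennreal_plus)
  qed
  then obtain q where q: "P = ennreal q" "q \<ge> 0" by (cases P) auto
  show ?thesis
  proof (cases "q = 0")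
    case True
    then show ?thesis using q by (simp add: P_def)
  next
    case False
    \<comment> \<open>The tangent point at which the inequality is sharp: the mean value of \<open>f / W\<close> with respect to \<open>W\<close>.\<close>
    define s where "s = q / K"
    have s: "s > 0" "q = s * K" using False q K by (auto simp: s_def)
    have sr: "s powr r = s powr (r - 1) * s" using s(1) by (simp add: powr_diff)
    from tangent[OF s(1)] have "s powr (r - 1) * q \<le> (1 / r) * j + (1 - 1 / r) * s powr r * K"
      using r j q K s by (simp add: ennreal_mult[symmetric] ennreal_plus[symmetric] del: ennreal_plus)
    then have "s powr r * K \<le> j" using r unfolding s(2) sr by (simp add: field_simps)
    then have "K powr (r - 1) * (s powr r * K) \<le> K powr (r - 1) * j" by (intro mult_left_mono) auto
    moreover have "K powr (r - 1) * (s powr r * K) = q powr r"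
      using s K(2) unfolding s(2) by (simp add: powr_mult powr_diff)
    ultimately show ?thesis
      unfolding P_def[symmetric] J_def[symmetric] using q j by (simp add: ennpowr_ennreal ennreal_mult[symmetric] ennreal_leI)
  qed
qed

text \<open>
  For finite \<open>p\<close>, the weighted inequality \<open>ennpowr_integral_le\<close> is integrated over \<open>x\<close> and the order of integration
  is exchanged; a majorant with integral zero is treated apart, since the weight is then degenerate.
  For \<open>p = \<infinity>\<close>, the exceptional null sets are exchanged by Fubini's theorem.  Allowing any majorant \<open>W\<close> of the
  norms avoids the question whether the norms themselves are measurable in \<open>y\<close>.
\<close>

theorem Lp_norm_integral_le:
  fixes f :: "'a::euclidean_space \<times> 'b::euclidean_space \<Rightarrow> ennreal"
  assumes f [measurable]: "f \<in> borel_measurable (lborel \<Otimes>\<^sub>M lborel)"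
    and [measurable]: "W \<in> borel_measurable lborel"
    and p: "1 \<le> p" and W: "\<And>y. Lp_norm p (\<lambda>x. f (x, y)) \<le> W y"
  shows "Lp_norm p (\<lambda>x. \<integral>\<^sup>+y. f (x, y) \<partial>lborel) \<le> (\<integral>\<^sup>+y. W y \<partial>lborel)"
proof (cases "p = \<infinity>")
  case True
  have "AE y in lborel. AE x in lborel. f (x, y) \<le> W y"
  proof (rule AE_I2)
    fix y
    have "AE x in lborel. f (x, y) \<le> esssup lborel (\<lambda>x. f (x, y))" by (rule esssup_AE)
    then show "AE x in lborel. f (x, y) \<le> W y"
      by eventually_elim (use W[of y] True in \<open>auto simp: Lp_norm_def intro: order_trans\<close>)
  qed
  moreover have "{x \<in> space (lborel \<Otimes>\<^sub>M lborel). f (fst x, snd x) \<le> W (snd x)} \<in> sets (lborel \<Otimes>\<^sub>M lborel)"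
    by measurable
  ultimately have "AE x in lborel. AE y in lborel. f (x, y) \<le> W y"
    using lborel_pair.AE_commute[of "\<lambda>x y. f (x, y) \<le> W y"] by blast
  then have "AE x in lborel. (\<integral>\<^sup>+y. f (x, y) \<partial>lborel) \<le> (\<integral>\<^sup>+y. W y \<partial>lborel)"
    by eventually_elim (rule nn_integral_mono_AE)
  then show ?thesis unfolding Lp_norm_def using True by (simp add: esssup_I)
next
  case False
  define r where "r = enn2real p"
  have r: "r \<ge> 1" using p False unfolding r_def by (cases p) auto
  have Lp: "Lp_norm p h = ennpowr (\<integral>\<^sup>+x. ennpowr (h x) r \<partial>lborel) (1 / r)" for h :: "'a \<Rightarrow> ennreal"
    using False by (simp add: Lp_norm_def r_def)
  have W': "(\<integral>\<^sup>+x. ennpowr (f (x, y)) r \<partial>lborel) \<le> ennpowr (W y) r" for y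
    using ennpowr_mono[OF W[of y], of r] r unfolding Lp by (simp add: ennpowr_inverse_ennpowr)
  have "(\<integral>\<^sup>+x. ennpowr (\<integral>\<^sup>+y. f (x, y) \<partial>lborel) r \<partial>lborel) \<le> ennpowr (\<integral>\<^sup>+y. W y \<partial>lborel) r"
  proof (cases "(\<integral>\<^sup>+y. W y \<partial>lborel) = 0 \<or> (\<integral>\<^sup>+y. W y \<partial>lborel) = \<infinity>")
    case False
    then obtain K where K: "(\<integral>\<^sup>+y. W y \<partial>lborel) = ennreal K" "K > 0"
      by (cases "\<integral>\<^sup>+y. W y \<partial>lborel") (auto simp: less_le)
    have "(\<integral>\<^sup>+x. ennpowr (\<integral>\<^sup>+y. f (x, y) \<partial>lborel) r \<partial>lborel)
      \<le> (\<integral>\<^sup>+x. ennreal (K powr (r - 1)) * (\<integral>\<^sup>+y. ennpowr (f (x, y)) r * inverse (ennpowr (W y) (r - 1)) \<partial>lborel) \<partial>lborel)"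
      by (intro nn_integral_mono ennpowr_integral_le r K) auto
    also have "\<dots> = ennreal (K powr (r - 1)) * (\<integral>\<^sup>+x. (\<integral>\<^sup>+y. ennpowr (f (x, y)) r * inverse (ennpowr (W y) (r - 1)) \<partial>lborel) \<partial>lborel)"
      by (intro nn_integral_cmult) measurable
    also have "(\<integral>\<^sup>+x. (\<integral>\<^sup>+y. ennpowr (f (x, y)) r * inverse (ennpowr (W y) (r - 1)) \<partial>lborel) \<partial>lborel)
      = (\<integral>\<^sup>+y. (\<integral>\<^sup>+x. ennpowr (f (x, y)) r * inverse (ennpowr (W y) (r - 1)) \<partial>lborel) \<partial>lborel)"
      by (rule lborel_pair.Fubini'[symmetric]) measurable
    also have "\<dots> = (\<integral>\<^sup>+y. (\<integral>\<^sup>+x. ennpowr (f (x, y)) r \<partial>lborel) * inverse (ennpowr (W y) (r - 1)) \<partial>lborel)"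
      by (intro nn_integral_cong nn_integral_multc) measurable
    also have "\<dots> \<le> (\<integral>\<^sup>+y. W y \<partial>lborel)"
    proof (rule nn_integral_mono)
      fix y
      have "(\<integral>\<^sup>+x. ennpowr (f (x, y)) r \<partial>lborel) * inverse (ennpowr (W y) (r - 1)) \<le> ennpowr (W y) r * inverse (ennpowr (W y) (r - 1))"
        by (intro mult_right_mono W') simp
      also have "\<dots> \<le> W y"
      proof (cases "W y")
        case (real w)
        show ?thesis
        proof (cases "w = 0")
          case False
          then have "w > 0" using real by simp
          then show ?thesis using real
            by (simp add: ennpowr_ennreal inverse_ennreal ennreal_mult[symmetric] powr_diff divide_simps)
        qed (use real in simp)
      qed simp
      finally show "(\<integral>\<^sup>+x. ennpowr (f (x, y)) r \<partial>lborel) * inverse (ennpowr (W y) (r - 1)) \<le> W y" .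
    qed
    also have "ennreal (K powr (r - 1)) * (\<integral>\<^sup>+y. W y \<partial>lborel) = ennpowr (\<integral>\<^sup>+y. W y \<partial>lborel) r"
      using K by (simp add: ennpowr_ennreal ennreal_mult[symmetric] powr_diff)
    finally show ?thesis by (simp add: mult_left_mono)
  next
    case True
    then show ?thesis
    proof
      assume "(\<integral>\<^sup>+y. W y \<partial>lborel) = 0"
      then have "AE y in lborel. W y = 0" by (simp add: nn_integral_0_iff_AE)
      then have "AE y in lborel. AE x in lborel. f (x, y) = 0"
      proof eventually_elim
        case (elim y)
        then have "(\<integral>\<^sup>+x. ennpowr (f (x, y)) r \<partial>lborel) = 0" using W'[of y] by simp
        then have "AE x in lborel. ennpowr (f (x, y)) r = 0" by (subst (asm) nn_integral_0_iff_AE) auto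
        then show ?case by (simp add: ennpowr_eq_0_iff)
      qed
      moreover have "{x \<in> space (lborel \<Otimes>\<^sub>M lborel). f (fst x, snd x) = 0} \<in> sets (lborel \<Otimes>\<^sub>M lborel)"
        by measurable
      ultimately have "AE x in lborel. AE y in lborel. f (x, y) = 0"
        using lborel_pair.AE_commute[of "\<lambda>x y. f (x, y) = 0"] by blast
      then have "AE x in lborel. ennpowr (\<integral>\<^sup>+y. f (x, y) \<partial>lborel) r = 0"
      proof eventually_elim
        case (elim x)
        then have "(\<integral>\<^sup>+y. f (x, y) \<partial>lborel) = 0" by (subst nn_integral_0_iff_AE) auto
        then show ?case by simp
      qed
      then have "(\<integral>\<^sup>+x. ennpowr (\<integral>\<^sup>+y. f (x, y) \<partial>lborel) r \<partial>lborel) = 0"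
        by (subst nn_integral_0_iff_AE) auto
      then show ?thesis by simp
    qed simp
  qed
  then show ?thesis unfolding Lp
    using ennpowr_mono[of _ "ennpowr (\<integral>\<^sup>+y. W y \<partial>lborel) r" "1 / r"] ennpowr_ennpowr_inverse[of r] r by force
qed

lemma Lp_norm_mono:
  assumes "f \<in> borel_measurable lborel" "\<And>x. f x \<le> g x" "1 \<le> p"
  shows "Lp_norm p f \<le> Lp_norm p g"
proof (cases "p = \<infinity>")
  case True
  then show ?thesis using assms by (simp add: Lp_norm_def esssup_mono)
next
  case False
  have "enn2real p \<ge> 1" using assms(3) False by (cases p) auto
  then show ?thesis using False assms(2) unfolding Lp_norm_def
    by (auto intro!: ennpowr_mono nn_integral_mono)
qed

lemma Lp_norm_cmult_le:
  assumes [measurable]: "f \<in> borel_measurable lborel" and "1 \<le> p"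
  shows "Lp_norm p (\<lambda>x. c * f x) \<le> c * Lp_norm p f"
proof (cases "p = \<infinity>")
  case True
  have "AE x in lborel. c * f x \<le> c * esssup lborel f"
    using esssup_AE[of f lborel] by eventually_elim (simp add: mult_left_mono)
  then show ?thesis using True by (auto simp: Lp_norm_def intro!: esssup_I)
next
  case False
  have r: "enn2real p \<ge> 1" using assms(2) False by (cases p) auto
  have "(\<integral>\<^sup>+x. ennpowr (c * f x) (enn2real p) \<partial>lborel) = ennpowr c (enn2real p) * (\<integral>\<^sup>+x. ennpowr (f x) (enn2real p) \<partial>lborel)"
    using r by (simp add: ennpowr_mult nn_integral_cmult)
  then show ?thesis using False r by (simp add: Lp_norm_def ennpowr_mult ennpowr_ennpowr_inverse)
qed

lemma Lp_norm_shift_le: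
  fixes f :: "'a::euclidean_space \<Rightarrow> ennreal"
  assumes [measurable]: "f \<in> borel_measurable borel"
  shows "Lp_norm p (\<lambda>x. f (x + c)) \<le> Lp_norm p f"
proof (cases "p = \<infinity>")
  case True
  have "AE x in distr lborel borel ((+) c). f x \<le> esssup lborel f"
    unfolding lborel_distr_plus by (rule esssup_AE)
  then have "AE x in lborel. f (x + c) \<le> esssup lborel f"
    by (subst (asm) AE_distr_iff) (auto simp: add.commute)
  then show ?thesis using True by (auto simp: Lp_norm_def intro!: esssup_I)
next
  case False
  then show ?thesis
    by (simp add: Lp_norm_def lborel_nn_integral_shift[of "\<lambda>x. ennpowr (f x) (enn2real p)"])
qed

text \<open>
  Nonempty open sets have positive measure.  The superlevel sets of the essential supremum of a family
  of continuous functions are thereby unions of open sets, which gives measurability in the parameter.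
\<close>

lemma esssup_continuous_less_iff:
  fixes f :: "'a::euclidean_space \<Rightarrow> ennreal"
  assumes f: "continuous_on UNIV f"
  shows "c < esssup lborel f \<longleftrightarrow> (\<exists>x. c < f x)"
proof
  assume less: "c < esssup lborel f"
  show "\<exists>x. c < f x"
  proof (rule ccontr)
    assume "\<nexists>x. c < f x"
    then have "esssup lborel f \<le> c"
      using borel_measurable_continuous_onI[OF f] by (intro esssup_I AE_I2) (auto simp: not_less)
    with less show False by simp
  qed
next
  assume "\<exists>x. c < f x"
  then have ne: "{x. c < f x} \<noteq> {}" by auto
  have op: "open {x. c < f x}" by (intro open_Collect_less continuous_on_const f)
  show "c < esssup lborel f"
  proof (rule ccontr)
    assume "\<not> c < esssup lborel f"
    then have le: "esssup lborel f \<le> c" by simp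
    have "AE x in lborel. x \<notin> {x. c < f x}"
      using esssup_AE[of f lborel] by eventually_elim (use le in \<open>auto simp: not_less\<close>)
    from open_AE_empty[OF op this] ne show False by simp
  qed
qed

lemma Lp_norm_section_measurable:
  fixes V :: "'a::euclidean_space \<times> 'b::euclidean_space \<Rightarrow> real"
  assumes V: "continuous_on UNIV V"
  shows "(\<lambda>\<zeta>. Lp_norm p (\<lambda>z. ennreal (V (z, \<zeta>)))) \<in> borel_measurable borel"
proof (cases "p = \<infinity>")
  case True
  have sec: "continuous_on UNIV (\<lambda>z. ennreal (V (z, \<zeta>)))" for \<zeta>
    by (intro continuous_on_ennreal continuous_on_compose2[OF V] continuous_intros) auto
  have sec': "continuous_on UNIV (\<lambda>\<zeta>. ennreal (V (z, \<zeta>)))" for z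
    by (intro continuous_on_ennreal continuous_on_compose2[OF V] continuous_intros) auto
  have "(\<lambda>\<zeta>. esssup lborel (\<lambda>z. ennreal (V (z, \<zeta>)))) \<in> borel_measurable borel"
  proof (rule borel_measurableI_greater)
    fix c
    have "{\<zeta> \<in> space borel. c < esssup lborel (\<lambda>z. ennreal (V (z, \<zeta>)))} = (\<Union>z. {\<zeta>. c < ennreal (V (z, \<zeta>))})"
      by (auto simp: esssup_continuous_less_iff[OF sec])
    also have "open \<dots>"
      by (intro open_UN ballI open_Collect_less continuous_on_const sec')
    finally show "{\<zeta> \<in> space borel. c < esssup lborel (\<lambda>z. ennreal (V (z, \<zeta>)))} \<in> sets borel" by simp
  qed
  then show ?thesis using True by (simp add: Lp_norm_def)
next
  case False
  have [measurable]: "V \<in> borel_measurable (borel \<Otimes>\<^sub>M borel)"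
    using borel_measurable_continuous_onI[OF V] by (simp add: borel_prod)
  show ?thesis unfolding Lp_norm_def using False by simp
qed

abbreviation mixed_norm :: "ennreal \<Rightarrow> ennreal \<Rightarrow> ('a::euclidean_space \<times> 'b::euclidean_space \<Rightarrow> real) \<Rightarrow> ennreal" where
  "mixed_norm p q V \<equiv> Lp_norm q (\<lambda>\<zeta>. Lp_norm p (\<lambda>z. ennreal (V (z, \<zeta>))))"

text \<open>
  Minkowski's inequality is used first in \<open>z\<close>, then in \<open>\<zeta>\<close>; the norms are invariant under translations.
\<close>

lemma mixed_norm_convolution:
  fixes V V' :: "'a::euclidean_space \<times> 'b::euclidean_space \<Rightarrow> real"
  assumes V: "continuous_on UNIV V" and V': "continuous_on UNIV V'"
    and k [measurable]: "k \<in> borel_measurable lborel" and p: "1 \<le> p" and q: "1 \<le> q"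
    and le: "\<And>z \<zeta>. ennreal (V' (z, \<zeta>)) \<le> (\<integral>\<^sup>+w. k w * ennreal (V (z + fst w, \<zeta> + snd w)) \<partial>lborel)"
  shows "mixed_norm p q V' \<le> (\<integral>\<^sup>+w. k w \<partial>lborel) * mixed_norm p q V"
proof -
  have Vm [measurable]: "V \<in> borel_measurable (borel \<Otimes>\<^sub>M borel)"
    using borel_measurable_continuous_onI[OF V] by (simp add: borel_prod)
  have Vm' [measurable]: "V' \<in> borel_measurable (borel \<Otimes>\<^sub>M borel)"
    using borel_measurable_continuous_onI[OF V'] by (simp add: borel_prod)
  have k' [measurable]: "k \<in> borel_measurable (borel \<Otimes>\<^sub>M borel)"
    using k by (simp add: borel_prod)
  define H where "H \<zeta> = Lp_norm p (\<lambda>z. ennreal (V (z, \<zeta>)))" for \<zeta>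
  have [measurable]: "H \<in> borel_measurable borel"
    unfolding H_def[abs_def] by (rule Lp_norm_section_measurable[OF V])
  have prod: "sets (lborel :: ('a \<times> 'b) measure) = sets ((borel :: 'a measure) \<Otimes>\<^sub>M (borel :: 'b measure))"
    by (subst borel_prod) simp
  have measI: "F \<in> borel_measurable (lborel \<Otimes>\<^sub>M (lborel :: ('a \<times> 'b) measure))"
    if "F \<in> borel_measurable (borel \<Otimes>\<^sub>M ((borel :: 'a measure) \<Otimes>\<^sub>M (borel :: 'b measure)))"
    for F :: "'c::euclidean_space \<times> 'a \<times> 'b \<Rightarrow> ennreal"
    using that unfolding measurable_cong_sets[OF sets_pair_measure_cong[OF sets_lborel prod] refl] .
  have sec: "(\<lambda>z. ennreal (V (z, \<zeta>))) \<in> borel_measurable borel" for \<zeta> by measurable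
  have sec': "(\<lambda>z. ennreal (V' (z, \<zeta>))) \<in> borel_measurable borel" for \<zeta> by measurable
  have inner: "Lp_norm p (\<lambda>z. ennreal (V' (z, \<zeta>))) \<le> (\<integral>\<^sup>+w. k w * H (\<zeta> + snd w) \<partial>lborel)" for \<zeta>
  proof -
    define F where "F x = k (snd x) * ennreal (V (fst x + fst (snd x), \<zeta> + snd (snd x)))" for x :: "'a \<times> 'a \<times> 'b"
    define W where "W w = k w * H (\<zeta> + snd w)" for w :: "'a \<times> 'b"
    have F: "F \<in> borel_measurable (lborel \<Otimes>\<^sub>M lborel)"
      unfolding F_def[abs_def] by (rule measI) measurable
    have "W \<in> borel_measurable (borel \<Otimes>\<^sub>M borel)"
      unfolding W_def[abs_def] by measurable
    then have Wm: "W \<in> borel_measurable lborel" by (simp add: borel_prod)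
    have W: "Lp_norm p (\<lambda>z. F (z, w)) \<le> W w" for w
    proof -
      have "Lp_norm p (\<lambda>z. F (z, w)) \<le> k w * Lp_norm p (\<lambda>z. ennreal (V (z + fst w, \<zeta> + snd w)))"
        unfolding F_def fst_conv snd_conv by (rule Lp_norm_cmult_le[OF _ p]) measurable
      also have "\<dots> \<le> W w"
        unfolding W_def H_def using Lp_norm_shift_le[OF sec[of "\<zeta> + snd w"], of p "fst w"] by (rule mult_left_mono) simp
      finally show ?thesis .
    qed
    have "Lp_norm p (\<lambda>z. ennreal (V' (z, \<zeta>))) \<le> Lp_norm p (\<lambda>z. \<integral>\<^sup>+w. F (z, w) \<partial>lborel)"
      using le sec' by (intro Lp_norm_mono p) (simp_all add: F_def)
    also have "\<dots> \<le> (\<integral>\<^sup>+w. W w \<partial>lborel)"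
      by (rule Lp_norm_integral_le[OF F Wm p W])
    finally show ?thesis by (simp add: W_def)
  qed
  define F where "F x = k (snd x) * H (fst x + snd (snd x))" for x :: "'b \<times> 'a \<times> 'b"
  define W where "W w = k w * Lp_norm q H" for w :: "'a \<times> 'b"
  have F: "F \<in> borel_measurable (lborel \<Otimes>\<^sub>M lborel)"
    unfolding F_def[abs_def] by (rule measI) measurable
  have Wm: "W \<in> borel_measurable lborel"
    unfolding W_def[abs_def] using k by simp
  have W: "Lp_norm q (\<lambda>\<zeta>. F (\<zeta>, w)) \<le> W w" for w
  proof -
    have "Lp_norm q (\<lambda>\<zeta>. F (\<zeta>, w)) \<le> k w * Lp_norm q (\<lambda>\<zeta>. H (\<zeta> + snd w))"
      unfolding F_def fst_conv snd_conv by (rule Lp_norm_cmult_le[OF _ q]) measurable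
    also have "\<dots> \<le> W w"
      unfolding W_def using Lp_norm_shift_le[of H q "snd w"] by (intro mult_left_mono) simp_all
    finally show ?thesis .
  qed
  have "mixed_norm p q V' \<le> Lp_norm q (\<lambda>\<zeta>. \<integral>\<^sup>+w. F (\<zeta>, w) \<partial>lborel)"
    using inner Lp_norm_section_measurable[OF V'] by (intro Lp_norm_mono q) (simp_all add: F_def)
  also have "\<dots> \<le> (\<integral>\<^sup>+w. W w \<partial>lborel)"
    by (rule Lp_norm_integral_le[OF F Wm q W])
  also have "\<dots> = (\<integral>\<^sup>+w. k w \<partial>lborel) * Lp_norm q H"
    unfolding W_def by (rule nn_integral_multc[OF k])
  finally show ?thesis by (simp add: H_def[abs_def])
qed

theorem mixed_norm_stft_change_window:
  fixes G G' :: "'a::euclidean_space \<Rightarrow> complex"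
  assumes u: "u \<in> tempered_distributions" and G: "G \<in> schwartz_space" "G \<noteq> (\<lambda>_. 0)"
    and G': "G' \<in> schwartz_space" and p: "1 \<le> p" and q: "1 \<le> q"
    and fin: "mixed_norm p q (\<lambda>w. norm (stft G u (fst w) (snd w))) < \<infinity>"
  shows "mixed_norm p q (\<lambda>w. norm (stft G' u (fst w) (snd w))) < \<infinity>"
proof (rule stft_change_window[OF u G G'])
  fix k :: "'a \<times> 'a \<Rightarrow> real"
  assume k: "integrable lborel k" "\<And>w. k w \<ge> 0"
    "\<And>z \<zeta>. ennreal (norm (stft G' u z \<zeta>)) \<le>
       (\<integral>\<^sup>+w. ennreal (k w) * ennreal (norm (stft G u (z + fst w) (\<zeta> + snd w))) \<partial>lborel)"
  define V V' where "V = (\<lambda>w. norm (stft G u (fst w) (snd w)))" and "V' = (\<lambda>w. norm (stft G' u (fst w) (snd w)))"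
  have "continuous_on UNIV V" "continuous_on UNIV V'"
    unfolding V_def V'_def by (intro continuous_on_norm stft_continuous u G G')+
  moreover have "(\<lambda>w. ennreal (k w)) \<in> borel_measurable lborel"
    using borel_measurable_integrable[OF k(1)] by measurable
  moreover have "ennreal (V' (z, \<zeta>)) \<le> (\<integral>\<^sup>+w. ennreal (k w) * ennreal (V (z + fst w, \<zeta> + snd w)) \<partial>lborel)" for z \<zeta>
    unfolding V_def V'_def fst_conv snd_conv by (rule k(3))
  ultimately have le: "mixed_norm p q V' \<le> (\<integral>\<^sup>+w. ennreal (k w) \<partial>lborel) * mixed_norm p q V"
    by (rule mixed_norm_convolution[OF _ _ _ p q])
  have "(\<integral>\<^sup>+w. ennreal (k w) \<partial>lborel) < \<infinity>"
    using k(1,2) by (simp add: integrable_iff_bounded)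
  moreover have "mixed_norm p q V < \<infinity>" using fin unfolding V_def .
  ultimately have "mixed_norm p q V' < \<infinity>"
    by (intro order_le_less_trans[OF le]) (simp add: ennreal_mult_less_top)
  then show ?thesis unfolding V'_def .
qed

section \<open>The multiplier that shears the partial Fourier transform\<close>

text \<open>
  The Fourier multiplier with symbol \<open>exp (- 2 \<pi> \<i> \<xi> \<bullet> A \<eta>)\<close>.  After the transform in the second variable alone,
  multiplication by this symbol is a translation of the first variable by \<open>A \<eta>\<close>.
\<close>

definition shear_multiplier ::
    "('b \<Rightarrow> 'a) \<Rightarrow> ('a::euclidean_space \<times> 'b::euclidean_space \<Rightarrow> complex) \<Rightarrow> 'a \<times> 'b \<Rightarrow> complex" where
  "shear_multiplier A \<phi> = inv_partial_fourier2 (\<lambda>z. partial_fourier2 \<phi> (fst z - A (snd z), snd z))"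

lemma schwartz_continuous_shear:
  fixes A :: "'b::euclidean_space \<Rightarrow> 'a::euclidean_space"
  assumes A: "linear A"
  shows "schwartz_continuous (\<lambda>\<phi> z. \<phi> (fst z - A (snd z), snd z))"
proof (rule schwartz_continuous_linear)
  show "linear (\<lambda>z. (fst z - A (snd z), snd z))"
    by (intro linearI) (auto simp: linear_add[OF A] linear_scale[OF A] algebra_simps)
  show "inj (\<lambda>z. (fst z - A (snd z), snd z))" by (auto simp: inj_def prod_eq_iff)
qed

lemma schwartz_continuous_shear_multiplier:
  assumes "linear A"
  shows "schwartz_continuous (shear_multiplier A)"
  unfolding shear_multiplier_def[abs_def]
  by (rule schwartz_continuous_comp[OF schwartz_continuous_inv_partial_fourier2
      schwartz_continuous_comp[OF schwartz_continuous_shear[OF assms] schwartz_continuous_partial_fourier2]])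

lemma partial_fourier2_shear_multiplier:
  assumes A: "linear A" and \<phi>: "\<phi> \<in> schwartz_space"
  shows "partial_fourier2 (shear_multiplier A \<phi>) (x, t) = partial_fourier2 \<phi> (x - A t, t)"
proof -
  have "(\<lambda>z. partial_fourier2 \<phi> (fst z - A (snd z), snd z)) \<in> schwartz_space"
    by (rule schwartz_continuous_in[OF schwartz_continuous_comp[OF schwartz_continuous_shear[OF A] schwartz_continuous_partial_fourier2] \<phi>])
  from partial_fourier2_inv_partial_fourier2[OF this] show ?thesis
    by (simp add: shear_multiplier_def)
qed

lemma inv_partial_fourier2_add:
  assumes "\<phi> \<in> schwartz_space" "\<psi> \<in> schwartz_space"
  shows "inv_partial_fourier2 (\<lambda>z. \<phi> z + \<psi> z) = (\<lambda>z. inv_partial_fourier2 \<phi> z + inv_partial_fourier2 \<psi> z)"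
  by (simp add: inv_partial_fourier2_def partial_fourier2_add[OF assms])

lemma inv_partial_fourier2_cmult:
  "inv_partial_fourier2 (\<lambda>z. c * \<phi> z) = (\<lambda>z. c * inv_partial_fourier2 \<phi> z)"
  by (simp add: inv_partial_fourier2_def partial_fourier2_cmult)

lemma shear_multiplier_add:
  assumes A: "linear A" and "\<phi> \<in> schwartz_space" "\<psi> \<in> schwartz_space"
  shows "shear_multiplier A (\<lambda>z. \<phi> z + \<psi> z) = (\<lambda>z. shear_multiplier A \<phi> z + shear_multiplier A \<psi> z)"
  unfolding shear_multiplier_def partial_fourier2_add[OF assms(2,3)]
  by (intro inv_partial_fourier2_add assms(2,3)[THEN schwartz_continuous_in[OF
        schwartz_continuous_comp[OF schwartz_continuous_shear[OF A] schwartz_continuous_partial_fourier2]]])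

lemma shear_multiplier_cmult: "shear_multiplier A (\<lambda>z. c * \<phi> z) = (\<lambda>z. c * shear_multiplier A \<phi> z)"
  unfolding shear_multiplier_def partial_fourier2_cmult by (rule inv_partial_fourier2_cmult)

lemma fourier_cmult: "fourier (\<lambda>z. c * \<phi> z) = (\<lambda>w. c * fourier \<phi> w)"
  by (rule ext) (simp add: fourier_def mult.left_commute[of _ c])

lemma fourier_tf_atom:
  fixes g :: "'a::euclidean_space \<Rightarrow> complex"
  assumes g: "g \<in> schwartz_space"
  shows "fourier (tf_atom z \<zeta> g) w = cis (- (2 * pi * ((w + \<zeta>) \<bullet> z))) * fourier g (w + \<zeta>)"
proof -
  define h where "h t = cis (- (2 * pi * ((w + \<zeta>) \<bullet> t))) * g (t - z)" for t
  from schwartz_modulation[OF schwartz_translate[OF g, of "- z"], of "- (2 * pi) *\<^sub>R (w + \<zeta>)"]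
  have h: "h \<in> schwartz_space" by (simp add: h_def[abs_def] inner_commute)
  have "fourier (tf_atom z \<zeta> g) w = (LINT t|lborel. h t)"
    unfolding fourier_def
  proof (rule Bochner_Integration.integral_cong[OF refl])
    fix t
    have "cis (- (2 * pi * (w \<bullet> t))) * cis (- (2 * pi * (t \<bullet> \<zeta>))) = cis (- (2 * pi * ((w + \<zeta>) \<bullet> t)))"
      by (simp add: cis_mult inner_add_left inner_commute[of t] algebra_simps)
    then show "cis (- (2 * pi * (w \<bullet> t))) * tf_atom z \<zeta> g t = h t"
      unfolding tf_atom_def h_def mult.assoc[symmetric] by simp
  qed
  also have "\<dots> = (LINT t|lborel. h (t + z))"
    by (rule lborel_integral_shift[OF schwartz_borel[OF h], symmetric])
  also have "\<dots> = (LINT t|lborel. cis (- (2 * pi * ((w + \<zeta>) \<bullet> z))) * (cis (- (2 * pi * ((w + \<zeta>) \<bullet> t))) * g t))"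
  proof (rule Bochner_Integration.integral_cong[OF refl])
    fix t
    have "cis (- (2 * pi * ((w + \<zeta>) \<bullet> (t + z)))) = cis (- (2 * pi * ((w + \<zeta>) \<bullet> z))) * cis (- (2 * pi * ((w + \<zeta>) \<bullet> t)))"
      by (simp add: cis_mult inner_add_right algebra_simps)
    then show "h (t + z) = cis (- (2 * pi * ((w + \<zeta>) \<bullet> z))) * (cis (- (2 * pi * ((w + \<zeta>) \<bullet> t))) * g t)"
      by (simp add: h_def)
  qed
  also have "\<dots> = cis (- (2 * pi * ((w + \<zeta>) \<bullet> z))) * fourier g (w + \<zeta>)"
    by (simp add: fourier_def)
  finally show ?thesis .
qed

lemma partial_fourier2_tf_atom:
  assumes g: "g \<in> schwartz_space"
  shows "partial_fourier2 (tf_atom (z1, z2) (\<alpha>, \<beta>) g) (x, \<eta>)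
    = cis (- (2 * pi * (x \<bullet> \<alpha>))) * cis (- (2 * pi * ((\<eta> + \<beta>) \<bullet> z2))) * partial_fourier2 g (x - z1, \<eta> + \<beta>)"
proof -
  have "cis (- (2 * pi * ((x, y) \<bullet> (\<alpha>, \<beta>)))) = cis (- (2 * pi * (x \<bullet> \<alpha>))) * cis (- (2 * pi * (y \<bullet> \<beta>)))" for y
    by (simp add: cis_mult algebra_simps)
  then have "(\<lambda>y. tf_atom (z1, z2) (\<alpha>, \<beta>) g (x, y)) = (\<lambda>y. cis (- (2 * pi * (x \<bullet> \<alpha>))) * tf_atom z2 \<beta> (\<lambda>y. g (x - z1, y)) y)"
    by (simp add: tf_atom_def mult.assoc)
  then have "fourier (\<lambda>y. tf_atom (z1, z2) (\<alpha>, \<beta>) g (x, y)) \<eta>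
    = cis (- (2 * pi * (x \<bullet> \<alpha>))) * fourier (tf_atom z2 \<beta> (\<lambda>y. g (x - z1, y))) \<eta>"
    by (simp only: fourier_cmult)
  then show ?thesis
    unfolding fourier_tf_atom[OF schwartz_section[OF g]] fourier_section by (simp add: mult.assoc)
qed

text \<open>
  A shift of the frequency by \<open>\<zeta>\<close> changes the quadratic symbol by a phase and by a character that is linear in
  the frequency, and multiplication by such a character is a translation.
\<close>

lemma shear_multiplier_tf_atom:
  fixes A :: "'b::euclidean_space \<Rightarrow> 'a::euclidean_space"
  assumes A: "linear A" and g: "g \<in> schwartz_space"
  shows "shear_multiplier A (tf_atom z \<zeta> g) =
    (\<lambda>t. cis (- (2 * pi * (A (snd \<zeta>) \<bullet> fst \<zeta>))) * tf_atom (z - (A (snd \<zeta>), adjoint A (fst \<zeta>))) \<zeta> (shear_multiplier A g) t)"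
proof -
  obtain z1 z2 \<alpha> \<beta> where z: "z = (z1, z2)" "\<zeta> = (\<alpha>, \<beta>)" by (cases z, cases \<zeta>)
  define c where "c = cis (- (2 * pi * (A \<beta> \<bullet> \<alpha>)))"
  let ?g' = "shear_multiplier A g"
  have g': "?g' \<in> schwartz_space" by (rule schwartz_continuous_in[OF schwartz_continuous_shear_multiplier[OF A] g])
  let ?at = "tf_atom (z1 - A \<beta>, z2 - adjoint A \<alpha>) (\<alpha>, \<beta>) ?g'"
  have "partial_fourier2 (tf_atom (z1, z2) (\<alpha>, \<beta>) g) (x - A \<eta>, \<eta>) = c * partial_fourier2 ?at (x, \<eta>)" for x \<eta>
  proof -
    have "cis (- (2 * pi * ((x - A \<eta>) \<bullet> \<alpha>))) * cis (- (2 * pi * ((\<eta> + \<beta>) \<bullet> z2)))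
      = c * (cis (- (2 * pi * (x \<bullet> \<alpha>))) * cis (- (2 * pi * ((\<eta> + \<beta>) \<bullet> (z2 - adjoint A \<alpha>)))))"
      unfolding c_def
      by (simp add: cis_mult inner_diff_left inner_diff_right inner_add_left adjoint_works[OF A] linear_add[OF A] algebra_simps)
    moreover have "x - (z1 - A \<beta>) - A (\<eta> + \<beta>) = x - A \<eta> - z1" by (simp add: linear_add[OF A])
    ultimately show ?thesis
      unfolding partial_fourier2_tf_atom[OF g] partial_fourier2_tf_atom[OF g'] partial_fourier2_shear_multiplier[OF A g]
      by (simp only: mult.assoc)
  qed
  note shear = this
  have "(\<lambda>w. partial_fourier2 (tf_atom z \<zeta> g) (fst w - A (snd w), snd w)) = (\<lambda>w. c * partial_fourier2 ?at w)"
  proof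
    fix w
    show "partial_fourier2 (tf_atom z \<zeta> g) (fst w - A (snd w), snd w) = c * partial_fourier2 ?at w"
      using shear[of "fst w" "snd w"] by (simp add: z)
  qed
  then have "shear_multiplier A (tf_atom z \<zeta> g) = inv_partial_fourier2 (\<lambda>w. c * partial_fourier2 ?at w)"
    unfolding shear_multiplier_def[of A "tf_atom z \<zeta> g"] by (simp only:)
  also have "\<dots> = (\<lambda>t. c * ?at t)"
    by (simp add: inv_partial_fourier2_cmult inv_partial_fourier2_partial_fourier2[OF schwartz_tf_atom[OF g']])
  finally show ?thesis by (simp add: z c_def)
qed

text \<open>
  The short-time Fourier transform of \<open>v\<close> is that of \<open>u\<close> for the window \<open>G'\<close>, with \<open>z\<close> translated by an amount that
  depends on \<open>\<zeta>\<close> only; the inner norm is insensitive to this translation.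
\<close>

theorem modulation_space_shear_multiplier:
  fixes A :: "'a::euclidean_space \<Rightarrow> 'a" and G :: "'a \<times> 'a \<Rightarrow> complex"
  assumes A: "linear A" and G: "G \<in> schwartz_space" "G \<noteq> (\<lambda>_. 0)" and p: "1 \<le> p" and q: "1 \<le> q"
    and u: "u \<in> modulation_space G p q"
    and v: "\<And>\<phi>. \<phi> \<in> schwartz_space \<Longrightarrow> v \<phi> = u (shear_multiplier A \<phi>)"
  shows "v \<in> modulation_space G p q"
proof -
  have ut: "u \<in> tempered_distributions" using u by (simp add: modulation_space_def)
  have vt: "v \<in> tempered_distributions"
    by (rule tempered_comp[OF ut schwartz_continuous_shear_multiplier[OF A] shear_multiplier_add[OF A] shear_multiplier_cmult v])
  define g where "g = (\<lambda>t. cnj (G t))"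
  have g: "g \<in> schwartz_space" unfolding g_def by (rule schwartz_cnj[OF G(1)])
  have g': "shear_multiplier A g \<in> schwartz_space"
    by (rule schwartz_continuous_in[OF schwartz_continuous_shear_multiplier[OF A] g])
  define G' where "G' = (\<lambda>t. cnj (shear_multiplier A g t))"
  have G': "G' \<in> schwartz_space" unfolding G'_def by (rule schwartz_cnj[OF g'])
  define V V' where "V = (\<lambda>w. norm (stft G v (fst w) (snd w)))" and "V' = (\<lambda>w. norm (stft G' u (fst w) (snd w)))"
  have cont: "continuous_on UNIV V" "continuous_on UNIV V'"
    unfolding V_def V'_def by (intro continuous_on_norm stft_continuous ut vt G G')+
  have "stft G v z \<zeta> = cis (- (2 * pi * (A (snd \<zeta>) \<bullet> fst \<zeta>))) * stft G' u (z - (A (snd \<zeta>), adjoint A (fst \<zeta>))) \<zeta>" for z \<zeta>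
    unfolding stft_eq_tf_atom
    by (simp add: g_def[symmetric] G'_def v schwartz_tf_atom g shear_multiplier_tf_atom[OF A g] tempered_cmult[OF ut schwartz_tf_atom[OF g']])
  then have V: "V (z, \<zeta>) = V' (z + - (A (snd \<zeta>), adjoint A (fst \<zeta>)), \<zeta>)" for z \<zeta>
    unfolding V_def V'_def fst_conv snd_conv diff_conv_add_uminus by (simp only: norm_mult norm_cis mult_1)
  have "Lp_norm p (\<lambda>z. ennreal (V (z, \<zeta>))) \<le> Lp_norm p (\<lambda>z. ennreal (V' (z, \<zeta>)))" for \<zeta>
    unfolding V
    by (rule Lp_norm_shift_le)
      (intro borel_measurable_continuous_onI continuous_on_ennreal continuous_on_compose2[OF cont(2)] continuous_intros, auto)
  then have "mixed_norm p q V \<le> mixed_norm p q V'"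
    by (rule Lp_norm_mono[OF _ _ q, rotated]) (use Lp_norm_section_measurable[OF cont(1)] in simp)
  also have "\<dots> < \<infinity>"
    unfolding V'_def using u
    by (intro mixed_norm_stft_change_window[OF ut G G' p q]) (simp add: modulation_space_def)
  finally show ?thesis using vt by (simp add: modulation_space_def V_def)
qed

section \<open>The multiplier distribution\<close>

definition swap_args :: "('a \<times> 'b \<Rightarrow> complex) \<Rightarrow> 'b \<times> 'a \<Rightarrow> complex" where
  "swap_args \<phi> = (\<lambda>z. \<phi> (snd z, fst z))"

lemma schwartz_continuous_swap_args:
  "schwartz_continuous (swap_args :: ('a::euclidean_space \<times> 'b::euclidean_space \<Rightarrow> complex) \<Rightarrow> _)"
  unfolding swap_args_def[abs_def]
proof (rule schwartz_continuous_linear)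
  show "linear (\<lambda>z::'b \<times> 'a. (snd z, fst z))" by (intro linearI) auto
  show "inj (\<lambda>z::'b \<times> 'a. (snd z, fst z))" by (auto simp: inj_def prod_eq_iff)
qed

text \<open>
  The full transform is obtained one variable at a time and inherits continuity from the partial one.
\<close>

lemma fourier_eq_partial_fourier2:
  fixes \<phi> :: "'a::euclidean_space \<times> 'b::euclidean_space \<Rightarrow> complex"
  assumes \<phi>: "\<phi> \<in> schwartz_space"
  shows "fourier \<phi> = swap_args (partial_fourier2 (swap_args (partial_fourier2 \<phi>)))"
proof
  fix w :: "'a \<times> 'b"
  obtain \<xi> \<eta> where w: "w = (\<xi>, \<eta>)" by (cases w)
  define h where "h z = cis (- (2 * pi * (w \<bullet> z))) * \<phi> z" for z
  have h: "h \<in> schwartz_space"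
    using schwartz_modulation[OF \<phi>, of "- (2 * pi) *\<^sub>R w"] by (simp add: h_def[abs_def] inner_commute[of _ w])
  have int: "integrable (lborel \<Otimes>\<^sub>M lborel) h"
    unfolding lborel_prod by (rule schwartz_integrable[OF h])
  have "fourier \<phi> w = integral\<^sup>L (lborel \<Otimes>\<^sub>M lborel) h"
    unfolding lborel_prod fourier_def h_def[abs_def] by (rule refl)
  also have "\<dots> = (LINT x|lborel. LINT y|lborel. h (x, y))"
    by (rule lborel_pair.integral_fst'[OF int, symmetric])
  also have "\<dots> = (LINT x|lborel. cis (- (2 * pi * (\<xi> \<bullet> x))) * partial_fourier2 \<phi> (x, \<eta>))"
  proof (rule Bochner_Integration.integral_cong[OF refl])
    fix x
    have "(LINT y|lborel. h (x, y)) = (LINT y|lborel. cis (- (2 * pi * (\<xi> \<bullet> x))) * (cis (- (2 * pi * (\<eta> \<bullet> y))) * \<phi> (x, y)))"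
    proof (rule Bochner_Integration.integral_cong[OF refl])
      fix y
      have "cis (- (2 * pi * (w \<bullet> (x, y)))) = cis (- (2 * pi * (\<xi> \<bullet> x))) * cis (- (2 * pi * (\<eta> \<bullet> y)))"
        by (simp add: w cis_mult algebra_simps)
      then show "h (x, y) = cis (- (2 * pi * (\<xi> \<bullet> x))) * (cis (- (2 * pi * (\<eta> \<bullet> y))) * \<phi> (x, y))"
        by (simp add: h_def)
    qed
    then show "(LINT y|lborel. h (x, y)) = cis (- (2 * pi * (\<xi> \<bullet> x))) * partial_fourier2 \<phi> (x, \<eta>)"
      by (simp add: partial_fourier2_apply)
  qed
  finally show "fourier \<phi> w = swap_args (partial_fourier2 (swap_args (partial_fourier2 \<phi>))) w"
    by (simp add: w swap_args_def partial_fourier2_apply[of "\<lambda>z. partial_fourier2 \<phi> (snd z, fst z)"])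
qed

lemma schwartz_continuous_fourier:
  "schwartz_continuous (fourier :: ('a::euclidean_space \<times> 'b::euclidean_space \<Rightarrow> complex) \<Rightarrow> _)"
proof (rule schwartz_continuous_cong[OF _ fourier_eq_partial_fourier2])
  show "schwartz_continuous (\<lambda>\<phi> :: 'a \<times> 'b \<Rightarrow> complex. swap_args (partial_fourier2 (swap_args (partial_fourier2 \<phi>))))"
    by (intro schwartz_continuous_comp[OF schwartz_continuous_swap_args] schwartz_continuous_comp[OF schwartz_continuous_partial_fourier2]
        schwartz_continuous_partial_fourier2)
qed

lemma fourier_add:
  fixes \<phi> \<psi> :: "'a::euclidean_space \<Rightarrow> complex"
  assumes "\<phi> \<in> schwartz_space" "\<psi> \<in> schwartz_space"
  shows "fourier (\<lambda>z. \<phi> z + \<psi> z) = (\<lambda>w. fourier \<phi> w + fourier \<psi> w)"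
proof
  fix w :: 'a
  have "integrable lborel (\<lambda>z. cis (- (2 * pi * (w \<bullet> z))) * \<phi> z)" if "\<phi> \<in> schwartz_space" for \<phi>
    using schwartz_integrable[OF schwartz_modulation[OF that, of "- (2 * pi) *\<^sub>R w"]] by (simp add: inner_commute)
  from this[OF assms(1)] this[OF assms(2)] show "fourier (\<lambda>z. \<phi> z + \<psi> z) w = fourier \<phi> w + fourier \<psi> w"
    by (simp add: fourier_def distrib_left)
qed

lemma tempered_bounded_function:
  fixes F :: "'a::euclidean_space \<Rightarrow> complex"
  assumes F [measurable]: "F \<in> borel_measurable borel" and bd: "\<And>x. norm (F x) \<le> 1"
  shows "distr_of_fun F \<in> tempered_distributions"
proof -
  let ?m = "2 * DIM('a)"
  let ?I = "LINT x|lborel. inverse ((1 + norm (x::'a)) ^ ?m)"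
  have int: "integrable lborel (\<lambda>x. F x * \<phi> x)" if "\<phi> \<in> schwartz_space" for \<phi>
  proof (rule Bochner_Integration.integrable_bound[OF schwartz_integrable[OF that]])
    show "(\<lambda>x. F x * \<phi> x) \<in> borel_measurable lborel" using schwartz_borel[OF that] by simp
    show "AE x in lborel. norm (F x * \<phi> x) \<le> norm (\<phi> x)"
      using bd by (intro AE_I2) (simp add: norm_mult mult_left_le_one_le)
  qed
  obtain C N where C: "C \<ge> 0" "\<And>\<phi> x. (\<phi> :: 'a \<Rightarrow> complex) \<in> schwartz_space \<Longrightarrow> (1 + norm x) ^ ?m * norm (\<phi> x) \<le> C * schwartz_seminorm N \<phi>"
    using schwartz_boundedE[OF schwartz_bounded_decay0[of ?m]] by metis
  have "norm (distr_of_fun F \<phi>) \<le> (?I * C) * schwartz_seminorm N \<phi>" if \<phi>: "\<phi> \<in> schwartz_space" for \<phi>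
  proof -
    have "norm (distr_of_fun F \<phi>) \<le> (LINT x|lborel. norm (F x * \<phi> x))"
      unfolding distr_of_fun_def by (rule integral_norm_bound)
    also have "\<dots> \<le> (LINT x|lborel. C * schwartz_seminorm N \<phi> * inverse ((1 + norm (x::'a)) ^ ?m))"
    proof (intro integral_mono integrable_norm int \<phi> integrable_mult_right integrable_polynomial_decay)
      fix x :: 'a
      have "norm (F x * \<phi> x) \<le> norm (\<phi> x)" using bd by (simp add: norm_mult mult_left_le_one_le)
      also have "\<dots> \<le> C * schwartz_seminorm N \<phi> * inverse ((1 + norm x) ^ ?m)"
        using C(2)[OF \<phi>, of x] by (simp add: field_simps add_pos_nonneg)
      finally show "norm (F x * \<phi> x) \<le> C * schwartz_seminorm N \<phi> * inverse ((1 + norm x) ^ ?m)" .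
    qed
    finally show ?thesis by (simp add: mult_ac)
  qed
  moreover have "distr_of_fun F (\<lambda>x. \<phi> x + \<psi> x) = distr_of_fun F \<phi> + distr_of_fun F \<psi>"
    if "\<phi> \<in> schwartz_space" "\<psi> \<in> schwartz_space" for \<phi> \<psi>
    using int[OF that(1)] int[OF that(2)] by (simp add: distr_of_fun_def distrib_left)
  moreover have "distr_of_fun F (\<lambda>x. c * \<phi> x) = c * distr_of_fun F \<phi>" for c \<phi>
    by (simp add: distr_of_fun_def mult.left_commute[of _ c])
  ultimately show ?thesis
    unfolding tempered_distributions_def by (intro CollectI conjI ballI allI exI[of _ "?I * C"] exI[of _ N]) simp_all
qed

text \<open>
  An injective linear map of the space into itself is surjective, so \<open>c\<close> can be absorbed into a translation of \<open>x\<close>.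
\<close>

lemma nn_integral_schwartz_affine:
  fixes \<Lambda> :: "'a::euclidean_space \<Rightarrow> 'a"
  assumes Q: "Q \<in> schwartz_space" and \<Lambda>: "linear \<Lambda>" "inj \<Lambda>"
  shows "\<exists>I. I < \<infinity> \<and> (\<forall>c. (\<integral>\<^sup>+x. ennreal (norm (Q (\<Lambda> x + c))) \<partial>lborel) = I)"
proof (intro exI conjI allI)
  have S: "(\<lambda>x. Q (\<Lambda> x)) \<in> schwartz_space" by (rule schwartz_linear[OF Q \<Lambda>])
  show "(\<integral>\<^sup>+x. ennreal (norm (Q (\<Lambda> x))) \<partial>lborel) < \<infinity>"
    using schwartz_integrable[OF S] by (simp add: integrable_iff_bounded)
  fix c
  obtain d where d: "c = \<Lambda> d" using linear_inj_imp_surj[OF \<Lambda>] by (metis surjD)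
  have "(\<integral>\<^sup>+x. ennreal (norm (Q (\<Lambda> x + c))) \<partial>lborel) = (\<integral>\<^sup>+x. ennreal (norm (Q (\<Lambda> (x + d)))) \<partial>lborel)"
    by (simp add: d linear_add[OF \<Lambda>(1)])
  also have "\<dots> = (\<integral>\<^sup>+x. ennreal (norm (Q (\<Lambda> x))) \<partial>lborel)"
    by (rule lborel_nn_integral_shift[where f="\<lambda>x. ennreal (norm (Q (\<Lambda> x)))"])
      (use schwartz_borel[OF S] in measurable)
  finally show "(\<integral>\<^sup>+x. ennreal (norm (Q (\<Lambda> x + c))) \<partial>lborel) = (\<integral>\<^sup>+x. ennreal (norm (Q (\<Lambda> x))) \<partial>lborel)" .
qed

lemma chi_eq: "chi M z = cis (2 * pi * (snd z \<bullet> (M *v fst z)))"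
  by (simp add: chi_def case_prod_unfold)

lemma chi_phase_has_derivative:
  fixes M :: "real^'d^'d"
  shows "((\<lambda>z. 2 * pi * (snd z \<bullet> (M *v fst z))) has_derivative
    (\<lambda>v. 2 * pi * (snd z \<bullet> (M *v fst v) + snd v \<bullet> (M *v fst z)))) (at z)"
proof -
  have "bounded_linear ((*v) M)" by (rule matrix_vector_mul_bounded_linear)
  from bounded_linear.has_derivative[OF this has_derivative_fst[OF has_derivative_ident]]
  have "((\<lambda>z. M *v fst z) has_derivative (\<lambda>v. M *v fst v)) (at z)" .
  from has_derivative_mult_right[OF has_derivative_inner[OF has_derivative_snd[OF has_derivative_ident] this]]
  show ?thesis by simp
qed

lemma inner_adjoint_mult: "y \<bullet> (M *v x) = x \<bullet> (transpose M *v y)" for x y :: "real^'d"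
  by (metis dot_lmul_matrix inner_commute transpose_matrix_vector)

lemma schwartz_chi:
  fixes M :: "real^'d^'d"
  assumes "\<phi> \<in> schwartz_space"
  shows "(\<lambda>z. chi M z * \<phi> z) \<in> schwartz_space"
  unfolding chi_eq
proof (rule schwartz_chirp[OF assms chi_phase_has_derivative])
  fix \<psi> :: "(real^'d) \<times> (real^'d) \<Rightarrow> complex" and b :: "(real^'d) \<times> (real^'d)"
  assume "\<psi> \<in> schwartz_space"
  from schwartz_cmult[OF schwartz_mult_inner[OF this, of "(transpose M *v snd b, M *v fst b)"], of "2 * pi"]
  show "(\<lambda>z. complex_of_real (2 * pi * (snd z \<bullet> (M *v fst b) + snd b \<bullet> (M *v fst z))) * \<psi> z) \<in> schwartz_space"
    by (simp add: inner_prod_def inner_adjoint_mult[of "snd b"] algebra_simps)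
qed

text \<open>
  Polarisation of the quadratic phase.
\<close>

lemma chi_diff:
  "chi M (w - s) = chi M s * cis (- (2 * pi * (w \<bullet> (transpose M *v snd s, M *v fst s)))) * chi M w"
proof -
  have "(snd w - snd s) \<bullet> (M *v (fst w - fst s))
    = snd s \<bullet> (M *v fst s) - w \<bullet> (transpose M *v snd s, M *v fst s) + snd w \<bullet> (M *v fst w)"
    by (simp add: inner_prod_def inner_diff_left inner_diff_right matrix_vector_mult_diff_distrib inner_adjoint_mult[of "snd s" M "fst w"])
  then show ?thesis by (simp add: chi_eq cis_mult algebra_simps)
qed

lemma chi_measurable: "chi M \<in> borel_measurable borel"
proof -
  have "continuous_on UNIV (\<lambda>z. 2 * pi * (snd z \<bullet> (M *v fst z)))"
    by (rule has_derivative_continuous_on[OF has_derivative_at_withinI[OF chi_phase_has_derivative]])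
  then have "continuous_on UNIV (\<lambda>z. chi M z)" unfolding chi_eq by (rule continuous_on_cis)
  then show ?thesis by (rule borel_measurable_continuous_onI)
qed

text \<open>
  The substitution of test functions that makes the Fourier transform symplectic.
\<close>

definition quarter_turn :: "('a \<times> 'a \<Rightarrow> complex) \<Rightarrow> 'a \<times> 'a::uminus \<Rightarrow> complex" where
  "quarter_turn \<phi> = (\<lambda>z. \<phi> (- snd z, fst z))"

lemma schwartz_continuous_quarter_turn:
  "schwartz_continuous (quarter_turn :: ('a::euclidean_space \<times> 'a \<Rightarrow> complex) \<Rightarrow> _)"
  unfolding quarter_turn_def[abs_def]
proof (rule schwartz_continuous_linear)
  show "linear (\<lambda>z::'a \<times> 'a. (- snd z, fst z))" by (intro linearI) auto
  show "inj (\<lambda>z::'a \<times> 'a. (- snd z, fst z))" by (auto simp: inj_def prod_eq_iff)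
qed

lemma theta_apply: "theta M \<phi> = distr_of_fun (chi M) (fourier (quarter_turn \<phi>))"
  by (simp add: theta_def distr_symplectic_fourier_def distr_fourier_def quarter_turn_def case_prod_unfold)

lemma theta_tempered: "theta M \<in> tempered_distributions"
proof (rule tempered_comp[where T = "\<lambda>\<phi>. fourier (quarter_turn \<phi>)", OF tempered_bounded_function[OF chi_measurable[of M]] _ _ _ theta_apply])
  show "norm (chi M z) \<le> 1" for z by (simp add: chi_eq)
  show "schwartz_continuous (\<lambda>\<phi> :: (real^'a) \<times> (real^'a) \<Rightarrow> complex. fourier (quarter_turn \<phi>))"
    by (rule schwartz_continuous_comp[OF schwartz_continuous_fourier schwartz_continuous_quarter_turn])
  show "fourier (quarter_turn (\<lambda>x. \<phi> x + \<psi> x)) = (\<lambda>x. fourier (quarter_turn \<phi>) x + fourier (quarter_turn \<psi>) x)"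
    if "\<phi> \<in> schwartz_space" "\<psi> \<in> schwartz_space" for \<phi> \<psi> :: "(real^'a) \<times> (real^'a) \<Rightarrow> complex"
    using fourier_add[OF that[THEN schwartz_continuous_in[OF schwartz_continuous_quarter_turn]]]
    by (simp add: quarter_turn_def)
  show "fourier (quarter_turn (\<lambda>x. c * \<phi> x)) = (\<lambda>x. c * fourier (quarter_turn \<phi>) x)"
    for c and \<phi> :: "(real^'a) \<times> (real^'a) \<Rightarrow> complex"
    using fourier_cmult[of c "quarter_turn \<phi>"] by (simp add: quarter_turn_def)
qed

lemma quarter_turn_tf_atom:
  "quarter_turn (tf_atom z \<zeta> g) = tf_atom (snd z, - fst z) (snd \<zeta>, - fst \<zeta>) (quarter_turn g)"
  by (cases z, cases \<zeta>) (auto simp: quarter_turn_def tf_atom_def inner_prod_def fun_eq_iff algebra_simps minus_diff_commute)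

text \<open>
  The Fourier transform turns the atom into an atom whose position and frequency have exchanged roles.
  Translating the integration variable and polarising \<open>\<chi>\<^sub>M\<close> collects all dependence on \<open>(z, \<zeta>)\<close> in a phase and in
  the frequency at which a fixed Schwartz function is transformed.
\<close>

lemma norm_stft_theta:
  fixes M :: "real^'d^'d"
  assumes G: "G \<in> schwartz_space"
  shows "\<exists>Q :: (real^'d) \<times> (real^'d) \<Rightarrow> complex. Q \<in> schwartz_space \<and> (\<forall>z \<zeta>. norm (stft G (theta M) z \<zeta>) =
       norm (Q ((snd z, - fst z) + (transpose M *v (- fst \<zeta>), M *v snd \<zeta>))))"
proof -
  define g where "g = quarter_turn (\<lambda>t. cnj (G t))"
  have g: "g \<in> schwartz_space"
    unfolding g_def by (intro schwartz_continuous_in[OF schwartz_continuous_quarter_turn] schwartz_cnj G)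
  define Q0 where "Q0 = (\<lambda>w. chi M w * fourier g w)"
  have Q0: "Q0 \<in> schwartz_space"
    unfolding Q0_def by (intro schwartz_chi schwartz_continuous_in[OF schwartz_continuous_fourier g])
  show ?thesis
  proof (intro exI[of _ "fourier Q0"] conjI allI)
    show "fourier Q0 \<in> schwartz_space" by (rule schwartz_continuous_in[OF schwartz_continuous_fourier Q0])
    fix z \<zeta> :: "(real^'d) \<times> (real^'d)"
    define z' where "z' = (snd z, - fst z)"
    define s where "s = (snd \<zeta>, - fst \<zeta>)"
    define c where "c = z' + (transpose M *v snd s, M *v fst s)"
    define k where "k w = chi M s * (cis (- (2 * pi * (c \<bullet> w))) * Q0 w)" for w
    have k_eq: "k w = chi M (w - s) * (cis (- (2 * pi * (w \<bullet> z'))) * fourier g w)" for w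
    proof -
      have "cis (- (2 * pi * (c \<bullet> w))) = cis (- (2 * pi * (w \<bullet> (transpose M *v snd s, M *v fst s)))) * cis (- (2 * pi * (w \<bullet> z')))"
        by (simp add: c_def cis_mult inner_add_left inner_commute[of w] algebra_simps)
      then show ?thesis
        unfolding k_def chi_diff Q0_def by (simp only: mult_ac)
    qed
    have k: "k \<in> borel_measurable borel"
      using schwartz_borel[OF schwartz_cmult[OF schwartz_modulation[OF Q0, of "- (2 * pi) *\<^sub>R c"], of "chi M s"]]
      by (simp add: k_def[abs_def] inner_commute)
    have "stft G (theta M) z \<zeta> = (LINT w|lborel. chi M w * (cis (- (2 * pi * ((w + s) \<bullet> z'))) * fourier g (w + s)))"
      unfolding stft_eq_tf_atom theta_apply quarter_turn_tf_atom g_def[symmetric] distr_of_fun_def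
      by (simp add: fourier_tf_atom[OF g] z'_def s_def)
    also have "\<dots> = (LINT w|lborel. k (w + s))" by (simp add: k_eq)
    also have "\<dots> = (LINT w|lborel. k w)" by (rule lborel_integral_shift[OF k])
    also have "\<dots> = chi M s * fourier Q0 c" by (simp add: k_def fourier_def)
    finally have "norm (stft G (theta M) z \<zeta>) = norm (fourier Q0 c)" by (simp add: norm_mult chi_eq)
    then show "norm (stft G (theta M) z \<zeta>) = norm (fourier Q0 ((snd z, - fst z) + (transpose M *v (- fst \<zeta>), M *v snd \<zeta>)))"
      by (simp add: c_def z'_def s_def)
  qed
qed

lemma Lp_norm_1: "Lp_norm 1 h = (\<integral>\<^sup>+x. h x \<partial>lborel)"
  by (simp add: Lp_norm_def)

lemma Lp_norm_infinity_const_le: "Lp_norm \<infinity> (\<lambda>x. c) \<le> c"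
  by (auto simp: Lp_norm_def intro!: esssup_I)

text \<open>
  Both inner integrals are constant in the outer variable.  Invertibility of \<open>M\<close> makes \<open>?\<Lambda>2\<close> injective, which is
  what the integral over \<open>\<zeta>\<close> needs.
\<close>

theorem theta_in_modulation_space_and_wiener_amalgam:
  fixes M :: "real^'d^'d"
  assumes M: "invertible M" and G: "G \<in> schwartz_space"
  shows "theta M \<in> modulation_space G 1 \<infinity> \<inter> wiener_amalgam G 1 \<infinity>"
proof -
  from norm_stft_theta[OF G, of M]
  obtain Q :: "(real^'d) \<times> (real^'d) \<Rightarrow> complex" where "Q \<in> schwartz_space \<and> (\<forall>z \<zeta>. norm (stft G (theta M) z \<zeta>) =
       norm (Q ((snd z, - fst z) + (transpose M *v (- fst \<zeta>), M *v snd \<zeta>))))" ..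
  note Q = this[THEN conjunct1] and st = this[THEN conjunct2, rule_format]
  let ?\<Lambda>1 = "\<lambda>z :: (real^'d) \<times> (real^'d). (snd z, - fst z)"
  let ?\<Lambda>2 = "\<lambda>\<zeta> :: (real^'d) \<times> (real^'d). (transpose M *v (- fst \<zeta>), M *v snd \<zeta>)"
  have \<Lambda>1: "linear ?\<Lambda>1" "inj ?\<Lambda>1"
    by (intro linearI; auto) (auto simp: inj_def prod_eq_iff)
  note lin = matrix_vector_mul_linear[of M] matrix_vector_mul_linear[of "transpose M"]
  have \<Lambda>2: "linear ?\<Lambda>2"
    by (intro linearI) (auto simp: lin[THEN linear_add] lin[THEN linear_diff] lin[THEN linear_neg] lin[THEN linear_scale]
        simp del: transpose_matrix_vector)
  have inj: "inj ((*v) M)" "inj ((*v) (transpose M))"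
    by (rule inj_matrix_vector_mult[OF M], rule inj_matrix_vector_mult[OF transpose_invertible[OF M]])
  have inj2: "inj ?\<Lambda>2"
  proof (rule injI)
    fix x y assume "?\<Lambda>2 x = ?\<Lambda>2 y"
    then have "transpose M *v (- fst x) = transpose M *v (- fst y)" "M *v snd x = M *v snd y"
      by (simp_all only: prod.inject)
    from injD[OF inj(2) this(1)] injD[OF inj(1) this(2)] show "x = y" by (simp add: prod_eq_iff)
  qed
  from nn_integral_schwartz_affine[OF Q \<Lambda>1]
  obtain I where "I < \<infinity> \<and> (\<forall>c. (\<integral>\<^sup>+z. ennreal (norm (Q (?\<Lambda>1 z + c))) \<partial>lborel) = I)" ..
  note I = this[THEN conjunct1] this[THEN conjunct2, rule_format]
  have "(\<lambda>\<zeta>. Lp_norm 1 (\<lambda>z. ennreal (norm (stft G (theta M) z \<zeta>)))) = (\<lambda>\<zeta>. I)"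
    unfolding st Lp_norm_1 I(2) ..
  then have 1: "theta M \<in> modulation_space G 1 \<infinity>"
    using I(1) Lp_norm_infinity_const_le[of I] theta_tempered
    by (auto simp: modulation_space_def intro: order_le_less_trans)
  from nn_integral_schwartz_affine[OF Q \<Lambda>2 inj2]
  obtain J where "J < \<infinity> \<and> (\<forall>c. (\<integral>\<^sup>+\<zeta>. ennreal (norm (Q (?\<Lambda>2 \<zeta> + c))) \<partial>lborel) = J)" ..
  note J = this[THEN conjunct1] this[THEN conjunct2, rule_format]
  have "(\<lambda>z. Lp_norm 1 (\<lambda>\<zeta>. ennreal (norm (stft G (theta M) z \<zeta>)))) = (\<lambda>z. J)"
    unfolding st Lp_norm_1 add.commute[of "(snd _, - fst _)"] J(2) ..
  then have 2: "theta M \<in> wiener_amalgam G 1 \<infinity>"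
    using J(1) Lp_norm_infinity_const_le[of J] theta_tempered
    by (auto simp: wiener_amalgam_def intro: order_le_less_trans)
  from 1 2 show ?thesis by simp
qed

section \<open>Comparison of the distributions for different matrices\<close>

lemma matrix_vector_mult_uminus: "(- A) *v x = - (A *v x)" for A :: "real^'n^'m"
  using matrix_vector_mult_diff_rdistrib[of 0 A x] by simp

lemma matrix_inv_eqI:
  fixes A B :: "real^'n^'n"
  assumes "A ** B = mat 1"
  shows "matrix_inv A = B"
proof -
  have "A ** B = mat 1 \<and> B ** A = mat 1"
    using assms matrix_left_right_inverse[of A B] by simp
  then have "matrix_inv A ** A = mat 1"
    unfolding matrix_inv_def by (rule someI2) simp
  then have "B = matrix_inv A ** (A ** B)" by (simp add: matrix_mul_assoc)
  then show ?thesis using assms by simp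
qed

lemma vec_join_split [simp]: "vec_join (vec_split v) = v"
  by (auto simp: vec_join_def vec_split_def vec_eq_iff split: sum.split)

lemma vec_split_join [simp]: "vec_split (vec_join z) = z"
  by (auto simp: vec_join_def vec_split_def prod_eq_iff vec_eq_iff)

lemma mat_apply_mult: "mat_apply (A ** B) z = mat_apply A (mat_apply B z)"
  by (simp add: mat_apply_def matrix_vector_mul_assoc)

lemma mat_apply_id: "mat_apply (mat 1) z = z"
  by (simp add: mat_apply_def)

lemma mat_apply_eqI:
  assumes "\<And>x y. mat_apply A (x, y) = mat_apply B (x, y)"
  shows "A = B"
proof -
  have "A *v v = B *v v" for v
  proof -
    obtain x y where xy: "vec_split v = (x, y)" by (cases "vec_split v")
    have "vec_split (A *v v) = vec_split (B *v v)"
      using assms[of x y] by (simp add: mat_apply_def flip: xy)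
    then show ?thesis by (metis vec_join_split)
  qed
  then show ?thesis by (simp add: matrix_eq)
qed

definition shear_matrix :: "real^'d^'d \<Rightarrow> real^('d + 'd)^('d + 'd)" where
  "shear_matrix M = block_matrix (mat 1) M 0 (mat 1)"

lemma mat_apply_shear_matrix: "mat_apply (shear_matrix M) (x, y) = (x + M *v y, y)"
  by (simp add: shear_matrix_def mat_apply_block_matrix)

text \<open>
  Conjugation by the scaling of the first block by two turns the shear into its square, so its
  determinant \<open>\<delta>\<close> satisfies \<open>\<delta> = \<delta>\<^sup>2\<close>, and it is not zero.
\<close>

lemma det_shear_matrix: "det (shear_matrix M) = 1"
proof -
  let ?S = "shear_matrix M"
  define D where "D = block_matrix (2 *\<^sub>R mat 1) 0 0 (mat 1 :: real^'a^'a)"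
  define E where "E = block_matrix ((1/2) *\<^sub>R mat 1) 0 0 (mat 1 :: real^'a^'a)"
  have D: "mat_apply D (x, y) = (2 *\<^sub>R x, y)" for x y
    by (simp add: D_def mat_apply_block_matrix flip: scaleR_matrix_vector_assoc)
  have E: "mat_apply E (x, y) = ((1/2) *\<^sub>R x, y)" for x y
    by (simp add: E_def mat_apply_block_matrix flip: scaleR_matrix_vector_assoc)
  have "D ** E = mat 1"
    by (rule mat_apply_eqI) (simp add: mat_apply_mult mat_apply_id D E)
  then have "det D * det E = 1" by (metis det_mul det_I)
  then have D0: "det D \<noteq> 0" by auto
  have "?S ** shear_matrix (- M) = mat 1"
    by (rule mat_apply_eqI) (simp add: mat_apply_mult mat_apply_id mat_apply_shear_matrix matrix_vector_mult_uminus)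
  then have "det ?S * det (shear_matrix (- M)) = 1" by (metis det_mul det_I)
  then have S0: "det ?S \<noteq> 0" by auto
  have "D ** ?S = ?S ** (?S ** D)"
    by (rule mat_apply_eqI) (simp add: mat_apply_mult mat_apply_shear_matrix D algebra_simps scaleR_2)
  then have "det D * det ?S = det ?S * (det ?S * det D)" by (metis det_mul)
  then show ?thesis using D0 S0 by simp
qed

lemma mat_apply_A_mat:
  "mat_apply (A_mat M) (x, y) = (x + M *v y + (1/2) *\<^sub>R y, x + M *v y - (1/2) *\<^sub>R y)"
  by (simp add: A_mat_def mat_apply_block_matrix matrix_vector_mult_add_rdistrib matrix_vector_mult_diff_rdistrib
      flip: scaleR_matrix_vector_assoc)

lemma A_mat_eq: "A_mat M = A_mat 0 ** shear_matrix M"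
  by (rule mat_apply_eqI) (simp add: mat_apply_mult mat_apply_shear_matrix mat_apply_A_mat)

lemma det_A_mat: "det (A_mat M) = det (A_mat (0 :: real^'d^'d))" for M :: "real^'d^'d"
  unfolding A_mat_eq[of M] by (simp add: det_mul det_shear_matrix)

lemma mat_apply_matrix_inv_A_mat:
  "mat_apply (matrix_inv (A_mat M)) (u, v) = ((1/2) *\<^sub>R (u + v) - M *v (u - v), u - v)"
proof -
  define B where "B = block_matrix ((1/2) *\<^sub>R mat 1 - M) ((1/2) *\<^sub>R mat 1 + M) (mat 1) (- mat 1)"
  have B: "mat_apply B (u, v) = ((1/2) *\<^sub>R (u + v) - M *v (u - v), u - v)" for u v
    by (simp add: B_def mat_apply_block_matrix matrix_vector_mult_add_rdistrib matrix_vector_mult_diff_rdistrib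
        matrix_vector_mult_uminus matrix_vector_mult_diff_distrib algebra_simps flip: scaleR_matrix_vector_assoc)
  have "A_mat M ** B = mat 1"
  proof (rule mat_apply_eqI)
    fix u v :: "real^'a"
    have "(1/2) *\<^sub>R (u + v) + (1/2) *\<^sub>R (u - v) = u" "(1/2) *\<^sub>R (u + v) - (1/2) *\<^sub>R (u - v) = v"
      by (simp_all add: algebra_simps flip: scaleR_left_distrib)
    then show "mat_apply (A_mat M ** B) (u, v) = mat_apply (mat 1) (u, v)"
      by (simp add: mat_apply_mult mat_apply_id mat_apply_A_mat B)
  qed
  then have "matrix_inv (A_mat M) = B" by (rule matrix_inv_eqI)
  then show ?thesis by (simp add: B)
qed

text \<open>
  The matrix for \<open>M + N\<close> is the matrix for \<open>M\<close> after a shear by \<open>N\<close>, which acts on the partially transformed test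
  function exactly as \<open>shear_multiplier\<close> does.  Both sides evaluate the same tensor product at the same function.
\<close>

lemma bilinear_tf_A_mat:
  fixes M N :: "real^'d^'d"
  assumes \<phi>: "\<phi> \<in> schwartz_space"
  shows "bilinear_tf (A_mat (M + N)) f h \<phi> = bilinear_tf (A_mat M) f h (shear_multiplier ((*v) N) \<phi>)"
proof -
  have "partial_fourier2 \<phi> (mat_apply (matrix_inv (A_mat (M + N))) w)
      = partial_fourier2 (shear_multiplier ((*v) N) \<phi>) (mat_apply (matrix_inv (A_mat M)) w)" for w
    by (cases w) (simp add: mat_apply_matrix_inv_A_mat partial_fourier2_shear_multiplier[OF matrix_vector_mul_linear \<phi>]
        matrix_vector_mult_add_rdistrib diff_diff_eq)
  then show ?thesis
    by (simp add: bilinear_tf_def distr_partial_fourier2_def distr_matrix_comp_def det_A_mat[of "M + N"] det_A_mat[of M])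
qed

theorem theorem1p2:
  fixes M :: "real^'d^'d" and G :: "(real^'d) \<times> (real^'d) \<Rightarrow> complex"
  assumes "invertible M"
    and "G \<in> schwartz_space" and "G \<noteq> (\<lambda>_. 0)"
  shows "theta M \<in> modulation_space G 1 \<infinity> \<inter> wiener_amalgam G 1 \<infinity> \<and>
    (\<forall>f \<in> tempered_distributions. \<forall>p q :: ennreal. 1 \<le> p \<longrightarrow> 1 \<le> q \<longrightarrow>
       (wigner f \<in> modulation_space G p q \<longleftrightarrow>
        bilinear_tf (A_mat M) f f \<in> modulation_space G p q))"
proof (intro conjI ballI allI impI)
  show "theta M \<in> modulation_space G 1 \<infinity> \<inter> wiener_amalgam G 1 \<infinity>"
    by (rule theta_in_modulation_space_and_wiener_amalgam[OF assms(1,2)])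
  fix f :: "(real^'d) distr" and p q :: ennreal
  assume p: "1 \<le> p" and q: "1 \<le> q"
  have transfer: "bilinear_tf (A_mat (K + N)) f f \<in> modulation_space G p q"
    if "bilinear_tf (A_mat K) f f \<in> modulation_space G p q" for K N :: "real^'d^'d"
    by (rule modulation_space_shear_multiplier[OF matrix_vector_mul_linear[of N] assms(2,3) p q that bilinear_tf_A_mat])
  show "wigner f \<in> modulation_space G p q \<longleftrightarrow> bilinear_tf (A_mat M) f f \<in> modulation_space G p q"
    using transfer[of 0 M] transfer[of M "- M"] by (auto simp: wigner_def)
qed

end
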